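(* Let $\mathbb M$ and $\mathbb H$ be partial groups. Then the following holds. (a) An $\mathbb H$-twisting pair $\phi=(t,\eta)$ for $\mathbb M$ defines an extension $\mathbb M\to\mathbb M\times_\phi\mathbb H\xrightarrow{\tau}\mathbb H$ of $\mathbb H$ by $\mathbb M$ (with fibre inclusion $x\mapsto (x,1)$ on $1$-simplices), whose total space $\mathbb M\times_\phi\mathbb H$ is a partial group with set of $1$-simplices $\mathbb M_1\times\mathbb H_1$ and with $n$-simplices the $[(x_1,g_1)|\dots|(x_n,g_n)]$, $x_i\in\mathbb M_1$, $g_i\in\mathbb H_1$, satisfying (i) $[g_1|\dots|g_n]\in\mathbb H_n$; and (ii) $[x_1\,|\,t(g_1)(x_2)\,|\,(t(g_1)\circ t(g_2))(x_3)\,|\dots|\,(t(g_1)\circ\dots\circ t(g_{n-1}))(x_n)]\in\mathbb M_n$. The product and inverse in $\mathbb M\times_\phi\mathbb H$ are given by $$\Pi[(x,g)|(z,h)]=[(x\cdot t(g)(z)\cdot\eta(g,h),\,g\cdot h)],$$ $$[(x,g)]^{-1}=[(\eta(g^{-1},g)^{-1}\cdot t(g^{-1})(x^{-1}),\,g^{-1})],$$ and the projection $\tau\colon\mathbb M\times_\phi\mathbb H\to\mathbb H$ is given on $n$-simplices by $\tau[(x_1,g_1)|\dots|(x_n,g_n)]=[g_1|\dots|g_n]$. (b) Given an extension $\mathbb M\to\mathbb E\xrightarrow{\rho}\mathbb H$, there is an $\mathbb H$-twisting pair $\phi=(t,\eta)$ for $\mathbb M$ and an equivalence of extensions $\mathbb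 M\times_\phi\mathbb H\cong\mathbb E$ (over the identity of $\mathbb H$). In particular, the total space of an extension of partial groups is again a partial group.
   Context: Partial groups. A partial monoid is a nonempty simplicial set $\mathbb M$ with exactly one vertex $v$ such that for all $n\ge1$ the spine map $\mathbb M_n\to(\mathbb M_1)^n$, whose $i$-th component is induced by the map $[1]\to[n]$ with image $\{i-1,i\}$, is injective. The $n$-simplex with spine $(x_1,\dots,x_n)$ is written $[x_1|\dots|x_n]$; writing $[x_1|\dots|x_n]\in\mathbb M$ asserts that such a simplex exists. $\Pi\colon\mathbb M_n\to\mathbb M_1$ is induced by $[1]\to[n]$ with image $\{0,n\}$; one writes $x_1\cdots x_n=\Pi[x_1|\dots|x_n]$ (its use asserts that the simplex exists), and $1=s_0(v)$. A partial group is a partial monoid with an inversion: a simplicial map $\nu\colon\mathbb M\to\mathbb M^{\mathrm{op}}$ with $\nu^{-1}=\nu^{\mathrm{op}}$ such that for every $u\in\mathbb M_n$, $n\ge1$, there is a simplex $[\nu(u)|u]\in\mathbb M_{2n}$ (concatenated spines) with $\Pi[\nu(u)|u]=1$; it is unique and one writes $u^{-1}=\nu(u)$. Homomorphisms are simplicial maps; $\mathrm{Aut}(\mathbb M)$ is the group of simplicial automorphisms. Homotopies. Let $\iota\in\Delta[1]_1$ be the nondegenerate edge, $v_0=d_1\iota$, $v_1=d_0\iota$. A homotopy from $g$ to $f$ (simplicial maps $Y\to X$) is a map $F\colon Y\times\Delta[1]\to X$ with $f=F\circ(\mathrm{Id}\times v_0)$, $g=F\circ(\mathrm{Id}\times v_1)$.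 For homomorphisms $f,g\colon\mathbb H\to\mathbb M$ of partial groups and $\eta\in\mathbb M_1$, write $f\xleftarrow{\eta}g$ ("$\eta$ determines a homotopy from $g$ to $f$") if there is a homotopy $F$ from $g$ to $f$ with $F(1,\iota)=\eta$. The normalizer $N(\mathbb M)$ is the set of $\eta\in\mathbb M_1$ for which there is an automorphism $c_\eta$ of $\mathbb M$ with $c_\eta\xleftarrow{\eta}1_{\mathbb M}$. Extensions. A fibre bundle with fibre $F$ is a surjective simplicial map $f\colon E\to B$ such that for each simplex $b\colon\Delta[n]\to B$ the pullback of $f$ along $b$ is isomorphic over $\Delta[n]$ to $F\times\Delta[n]$. An extension of $\mathbb H$ by $\mathbb M$ is a fibre bundle $\tau\colon\mathbb E\to\mathbb H$ with fibre $\mathbb M$, written $\mathbb M\to\mathbb E\to\mathbb H$, where $\mathbb M\to\mathbb E$ identifies $\mathbb M$ with the fibre over the vertex of $\mathbb H$. Two extensions $\mathbb M\to\mathbb E_i\to\mathbb H$, $i=1,2$, are equivalent if there is an isomorphism $\mathbb E_1\to\mathbb E_2$ of simplicial sets compatible with the identity of $\mathbb M$ and the identity of $\mathbb H$. Twisting pairs. An $\mathbb H$-twisting pair for $\mathbb M$ is a pair of functions $t\colon\mathbb H_1\to\mathrm{Aut}(\mathbb M)$, $\eta\colon\mathbb H_2\to N(\mathbb M)$ (written $\eta(g,h)=\eta([g|h])$) such that: (a) $t(g)\circ t(h)\xleftarrow{\eta(g,h)}t(gh)$ for each $[g|h]\in\mathbb H_2$; (b) $t(1)=\mathrm{Id}$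 and $\eta(g,1)=1=\eta(1,g)$ for all $g\in\mathbb H_1$; (c) $t(g)(\eta(h,k))\cdot\eta(g,hk)=\eta(g,h)\cdot\eta(gh,k)$ for all $[g|h|k]\in\mathbb H_3$. *)

theory Defs
  imports Main "HOL-Library.FuncSet"
begin

section \<open>Simplicial sets\<close>

text \<open>The monotone maps \<open>[m] \<rightarrow> [n]\<close>, where \<open>[n]\<close> is \<open>{..n}\<close>. All functions between sets
  are made extensional, so that equality of maps is equality in HOL.\<close>

definition ops :: "nat \<Rightarrow> nat \<Rightarrow> (nat \<Rightarrow> nat) set" where
  "ops m n = {\<theta> \<in> {..m} \<rightarrow>\<^sub>E {..n}. mono_on {..m} \<theta>}"

record 'a sset =
  simplices :: "nat \<Rightarrow> 'a set"
  act :: "nat \<Rightarrow> nat \<Rightarrow> (nat \<Rightarrow> nat) \<Rightarrow> 'a \<Rightarrow> 'a"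

text \<open>\<^term>\<open>act X m n \<theta>\<close> is the operator \<open>X\<^sub>n \<rightarrow> X\<^sub>m\<close> induced by \<open>\<theta> : [m] \<rightarrow> [n]\<close>. The sets
  \<^term>\<open>simplices X n\<close> for different \<open>n\<close> need not be disjoint, so dimensions are always explicit.\<close>

definition sset :: "'a sset \<Rightarrow> bool" where
  "sset X \<longleftrightarrow>
     (\<forall>m n. \<forall>\<theta>\<in>ops m n. act X m n \<theta> \<in> simplices X n \<rightarrow> simplices X m) \<and>
     (\<forall>n. \<forall>x\<in>simplices X n. act X n n (\<lambda>i\<in>{..n}. i) x = x) \<and>
     (\<forall>k m n. \<forall>\<alpha>\<in>ops k m. \<forall>\<beta>\<in>ops m n. \<forall>x\<in>simplices X n.
        act X k n (compose {..k} \<beta> \<alpha>) x = act X k m \<alpha> (act X m n \<beta> x))"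

definition smap :: "'a sset \<Rightarrow> 'b sset \<Rightarrow> (nat \<Rightarrow> 'a \<Rightarrow> 'b) \<Rightarrow> bool" where
  "smap X Y f \<longleftrightarrow>
     (\<forall>n. f n \<in> simplices X n \<rightarrow>\<^sub>E simplices Y n) \<and>
     (\<forall>m n. \<forall>\<theta>\<in>ops m n. \<forall>x\<in>simplices X n. f m (act X m n \<theta> x) = act Y m n \<theta> (f n x))"

definition sid :: "'a sset \<Rightarrow> nat \<Rightarrow> 'a \<Rightarrow> 'a" where
  "sid X = (\<lambda>n. \<lambda>x\<in>simplices X n. x)"

definition scomp :: "'a sset \<Rightarrow> (nat \<Rightarrow> 'b \<Rightarrow> 'c) \<Rightarrow> (nat \<Rightarrow> 'a \<Rightarrow> 'b) \<Rightarrow> nat \<Rightarrow> 'a \<Rightarrow> 'c" where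
  "scomp X g f = (\<lambda>n. compose (simplices X n) (g n) (f n))"

definition siso :: "'a sset \<Rightarrow> 'b sset \<Rightarrow> (nat \<Rightarrow> 'a \<Rightarrow> 'b) \<Rightarrow> bool" where
  "siso X Y f \<longleftrightarrow>
     smap X Y f \<and> (\<exists>g. smap Y X g \<and> scomp X g f = sid X \<and> scomp Y f g = sid Y)"

definition Aut :: "'a sset \<Rightarrow> (nat \<Rightarrow> 'a \<Rightarrow> 'a) set" where
  "Aut X = {f. siso X X f}"

definition std_simplex :: "nat \<Rightarrow> (nat \<Rightarrow> nat) sset" where
  "std_simplex n = \<lparr> simplices = (\<lambda>m. ops m n), act = (\<lambda>k m \<theta> x. compose {..k} x \<theta>) \<rparr>"

definition sprod :: "'a sset \<Rightarrow> 'b sset \<Rightarrow> ('a \<times> 'b) sset" where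
  "sprod X Y = \<lparr> simplices = (\<lambda>n. simplices X n \<times> simplices Y n),
                act = (\<lambda>m n \<theta> (x, y). (act X m n \<theta> x, act Y m n \<theta> y)) \<rparr>"

definition sop :: "'a sset \<Rightarrow> 'a sset" where
  "sop X = \<lparr> simplices = simplices X,
            act = (\<lambda>m n \<theta>. act X m n (\<lambda>i\<in>{..m}. n - \<theta> (m - i))) \<rparr>"

text \<open>The \<open>n\<close>-simplex degenerate on the vertex \<open>v\<close>.\<close>

definition degen :: "'a sset \<Rightarrow> nat \<Rightarrow> 'a \<Rightarrow> 'a" where
  "degen X n v = act X n 0 (\<lambda>i\<in>{..n}. 0) v"

text \<open>The map \<open>[n] \<rightarrow> [n+1]\<close> that omits \<open>i\<close>.\<close>

definition coface :: "nat \<Rightarrow> nat \<Rightarrow> nat \<Rightarrow> nat" where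
  "coface n i = (\<lambda>j\<in>{..n}. if j < i then j else Suc j)"


section \<open>Partial groups\<close>

definition edge :: "'a sset \<Rightarrow> nat \<Rightarrow> nat \<Rightarrow> nat \<Rightarrow> 'a \<Rightarrow> 'a" where
  "edge X n i j u = act X 1 n (\<lambda>k\<in>{..1}. if k = 0 then i else j) u"

definition spine :: "'a sset \<Rightarrow> nat \<Rightarrow> 'a \<Rightarrow> 'a list" where
  "spine X n u = map (\<lambda>i. edge X n i (Suc i) u) [0..<n]"

definition partial_monoid :: "'a sset \<Rightarrow> bool" where
  "partial_monoid X \<longleftrightarrow>
     sset X \<and> (\<exists>!v. v \<in> simplices X 0) \<and> (\<forall>n\<ge>1. inj_on (spine X n) (simplices X n))"

definition vertex :: "'a sset \<Rightarrow> 'a" where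
  "vertex X = (THE v. v \<in> simplices X 0)"

definition one :: "'a sset \<Rightarrow> 'a" where
  "one X = degen X 1 (vertex X)"

definition is_word :: "'a sset \<Rightarrow> 'a list \<Rightarrow> bool" where
  "is_word X xs \<longleftrightarrow> (\<exists>u\<in>simplices X (length xs). spine X (length xs) u = xs)"

definition word :: "'a sset \<Rightarrow> 'a list \<Rightarrow> 'a" where
  "word X xs = (THE u. u \<in> simplices X (length xs) \<and> spine X (length xs) u = xs)"

definition wprod :: "'a sset \<Rightarrow> 'a list \<Rightarrow> 'a" where
  "wprod X xs = edge X (length xs) 0 (length xs) (word X xs)"

text \<open>\<^term>\<open>is_word X [x, y]\<close> is the assertion \<open>[x|y] \<in> X\<close>, \<^term>\<open>word X [x, y]\<close> is that simplex,
  and \<^term>\<open>wprod X [x, y]\<close> is the product \<open>x \<cdot> y\<close>; similarly for lists of any length.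
  The last two are meaningful only if \<^const>\<open>is_word\<close> holds, so this is asserted separately
  wherever the existence of the simplex is part of the claim.\<close>

text \<open>\<open>\<nu>\<^sup>o\<^sup>p\<close> has the same underlying functions as \<open>\<nu>\<close>, so \<open>\<nu>\<^sup>-\<^sup>1 = \<nu>\<^sup>o\<^sup>p\<close> says that each \<^term>\<open>\<nu> n\<close>
  is an involution.\<close>

definition inversion :: "'a sset \<Rightarrow> (nat \<Rightarrow> 'a \<Rightarrow> 'a) \<Rightarrow> bool" where
  "inversion X \<nu> \<longleftrightarrow>
     smap X (sop X) \<nu> \<and> scomp X \<nu> \<nu> = sid X \<and>
     (\<forall>n\<ge>1. \<forall>u\<in>simplices X n.
        is_word X (spine X n (\<nu> n u) @ spine X n u) \<and>
        wprod X (spine X n (\<nu> n u) @ spine X n u) = one X)"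

definition partial_group :: "'a sset \<Rightarrow> bool" where
  "partial_group X \<longleftrightarrow> partial_monoid X \<and> (\<exists>\<nu>. inversion X \<nu>)"

text \<open>The inversion of a partial group is unique: compare \<open>\<nu>'(x) \<cdot> (x \<cdot> \<nu>(x))\<close> with
  \<open>(\<nu>'(x) \<cdot> x) \<cdot> \<nu>(x)\<close> in the simplex \<open>[\<nu>'(u)|u]\<close> for \<open>u = [x|\<nu>(x)]\<close>.\<close>

lemma edge_act:
  assumes "sset X" "\<theta> \<in> ops m n" "i \<le> j" "j \<le> m" "u \<in> simplices X n"
  shows "edge X m i j (act X m n \<theta> u) = edge X n (\<theta> i) (\<theta> j) u"
proof -
  let ?e = "\<lambda>k\<in>{..1::nat}. if k = 0 then i else j"
  have e: "?e \<in> ops 1 m"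
    using assms(3,4) by (auto simp: ops_def mono_on_def)
  have "compose {..1} \<theta> ?e = (\<lambda>k\<in>{..1::nat}. if k = 0 then \<theta> i else \<theta> j)"
    by (auto simp: compose_def fun_eq_iff)
  then show ?thesis
    using assms(1,2,5) e unfolding sset_def edge_def by metis
qed

lemma edge_in:
  assumes "sset X" "i \<le> j" "j \<le> n" "u \<in> simplices X n"
  shows "edge X n i j u \<in> simplices X 1"
proof -
  have "(\<lambda>k\<in>{..1::nat}. if k = 0 then i else j) \<in> ops 1 n"
    using assms(2,3) by (auto simp: ops_def mono_on_def)
  then show ?thesis using assms unfolding sset_def edge_def by blast
qed

lemma edge_01: assumes "sset X" "x \<in> simplices X 1" shows "edge X 1 0 1 x = x"
proof -
  have "(\<lambda>k\<in>{..1::nat}. if k = 0 then 0 else 1) = (\<lambda>k\<in>{..1::nat}. k)"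
    by (auto simp: fun_eq_iff)
  then show ?thesis using assms unfolding sset_def edge_def by simp
qed

lemma edge_deg:
  assumes "partial_monoid X" "i \<le> n" "u \<in> simplices X n"
  shows "edge X n i i u = one X"
proof -
  have X: "sset X" using assms by (simp add: partial_monoid_def)
  let ?c = "\<lambda>k\<in>{..1::nat}. 0::nat" and ?d = "\<lambda>k\<in>{..0::nat}. i"
  have c: "?c \<in> ops 1 0" and d: "?d \<in> ops 0 n" using assms(2) by (auto simp: ops_def mono_on_def)
  have "compose {..1} ?d ?c = (\<lambda>k\<in>{..1::nat}. if k = 0 then i else i)"
    by (auto simp: compose_def fun_eq_iff)
  then have 1: "edge X n i i u = act X 1 0 ?c (act X 0 n ?d u)"
    using X c d assms(3) unfolding sset_def edge_def by metis
  have "act X 0 n ?d u \<in> simplices X 0" using X d assms(3) unfolding sset_def by blast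
  then have "act X 0 n ?d u = vertex X"
    using assms(1) unfolding partial_monoid_def vertex_def by (metis the1_equality)
  with 1 show ?thesis by (simp add: one_def degen_def)
qed

lemma word_eq:
  assumes "partial_monoid X" "u \<in> simplices X (length xs)" "spine X (length xs) u = xs" "xs \<noteq> []"
  shows "word X xs = u"
  unfolding word_def using assms
  by (intro the_equality) (auto simp: partial_monoid_def inj_on_def Suc_le_eq)

lemma simplex2_eq:
  assumes "partial_monoid X" "u \<in> simplices X 2" "v \<in> simplices X 2"
    "edge X 2 0 1 u = edge X 2 0 1 v" "edge X 2 1 2 u = edge X 2 1 2 v"
  shows "u = v"
proof -
  have "spine X 2 u = spine X 2 v"
    using assms(4,5) by (simp add: spine_def upt_rec[of 0] upt_rec[of "Suc 0"] numeral_2_eq_2)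
  moreover have "inj_on (spine X 2) (simplices X 2)"
    using assms(1) by (simp add: partial_monoid_def)
  ultimately show ?thesis using assms(2,3) by (meson inj_onD)
qed

lemma inversionD:
  assumes "partial_monoid X" "inversion X \<nu>" "n \<ge> 1" "u \<in> simplices X n"
  shows "\<exists>w\<in>simplices X (2 * n). spine X (2 * n) w = spine X n (\<nu> n u) @ spine X n u \<and>
           edge X (2 * n) 0 (2 * n) w = one X"
proof -
  let ?l = "spine X n (\<nu> n u) @ spine X n u"
  have l: "length ?l = 2 * n" by (simp add: spine_def)
  have "is_word X ?l" "wprod X ?l = one X" using assms by (auto simp: inversion_def)
  then show ?thesis using l assms(3) word_eq[OF assms(1), of _ ?l]
    unfolding is_word_def wprod_def
    by (metis (no_types, lifting) length_0_conv mult_eq_0_iff not_one_le_zero zero_neq_numeral)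
qed

lemma inversion_edge:
  assumes "sset X" "inversion X \<nu>" "u \<in> simplices X n" "i \<le> j" "j \<le> n"
  shows "edge X n i j (\<nu> n u) = \<nu> 1 (edge X n (n - j) (n - i) u)"
proof -
  let ?\<theta> = "\<lambda>k\<in>{..1::nat}. if k = 0 then n - j else n - i"
  have \<theta>: "?\<theta> \<in> ops 1 n" using assms(4,5) by (auto simp: ops_def mono_on_def)
  have eq: "(\<lambda>k\<in>{..1::nat}. n - ?\<theta> (1 - k)) = (\<lambda>k\<in>{..1::nat}. if k = 0 then i else j)"
    using assms(4,5) by (auto simp: fun_eq_iff)
  have "\<nu> 1 (act X 1 n ?\<theta> u) = act (sop X) 1 n ?\<theta> (\<nu> n u)"
    using assms(2,3) \<theta> unfolding inversion_def smap_def by blast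
  then show ?thesis unfolding edge_def sop_def by (simp only: sset.simps eq)
qed

lemma inversion_in: "inversion X \<nu> \<Longrightarrow> u \<in> simplices X n \<Longrightarrow> \<nu> n u \<in> simplices X n"
  by (auto simp: inversion_def smap_def sop_def PiE_iff)

lemma inversion_invol: "inversion X \<nu> \<Longrightarrow> u \<in> simplices X n \<Longrightarrow> \<nu> n (\<nu> n u) = u"
  unfolding inversion_def scomp_def sid_def by (metis (no_types, lifting) compose_eq restrict_apply')

lemma inversion_pair:
  assumes "partial_monoid X" "inversion X \<nu>" "x \<in> simplices X 1"
  obtains p where "p \<in> simplices X 2" "edge X 2 0 1 p = \<nu> 1 x" "edge X 2 1 2 p = x"
    "edge X 2 0 2 p = one X"
proof -
  have X: "sset X" using assms by (simp add: partial_monoid_def)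
  have s: "spine X 1 y = [y]" if "y \<in> simplices X 1" for y
    using edge_01[OF X that] by (simp add: spine_def)
  obtain p where p: "p \<in> simplices X 2" "spine X 2 p = [\<nu> 1 x, x]" "edge X 2 0 2 p = one X"
    using inversionD[OF assms(1,2) _ assms(3)] s inversion_in[OF assms(2,3)] assms(3) by auto
  show ?thesis using p that
    by (simp add: spine_def upt_rec[of 0] upt_rec[of "Suc 0"] numeral_2_eq_2)
qed

lemma inversion_unique1:
  assumes pm: "partial_monoid X" and \<nu>: "inversion X \<nu>" and \<nu>': "inversion X \<nu>'"
    and x: "x \<in> simplices X 1"
  shows "\<nu> 1 x = \<nu>' 1 x"
proof -
  have X: "sset X" using pm by (simp add: partial_monoid_def)
  have nx: "\<nu> 1 x \<in> simplices X 1" "\<nu>' 1 x \<in> simplices X 1"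
    using inversion_in[OF \<nu> x] inversion_in[OF \<nu>' x] .
  obtain u where u: "u \<in> simplices X 2" "edge X 2 0 1 u = x" "edge X 2 1 2 u = \<nu> 1 x"
    "edge X 2 0 2 u = one X"
    using inversion_pair[OF pm \<nu> nx(1)] inversion_invol[OF \<nu> x] by metis
  obtain p where p: "p \<in> simplices X 2" "edge X 2 0 1 p = \<nu>' 1 x" "edge X 2 1 2 p = x"
    "edge X 2 0 2 p = one X"
    using inversion_pair[OF pm \<nu>' x] by metis
  obtain w where w: "w \<in> simplices X 4" "spine X 4 w = spine X 2 (\<nu>' 2 u) @ spine X 2 u"
    using inversionD[OF pm \<nu>' _ u(1)] by auto
  have n2: "edge X 2 1 2 (\<nu>' 2 u) = \<nu>' 1 x"
    using inversion_edge[OF X \<nu>' u(1), of 1 2] u(2) by simp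
  have w': "edge X 4 1 2 w = \<nu>' 1 x" "edge X 4 2 3 w = x" "edge X 4 3 4 w = \<nu> 1 x"
  proof -
    have "spine X 4 w ! 1 = \<nu>' 1 x" "spine X 4 w ! 2 = x" "spine X 4 w ! 3 = \<nu> 1 x"
      using n2 u(2,3) unfolding w(2) by (auto simp: spine_def nth_append numeral_2_eq_2)
    then show "edge X 4 1 2 w = \<nu>' 1 x" "edge X 4 2 3 w = x" "edge X 4 3 4 w = \<nu> 1 x"
      by (auto simp: spine_def numeral_2_eq_2 numeral_3_eq_3 eval_nat_numeral)
  qed
  let ?f = "\<lambda>a b c. (\<lambda>k\<in>{..2::nat}. if k = 0 then a else if k = 1 then b else (c::nat))"
  have f: "?f a b c \<in> ops 2 n" if "a \<le> b" "b \<le> c" "c \<le> n" for a b c n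
    using that by (auto simp: ops_def mono_on_def)
  have fin: "act X 2 n (?f a b c) y \<in> simplices X 2"
    if "a \<le> b" "b \<le> c" "c \<le> n" "y \<in> simplices X n" for a b c n y
    using X f[OF that(1-3)] that(4) unfolding sset_def by blast
  have fe: "edge X 2 0 1 (act X 2 n (?f a b c) y) = edge X n a b y"
    "edge X 2 1 2 (act X 2 n (?f a b c) y) = edge X n b c y"
    "edge X 2 0 2 (act X 2 n (?f a b c) y) = edge X n a c y"
    if "a \<le> b" "b \<le> c" "c \<le> n" "y \<in> simplices X n" for a b c n y
    using edge_act[OF X f[OF that(1-3)] _ _ that(4)] by simp_all
  have "act X 2 4 (?f 2 3 4) w = u"
    by (rule simplex2_eq[OF pm]) (simp_all add: fin fe w(1) w' u del: One_nat_def)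
  then have e24: "edge X 4 2 4 w = one X" using fe(3)[of 2 3 4 4 w] u(4) w(1) by (simp del: One_nat_def)
  have "act X 2 4 (?f 1 2 3) w = p"
    by (rule simplex2_eq[OF pm]) (simp_all add: fin fe w(1) w' p del: One_nat_def)
  then have e13: "edge X 4 1 3 w = one X" using fe(3)[of 1 2 3 4 w] p(4) w(1) by (simp del: One_nat_def)
  have "act X 2 4 (?f 1 2 4) w = act X 2 1 (?f 0 1 1) (\<nu>' 1 x)"
    by (rule simplex2_eq[OF pm])
      (use w(1) w' nx e24 in \<open>simp_all add: fin fe edge_deg[OF pm] edge_01[OF X] del: One_nat_def\<close>)
  then have 1: "edge X 4 1 4 w = \<nu>' 1 x"
    using fe(3)[of 1 2 4 4 w] fe(3)[of 0 1 1 1 "\<nu>' 1 x"] w(1) nx edge_01[OF X nx(2)] by (simp del: One_nat_def)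
  have "act X 2 4 (?f 1 3 4) w = act X 2 1 (?f 0 0 1) (\<nu> 1 x)"
    by (rule simplex2_eq[OF pm])
      (use w(1) w' nx e13 in \<open>simp_all add: fin fe edge_deg[OF pm] edge_01[OF X] del: One_nat_def\<close>)
  then have 2: "edge X 4 1 4 w = \<nu> 1 x"
    using fe(3)[of 1 3 4 4 w] fe(3)[of 0 0 1 1 "\<nu> 1 x"] w(1) nx edge_01[OF X nx(1)] by (simp del: One_nat_def)
  from 1 2 show ?thesis by simp
qed

lemma inversion_unique:
  assumes pm: "partial_monoid X" and \<nu>: "inversion X \<nu>" and \<nu>': "inversion X \<nu>'"
  shows "\<nu> = \<nu>'"
proof (intro ext)
  fix n u
  have X: "sset X" using pm by (simp add: partial_monoid_def)
  show "\<nu> n u = \<nu>' n u"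
  proof (cases "u \<in> simplices X n")
    case False
    then show ?thesis using \<nu> \<nu>' by (simp add: inversion_def smap_def PiE_iff extensional_def)
  next
    case u: True
    show ?thesis
    proof (cases "n = 0")
      case True
      then show ?thesis using pm inversion_in[OF \<nu> u] inversion_in[OF \<nu>' u]
        unfolding partial_monoid_def by blast
    next
      case False
      have "spine X n (\<nu> n u) = spine X n (\<nu>' n u)"
        unfolding spine_def
        by (simp add: inversion_edge[OF X \<nu> u] inversion_edge[OF X \<nu>' u]
            inversion_unique1[OF pm \<nu> \<nu>'] edge_in[OF X _ _ u] del: One_nat_def)
      then show ?thesis using pm False inversion_in[OF \<nu> u] inversion_in[OF \<nu>' u]
        unfolding partial_monoid_def inj_on_def by (metis One_nat_def Suc_leI gr0I)
    qed
  qed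
qed

definition inversion_of :: "'a sset \<Rightarrow> nat \<Rightarrow> 'a \<Rightarrow> 'a" where
  "inversion_of X = (THE \<nu>. inversion X \<nu>)"

lemma inversion_of_eq: "partial_group X \<Longrightarrow> inversion X \<nu> \<Longrightarrow> inversion_of X = \<nu>"
  unfolding inversion_of_def partial_group_def
  by (blast intro: the_equality inversion_unique)

abbreviation inv1 :: "'a sset \<Rightarrow> 'a \<Rightarrow> 'a" where
  "inv1 X \<equiv> inversion_of X 1"


section \<open>Homotopies and the normalizer\<close>

definition iota :: "nat \<Rightarrow> nat" where
  "iota = (\<lambda>i\<in>{..1}. i)"

definition v0 :: "nat \<Rightarrow> nat" where
  "v0 = act (std_simplex 1) 0 1 (coface 0 1) iota"

definition v1 :: "nat \<Rightarrow> nat" where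
  "v1 = act (std_simplex 1) 0 1 (coface 0 0) iota"

lemma v0_eq: "v0 = (\<lambda>i\<in>{..0}. 0)" and v1_eq: "v1 = (\<lambda>i\<in>{..0}. 1)"
  by (auto simp: v0_def v1_def std_simplex_def compose_def coface_def iota_def fun_eq_iff)

text \<open>The map \<open>Id \<times> v : Y \<rightarrow> Y \<times> \<Delta>[1]\<close> for a vertex \<open>v\<close> of \<open>\<Delta>[1]\<close>.\<close>

definition cyl_end :: "'a sset \<Rightarrow> (nat \<Rightarrow> nat) \<Rightarrow> nat \<Rightarrow> 'a \<Rightarrow> 'a \<times> (nat \<Rightarrow> nat)" where
  "cyl_end Y v = (\<lambda>n. \<lambda>y\<in>simplices Y n. (y, degen (std_simplex 1) n v))"

text \<open>\<open>F\<close> is a homotopy from \<open>g\<close> to \<open>f\<close>; note that \<open>f\<close> sits at the vertex \<^const>\<open>v0\<close>.\<close>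

definition homotopy ::
  "'a sset \<Rightarrow> 'b sset \<Rightarrow> (nat \<Rightarrow> 'a \<Rightarrow> 'b) \<Rightarrow> (nat \<Rightarrow> 'a \<Rightarrow> 'b) \<Rightarrow>
    (nat \<Rightarrow> 'a \<times> (nat \<Rightarrow> nat) \<Rightarrow> 'b) \<Rightarrow> bool" where
  "homotopy Y X g f F \<longleftrightarrow>
     smap (sprod Y (std_simplex 1)) X F \<and>
     f = scomp Y F (cyl_end Y v0) \<and> g = scomp Y F (cyl_end Y v1)"

definition htpc ::
  "'b sset \<Rightarrow> 'a sset \<Rightarrow> (nat \<Rightarrow> 'b \<Rightarrow> 'a) \<Rightarrow> 'a \<Rightarrow> (nat \<Rightarrow> 'b \<Rightarrow> 'a) \<Rightarrow> bool" where
  "htpc H M f \<eta> g \<longleftrightarrow> (\<exists>F. homotopy H M g f F \<and> F 1 (one H, iota) = \<eta>)"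

text \<open>\<^term>\<open>htpc H M f \<eta> g\<close> is \<open>f \<leftarrow>\<^sup>\<eta> g\<close>.\<close>

definition normalizer :: "'a sset \<Rightarrow> 'a set" where
  "normalizer M = {\<eta> \<in> simplices M 1. \<exists>c\<in>Aut M. htpc M M c \<eta> (sid M)}"


section \<open>Fibre bundles and extensions\<close>

text \<open>The pullback of \<open>f : E \<rightarrow> B\<close> along the map \<open>\<Delta>[n] \<rightarrow> B\<close> given by \<open>b \<in> B\<^sub>n\<close>, which sends
  \<open>\<theta> : [m] \<rightarrow> [n]\<close> to \<open>act B m n \<theta> b\<close>.\<close>

definition pullback ::
  "'e sset \<Rightarrow> 'b sset \<Rightarrow> (nat \<Rightarrow> 'e \<Rightarrow> 'b) \<Rightarrow> nat \<Rightarrow> 'b \<Rightarrow> ('e \<times> (nat \<Rightarrow> nat)) sset" where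
  "pullback E B f n b =
     \<lparr> simplices = (\<lambda>m. {(e, \<theta>). e \<in> simplices E m \<and> \<theta> \<in> simplices (std_simplex n) m \<and>
                              f m e = act B m n \<theta> b}),
       act = act (sprod E (std_simplex n)) \<rparr>"

definition fibre_bundle ::
  "'f sset \<Rightarrow> 'e sset \<Rightarrow> 'b sset \<Rightarrow> (nat \<Rightarrow> 'e \<Rightarrow> 'b) \<Rightarrow> bool" where
  "fibre_bundle F E B f \<longleftrightarrow>
     sset F \<and> sset E \<and> sset B \<and> smap E B f \<and>
     (\<forall>n. f n ` simplices E n = simplices B n) \<and>
     (\<forall>n. \<forall>b\<in>simplices B n. \<exists>\<psi>.
        siso (pullback E B f n b) (sprod F (std_simplex n)) \<psi> \<and>
        (\<forall>m. \<forall>p\<in>simplices (pullback E B f n b) m. snd (\<psi> m p) = snd p))"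

definition fibre :: "'e sset \<Rightarrow> 'b sset \<Rightarrow> (nat \<Rightarrow> 'e \<Rightarrow> 'b) \<Rightarrow> 'b \<Rightarrow> 'e sset" where
  "fibre E B f v =
     \<lparr> simplices = (\<lambda>n. {e \<in> simplices E n. f n e = degen B n v}), act = act E \<rparr>"

text \<open>\<^term>\<open>i : M \<rightarrow> E\<close> is the fibre inclusion and \<open>\<tau> : E \<rightarrow> H\<close> the projection.\<close>

definition extension ::
  "'a sset \<Rightarrow> 'e sset \<Rightarrow> 'b sset \<Rightarrow> (nat \<Rightarrow> 'a \<Rightarrow> 'e) \<Rightarrow> (nat \<Rightarrow> 'e \<Rightarrow> 'b) \<Rightarrow> bool" where
  "extension M E H i \<tau> \<longleftrightarrow> fibre_bundle M E H \<tau> \<and> siso M (fibre E H \<tau> (vertex H)) i"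

definition equivalent_extensions ::
  "'a sset \<Rightarrow> 'e sset \<Rightarrow> (nat \<Rightarrow> 'a \<Rightarrow> 'e) \<Rightarrow> (nat \<Rightarrow> 'e \<Rightarrow> 'b) \<Rightarrow>
    'f sset \<Rightarrow> (nat \<Rightarrow> 'a \<Rightarrow> 'f) \<Rightarrow> (nat \<Rightarrow> 'f \<Rightarrow> 'b) \<Rightarrow> bool" where
  "equivalent_extensions M E i \<tau> E' i' \<tau>' \<longleftrightarrow>
     (\<exists>\<psi>. siso E E' \<psi> \<and> scomp M \<psi> i = i' \<and> scomp E \<tau>' \<psi> = \<tau>)"


section \<open>Twisting pairs\<close>

text \<open>\<open>\<eta>\<close> is a function on 2-simplices; \<open>\<eta>(g,h)\<close> is \<^term>\<open>\<eta> (word H [g, h])\<close>.\<close>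

definition twisting_pair ::
  "'a sset \<Rightarrow> 'b sset \<Rightarrow> ('b \<Rightarrow> nat \<Rightarrow> 'a \<Rightarrow> 'a) \<Rightarrow> ('b \<Rightarrow> 'a) \<Rightarrow> bool" where
  "twisting_pair M H t \<eta> \<longleftrightarrow>
     t \<in> simplices H 1 \<rightarrow> Aut M \<and> \<eta> \<in> simplices H 2 \<rightarrow> normalizer M \<and>
     (\<forall>g h. is_word H [g, h] \<longrightarrow>
        htpc M M (scomp M (t g) (t h)) (\<eta> (word H [g, h])) (t (wprod H [g, h]))) \<and>
     t (one H) = sid M \<and>
     (\<forall>g\<in>simplices H 1. \<eta> (word H [g, one H]) = one M \<and> \<eta> (word H [one H, g]) = one M) \<and>
     (\<forall>g h k. is_word H [g, h, k] \<longrightarrow>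
        (let l = [t g 1 (\<eta> (word H [h, k])), \<eta> (word H [g, wprod H [h, k]])];
             r = [\<eta> (word H [g, h]), \<eta> (word H [wprod H [g, h], k])]
         in is_word M l \<and> is_word M r \<and> wprod M l = wprod M r))"

text \<open>The list whose \<open>i\<close>-th entry is \<open>(t(g\<^sub>1) \<circ> \<dots> \<circ> t(g\<^sub>i\<^sub>-\<^sub>1))(x\<^sub>i)\<close> for \<open>ws = [(x\<^sub>1,g\<^sub>1), \<dots>, (x\<^sub>n,g\<^sub>n)]\<close>.\<close>

definition twisted_spine :: "('b \<Rightarrow> nat \<Rightarrow> 'a \<Rightarrow> 'a) \<Rightarrow> ('a \<times> 'b) list \<Rightarrow> 'a list" where
  "twisted_spine t ws =
     map (\<lambda>i. foldr (\<lambda>g. t g 1) (map snd (take i ws)) (fst (ws ! i))) [0..<length ws]"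

definition tw_mult ::
  "'a sset \<Rightarrow> 'b sset \<Rightarrow> ('b \<Rightarrow> nat \<Rightarrow> 'a \<Rightarrow> 'a) \<Rightarrow> ('b \<Rightarrow> 'a) \<Rightarrow> 'a \<times> 'b \<Rightarrow> 'a \<times> 'b \<Rightarrow> 'a \<times> 'b" where
  "tw_mult M H t \<eta> =
     (\<lambda>(x, g) (z, h). (wprod M [x, t g 1 z, \<eta> (word H [g, h])], wprod H [g, h]))"

text \<open>The total space \<open>M \<times>\<^sub>\<phi> H\<close>. An \<open>n\<close>-simplex is identified with its spine, a list of \<open>n\<close> pairs;
  in particular the 1-simplex \<open>(x,g)\<close> is the list \<open>[(x,g)]\<close> and the vertex is the empty list.
  As in any partial monoid, the \<open>i\<close>-th spine entry of \<open>\<theta>\<^sup>*w\<close> is the (iterated, possibly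
  empty) product of the spine entries of \<open>w\<close> between the vertices \<open>\<theta>(i-1)\<close> and \<open>\<theta>(i)\<close>.\<close>

definition twisted_product ::
  "'a sset \<Rightarrow> 'b sset \<Rightarrow> ('b \<Rightarrow> nat \<Rightarrow> 'a \<Rightarrow> 'a) \<Rightarrow> ('b \<Rightarrow> 'a) \<Rightarrow> ('a \<times> 'b) list sset" where
  "twisted_product M H t \<eta> =
     \<lparr> simplices = (\<lambda>n. {ws. length ws = n \<and> set ws \<subseteq> simplices M 1 \<times> simplices H 1 \<and>
                           is_word H (map snd ws) \<and> is_word M (twisted_spine t ws)}),
       act = (\<lambda>m n \<theta> ws.
         map (\<lambda>i. foldl (tw_mult M H t \<eta>) (one M, one H) (map ((!) ws) [\<theta> i..<\<theta> (Suc i)])) [0..<m]) \<rparr>"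

definition tw_incl ::
  "'a sset \<Rightarrow> 'b sset \<Rightarrow> nat \<Rightarrow> 'a \<Rightarrow> ('a \<times> 'b) list" where
  "tw_incl M H = (\<lambda>n. \<lambda>u\<in>simplices M n. map (\<lambda>x. (x, one H)) (spine M n u))"

definition tw_proj ::
  "'a sset \<Rightarrow> 'b sset \<Rightarrow> ('b \<Rightarrow> nat \<Rightarrow> 'a \<Rightarrow> 'a) \<Rightarrow> ('b \<Rightarrow> 'a) \<Rightarrow> nat \<Rightarrow> ('a \<times> 'b) list \<Rightarrow> 'b" where
  "tw_proj M H t \<eta> =
     (\<lambda>n. \<lambda>ws\<in>simplices (twisted_product M H t \<eta>) n. word H (map snd ws))"

end

theory Submission
  imports Defs
begin

text \<open>
  A partial group is handled through the set of its words with the iterated product: a set of words closed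
  under factors, contraction of adjacent letters and insertion of 1 is the same as a partial monoid.
  In these terms \<open>f \<leftarrow>\<^sup>\<eta> g\<close> says that \<open>f(u)|\<eta>|g(v)\<close> is a word whenever \<open>u|v\<close> is one, and that
  \<open>f(x) \<eta> = \<eta> g(x)\<close>. Hence in a word of the semidirect product of \<open>M\<close> with its automorphisms a letter
  \<open>(x, f)\<close> may be replaced by \<open>(x \<eta>, g)\<close>. Products and inverses in the twisted product are those of the
  semidirect product followed by such replacements, and so is a change of coordinates at the vertices of a
  simplex, which gives local triviality.

  Conversely, trivialize an extension over each edge \<open>g\<close> of \<open>H\<close> so that it is the fibre inclusion at the
  terminal vertex. This gives \<open>s(g) \<in> E\<^sub>1\<close> over \<open>g\<close> and \<open>t(g)\<close> with \<open>t(g)(x) s(g) = s(g) x\<close>, and every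
  edge of \<open>E\<close> is \<open>x s(g)\<close> for a unique \<open>x\<close>. Comparing a trivialization over a simplex of \<open>H\<close>
  with those over its edges shows that the words of \<open>E\<close> are those of the twisted product, and
  \<open>s(g) s(h) = \<eta>(g,h) s(gh)\<close> defines \<open>\<eta>\<close>.
\<close>

section \<open>Simplicial operators and edges\<close>

text \<open>The obstacle is that products are partial: \<open>[x, y]\<close> and
  \<open>[y, z]\<close> being words does not make \<open>[x, y, z]\<close> one, and an equation
  between products can be used only inside a word known to exist. Every calculation therefore first
  produces the words through which it passes. Apart from units and inverses, new letters enter words
  in one way: an element that intertwines two automorphisms fits into every word, because the
  letters before it are the values of an automorphism on another word.

  In the local trivialization over a simplex \<open>b\<close>, the coordinate \<open>x\<close> on
  the edge from \<open>i\<close> to \<open>j\<close> stands for the edge \<open>p\<close> of the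
  twisted product with \<open>(1, b_0i) p = (x, b_0j)\<close>. So multiplicativity of the
  trivialization is a matter of cancelling on the left.

  In the converse, identities for \<open>t\<close> and \<open>\<eta>\<close> are multiplied by some
  \<open>s(k)\<close>, calculated in \<open>E\<close>, and read off from the uniqueness of
  \<open>x\<close> in \<open>x s(k)\<close>. The trivialization over the degenerate edge is
  prescribed, because an arbitrary choice there would not give \<open>t(1) = Id\<close> and
  \<open>s(1) = 1\<close>.\<close>

declare One_nat_def [simp del]

lemma opsI: "\<lbrakk>\<And>i. i \<le> m \<Longrightarrow> f i \<le> n; \<And>i j. \<lbrakk>i \<le> j; j \<le> m\<rbrakk> \<Longrightarrow> f i \<le> f j\<rbrakk>
    \<Longrightarrow> (\<lambda>i\<in>{..m}. f i) \<in> ops m n"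
  by (auto simp: ops_def mono_on_def)

lemma ops_le: "\<theta> \<in> ops m n \<Longrightarrow> i \<le> m \<Longrightarrow> \<theta> i \<le> n"
  by (auto simp: ops_def)

lemma ops_mono: "\<theta> \<in> ops m n \<Longrightarrow> i \<le> j \<Longrightarrow> j \<le> m \<Longrightarrow> \<theta> i \<le> \<theta> j"
  by (auto simp: ops_def mono_on_def)

lemma ops_eqI: "\<lbrakk>\<alpha> \<in> ops m n; \<beta> \<in> ops m n; \<And>i. i \<le> m \<Longrightarrow> \<alpha> i = \<beta> i\<rbrakk> \<Longrightarrow> \<alpha> = \<beta>"
  by (auto simp: ops_def intro: PiE_ext)

lemma ops_comp: "\<lbrakk>\<alpha> \<in> ops k m; \<beta> \<in> ops m n\<rbrakk> \<Longrightarrow> compose {..k} \<beta> \<alpha> \<in> ops k n"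
  unfolding compose_def by (intro opsI) (auto simp: ops_le ops_mono)

lemma act_in: "\<lbrakk>sset X; \<theta> \<in> ops m n; u \<in> simplices X n\<rbrakk> \<Longrightarrow> act X m n \<theta> u \<in> simplices X m"
  by (auto simp: sset_def)

lemma act_id: "\<lbrakk>sset X; u \<in> simplices X n\<rbrakk> \<Longrightarrow> act X n n (\<lambda>i\<in>{..n}. i) u = u"
  by (simp add: sset_def)

lemma act_act: "\<lbrakk>sset X; \<alpha> \<in> ops k m; \<beta> \<in> ops m n; u \<in> simplices X n\<rbrakk>
    \<Longrightarrow> act X k m \<alpha> (act X m n \<beta> u) = act X k n (compose {..k} \<beta> \<alpha>) u"
  by (simp add: sset_def)

lemma smap_in: "\<lbrakk>smap X Y f; u \<in> simplices X n\<rbrakk> \<Longrightarrow> f n u \<in> simplices Y n"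
  by (auto simp: smap_def)

lemma smap_act: "\<lbrakk>smap X Y f; \<theta> \<in> ops m n; u \<in> simplices X n\<rbrakk>
    \<Longrightarrow> f m (act X m n \<theta> u) = act Y m n \<theta> (f n u)"
  by (simp add: smap_def)

lemma smap_undef: "\<lbrakk>smap X Y f; u \<notin> simplices X n\<rbrakk> \<Longrightarrow> f n u = undefined"
  by (auto simp: smap_def PiE_iff extensional_def)

lemma smapI:
  "\<lbrakk>\<And>n. f n \<in> extensional (simplices X n); \<And>n u. u \<in> simplices X n \<Longrightarrow> f n u \<in> simplices Y n;
    \<And>m n \<theta> u. \<lbrakk>\<theta> \<in> ops m n; u \<in> simplices X n\<rbrakk> \<Longrightarrow> f m (act X m n \<theta> u) = act Y m n \<theta> (f n u)\<rbrakk>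
   \<Longrightarrow> smap X Y f"
  by (auto simp: smap_def PiE_iff)

lemma smap_eqI: "\<lbrakk>smap X Y f; smap X Z g; \<And>n u. u \<in> simplices X n \<Longrightarrow> f n u = g n u\<rbrakk> \<Longrightarrow> f = g"
  by (intro ext) (metis smap_undef)

lemma edge_op: "\<lbrakk>i \<le> j; j \<le> n\<rbrakk> \<Longrightarrow> (\<lambda>k\<in>{..1::nat}. if k = 0 then i else j) \<in> ops 1 n"
  by (rule opsI) auto

lemma smap_edge: "\<lbrakk>smap X Y f; i \<le> j; j \<le> n; u \<in> simplices X n\<rbrakk>
    \<Longrightarrow> f 1 (edge X n i j u) = edge Y n i j (f n u)"
  unfolding edge_def by (rule smap_act) (rule edge_op | assumption)+

lemma spine_len [simp]: "length (spine X n u) = n"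
  by (simp add: spine_def)

lemma spine_nth [simp]: "i < n \<Longrightarrow> spine X n u ! i = edge X n i (Suc i) u"
  by (simp add: spine_def)

lemma spine_1: "\<lbrakk>sset X; x \<in> simplices X 1\<rbrakk> \<Longrightarrow> spine X 1 x = [x]"
  using edge_01[of X x] by (simp add: spine_def One_nat_def)

lemma spine_2: "spine X 2 u = [edge X 2 0 1 u, edge X 2 1 2 u]"
  by (simp add: spine_def numeral_2_eq_2 One_nat_def)

lemma smap_spine: "\<lbrakk>smap X Y f; u \<in> simplices X n\<rbrakk> \<Longrightarrow> spine Y n (f n u) = map (f 1) (spine X n u)"
  by (auto intro!: nth_equalityI simp: smap_edge simp del: One_nat_def)

lemma spine_act: "\<lbrakk>sset X; \<theta> \<in> ops m n; u \<in> simplices X n\<rbrakk>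
    \<Longrightarrow> spine X m (act X m n \<theta> u) = map (\<lambda>i. edge X n (\<theta> i) (\<theta> (Suc i)) u) [0..<m]"
  by (auto intro!: nth_equalityI simp: edge_act)

lemma spine_subset: "\<lbrakk>sset X; u \<in> simplices X n\<rbrakk> \<Longrightarrow> set (spine X n u) \<subseteq> simplices X 1"
  by (auto simp: spine_def intro!: edge_in)

lemma siso_bij: "siso X Y f \<Longrightarrow> bij_betw (f n) (simplices X n) (simplices Y n)"
proof -
  assume "siso X Y f"
  then obtain g where f: "smap X Y f" and g: "smap Y X g" and gf: "scomp X g f = sid X" and fg: "scomp Y f g = sid Y"
    by (auto simp: siso_def)
  have 1: "g n (f n x) = x" if "x \<in> simplices X n" for x
    using fun_cong[OF fun_cong[OF gf, of n], of x] that by (simp add: scomp_def sid_def compose_def)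
  have 2: "f n (g n x) = x" if "x \<in> simplices Y n" for x
    using fun_cong[OF fun_cong[OF fg, of n], of x] that by (simp add: scomp_def sid_def compose_def)
  show ?thesis
    by (rule bij_betw_byWitness[of _ "g n"]) (auto simp: 1 2 smap_in[OF f] smap_in[OF g])
qed

lemma siso_smap: "siso X Y f \<Longrightarrow> smap X Y f"
  by (simp add: siso_def)

definition sinv :: "'a sset \<Rightarrow> 'b sset \<Rightarrow> (nat \<Rightarrow> 'a \<Rightarrow> 'b) \<Rightarrow> nat \<Rightarrow> 'b \<Rightarrow> 'a" where
  "sinv X Y f = (\<lambda>n. \<lambda>y\<in>simplices Y n. inv_into (simplices X n) (f n) y)"

lemma smap_sinv:
  assumes X: "sset X" and f: "smap X Y f" and b: "\<And>n. bij_betw (f n) (simplices X n) (simplices Y n)"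
  shows "smap Y X (sinv X Y f)"
    and "\<And>n x. x \<in> simplices X n \<Longrightarrow> sinv X Y f n (f n x) = x"
    and "\<And>n y. y \<in> simplices Y n \<Longrightarrow> f n (sinv X Y f n y) = y"
proof -
  have fi: "f n x \<in> simplices Y n" if "x \<in> simplices X n" for n x
    using f that by (rule smap_in)
  show 1: "sinv X Y f n (f n x) = x" if "x \<in> simplices X n" for n x
    using b[of n] that fi by (simp add: sinv_def bij_betw_inv_into_left)
  show 2: "f n (sinv X Y f n y) = y" if "y \<in> simplices Y n" for n y
    using b[of n] that by (simp add: sinv_def bij_betw_inv_into_right)
  have 3: "sinv X Y f n y \<in> simplices X n" if "y \<in> simplices Y n" for n y
    using b[of n] that by (simp add: sinv_def bij_betw_def inv_into_into)
  show "smap Y X (sinv X Y f)"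
  proof (rule smapI)
    fix m n \<theta> u assume \<theta>: "\<theta> \<in> ops m n" and u: "u \<in> simplices Y n"
    have "act Y m n \<theta> u = f m (act X m n \<theta> (sinv X Y f n u))"
      using smap_act[OF f \<theta> 3[OF u]] 2[OF u] by simp
    then show "sinv X Y f m (act Y m n \<theta> u) = act X m n \<theta> (sinv X Y f n u)"
      using 1 act_in[OF X \<theta> 3[OF u]] by simp
  qed (use 3 in \<open>auto simp: sinv_def\<close>)
qed

lemma sisoI:
  assumes X: "sset X" and f: "smap X Y f" and b: "\<And>n. bij_betw (f n) (simplices X n) (simplices Y n)"
  shows "siso X Y f"
  unfolding siso_def
proof (intro conjI exI[of _ "sinv X Y f"])
  show "scomp X (sinv X Y f) f = sid X" "scomp Y f (sinv X Y f) = sid Y"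
    by (auto simp: scomp_def sid_def compose_def fun_eq_iff smap_sinv[OF assms])
qed (use smap_sinv[OF assms] f in auto)

lemma scomp_app: "x \<in> simplices X n \<Longrightarrow> scomp X g f n x = g n (f n x)"
  by (simp add: scomp_def compose_def)

lemma smap_scomp:
  assumes X: "sset X" and f: "smap X Y f" and g: "smap Y Z g"
  shows "smap X Z (scomp X g f)"
  using act_in[OF X]
  by (intro smapI) (auto simp: scomp_def compose_eq smap_act[OF f] smap_act[OF g] smap_in[OF f] smap_in[OF g])

section \<open>Sets of words with a product\<close>

text \<open>The second conjunct is carried through the induction because an interval of indices
  splits at a point only if that point is known to lie inside it.\<close>

lemma concat_upt_segments:
  assumes "p \<le> q" "\<And>i. p \<le> i \<Longrightarrow> i < q \<Longrightarrow> g i \<le> g (Suc i)"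
  shows "concat (map (\<lambda>i. map f [g i..<g (Suc i)]) [p..<q]) = map f [g p..<g q] \<and> g p \<le> (g q :: nat)"
  using assms
proof (induction q rule: dec_induct)
  case (step r)
  then have "g p \<le> g r" "g r \<le> g (Suc r)" by auto
  then have "g p \<le> g (Suc r)" "[g p..<g (Suc r)] = [g p..<g r] @ [g r..<g (Suc r)]"
    by (auto, metis le_Suc_ex upt_add_eq_append)
  with step show ?case by auto
qed simp

text \<open>\<open>D_factor\<close> stands for repeated outer faces, \<open>D_contract\<close> for
  an inner face and \<open>D_unit\<close> for a degeneracy; associativity and the unit laws are what
  the simplicial identities then amount to. \<open>m\<close> is total, but only its values on words
  of length two have a meaning.\<close>

locale words =
  fixes D :: "'a list \<Rightarrow> bool" and m :: "'a \<Rightarrow> 'a \<Rightarrow> 'a" and e :: 'a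
  assumes D_factor: "D (a @ b @ c) \<Longrightarrow> D b"
    and D_contract: "D (a @ [x, y] @ b) \<Longrightarrow> D (a @ [m x y] @ b)"
    and D_unit: "D (a @ b) \<Longrightarrow> D (a @ [e] @ b)"
    and D_Nil: "D []"
    and assoc: "D [x, y, z] \<Longrightarrow> m (m x y) z = m x (m y z)"
    and m_e: "D [x] \<Longrightarrow> m x e = x"
    and e_m: "D [x] \<Longrightarrow> m e x = x"
begin

abbreviation prd :: "'a list \<Rightarrow> 'a" where "prd \<equiv> foldl m e"

lemma D_suffix: "D (a @ b) \<Longrightarrow> D b"
  using D_factor[of a b "[]"] by simp

lemma D_prefix: "D (a @ b) \<Longrightarrow> D a"
  using D_factor[of "[]" a b] by simp

lemma D_Cons: "D (x # a) \<Longrightarrow> D a"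
  using D_suffix[of "[x]" a] by simp

lemma D_one: "D [e]"
  using D_unit[of "[]" "[]"] D_Nil by simp

lemma D_elem: "D xs \<Longrightarrow> x \<in> set xs \<Longrightarrow> D [x]"
  by (metis D_factor append.left_neutral append_Cons split_list)

lemma D_foldl: "D (a @ x # xs @ b) \<Longrightarrow> D (a @ [foldl m x xs] @ b)"
proof (induction xs arbitrary: x)
  case (Cons y ys)
  then show ?case using D_contract[of a x y "ys @ b"] by simp
qed simp

lemma D_prd: "D (a @ xs @ b) \<Longrightarrow> D (a @ [prd xs] @ b)"
  using D_foldl[of a e xs b] D_unit[of a "xs @ b"] by simp

text \<open>The fold brackets to the left, so splitting off the first letter is where associativity
  enters. It applies because multiplying out \<open>ys\<close> leaves the word
  \<open>[x, prd ys, y]\<close>.\<close>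

lemma foldl_prd: "D (x # xs) \<Longrightarrow> foldl m x xs = m x (prd xs)"
proof (induction xs rule: rev_induct)
  case Nil
  then show ?case by (simp add: m_e)
next
  case (snoc y ys)
  have "D (x # ys)" using snoc.prems D_prefix[of "x # ys"] by simp
  moreover have "D [x, prd ys, y]" using D_prd[of "[x]" ys "[y]"] snoc.prems by simp
  ultimately show ?case using snoc.IH assoc by simp
qed

lemma prd_append: "D (xs @ ys) \<Longrightarrow> prd (xs @ ys) = m (prd xs) (prd ys)"
  using foldl_prd[of "prd xs" ys] D_prd[of "[]" xs ys] by simp

lemma prd_single: "D [x] \<Longrightarrow> prd [x] = x"
  by (simp add: e_m)

lemma prd_Cons: "D (x # xs) \<Longrightarrow> prd (x # xs) = m x (prd xs)"
  using prd_append[of "[x]" xs] D_prefix[of "[x]" xs] by (simp add: e_m)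

lemma prd_pair: "D [x, y] \<Longrightarrow> prd [x, y] = m x y"
  using D_prefix[of "[x]" "[y]"] by (simp add: e_m)

lemma prd_triple: "D [x, y, z] \<Longrightarrow> prd [x, y, z] = m x (m y z)"
  using D_prefix[of "[x]" "[y, z]"] by (simp add: e_m assoc)

text \<open>The replacement rule of the later calculations. Both long words are assumed, since equal
  products of \<open>b\<close> and \<open>b'\<close> do not carry the existence of one word over to
  the other.\<close>

lemma prd_mid: "\<lbrakk>D (a @ b @ c); D (a @ b' @ c); prd b = prd b'\<rbrakk> \<Longrightarrow> prd (a @ b @ c) = prd (a @ b' @ c)"
  using prd_append[of a "b @ c"] prd_append[of b c] D_suffix[of a "b @ c"]
    prd_append[of a "b' @ c"] prd_append[of b' c] D_suffix[of a "b' @ c"] by simp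

lemma prd_contract: "D (a @ [x, y] @ b) \<Longrightarrow> prd (a @ [m x y] @ b) = prd (a @ [x, y] @ b)"
  by (rule prd_mid) (use D_contract[of a x y b] D_factor[of a "[x, y]" b] D_factor[of a "[m x y]" b] in \<open>auto simp: prd_pair prd_single simp del: foldl.simps\<close>)

lemma prd_nested: "D (a @ xs @ b) \<Longrightarrow> prd (a @ [prd xs] @ b) = prd (a @ xs @ b)"
  by (rule prd_mid) (use D_prd[of a xs b] D_factor[of a "[prd xs]" b] in \<open>auto simp: e_m\<close>)

text \<open>The prefix \<open>a\<close> takes up the blocks already multiplied, one in each step of
  the induction.\<close>

lemma D_prd_concat: "D (a @ concat xss) \<Longrightarrow> D (a @ map prd xss)"
proof (induction xss arbitrary: a)
  case (Cons xs xss)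
  from Cons.prems have "D ((a @ [prd xs]) @ concat xss)"
    using D_prd[of a xs "concat xss"] by simp
  from Cons.IH[OF this] show ?case by simp
qed simp

lemma prd_concat: "D (concat xss) \<Longrightarrow> prd (map prd xss) = prd (concat xss)"
proof (induction xss)
  case (Cons xs xss)
  have D: "D (concat xss)" using Cons.prems D_suffix[of xs] by simp
  have "D (prd xs # concat xss)" using Cons.prems D_prd[of "[]" xs] by simp
  then have "D (prd xs # map prd xss)" using D_prd_concat[of "[prd xs]" xss] by simp
  then have "prd (map prd (xs # xss)) = m (prd xs) (prd (map prd xss))"
    using prd_Cons[of "prd xs"] by (simp del: foldl.simps)
  also have "\<dots> = prd (concat (xs # xss))"
    using Cons prd_append[of xs "concat xss"] D by simp
  finally show ?case .
qed simp

lemma D_e1: "D b \<Longrightarrow> D (e # b)"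
  and D_e2: "D (x # b) \<Longrightarrow> D (x # e # b)"
  and D_e3: "D (x # y # b) \<Longrightarrow> D (x # y # e # b)"
  and D_e4: "D (x # y # z # b) \<Longrightarrow> D (x # y # z # e # b)"
  using D_unit[of "[]" b] D_unit[of "[x]" b] D_unit[of "[x, y]" b] D_unit[of "[x, y, z]" b] by simp_all

lemma D_replicate: "D b \<Longrightarrow> D (replicate k e @ b @ replicate l e)"
proof -
  assume "D b"
  then have b: "D (replicate k e @ b)" by (induction k) (simp_all add: D_e1)
  show ?thesis
  proof (induction l)
    case (Suc l)
    have "D ((replicate k e @ b) @ [e] @ replicate l e)" by (rule D_unit) (use Suc in simp)
    then show ?case by simp
  qed (use b in simp)
qed

section \<open>The simplicial set of words\<close>

definition wact :: "nat \<Rightarrow> (nat \<Rightarrow> nat) \<Rightarrow> 'a list \<Rightarrow> 'a list" where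
  "wact k \<theta> ws = map (\<lambda>i. prd (map ((!) ws) [\<theta> i..<\<theta> (Suc i)])) [0..<k]"

definition word_sset :: "'a list sset" where
  "word_sset = \<lparr>simplices = (\<lambda>n. {ws. length ws = n \<and> D ws}), act = (\<lambda>k n \<theta> ws. wact k \<theta> ws)\<rparr>"

lemma simplices_word_sset: "simplices word_sset n = {ws. length ws = n \<and> D ws}"
  by (simp add: word_sset_def)

lemma act_word_sset: "act word_sset k n \<theta> ws = wact k \<theta> ws"
  by (simp add: word_sset_def)

lemma D_seg: "\<lbrakk>D ws; i \<le> j; j \<le> length ws\<rbrakk> \<Longrightarrow> D (map ((!) ws) [i..<j])"
proof -
  assume a: "D ws" "i \<le> j" "j \<le> length ws"
  have "map ((!) ws) [i..<j] = drop i (take j ws)"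
    using a by (auto intro!: nth_equalityI)
  moreover have "ws = take i (take j ws) @ drop i (take j ws) @ drop j ws"
    by (metis append.assoc append_take_drop_id)
  ultimately show ?thesis using D_factor a(1) by metis
qed

text \<open>This is functoriality on edges: the letters of \<open>wact k \<theta> ws\<close> between
  \<open>i\<close> and \<open>j\<close> are the products over adjacent segments of
  \<open>ws\<close>, which together fill the segment from \<open>\<theta> i\<close> to
  \<open>\<theta> j\<close>.\<close>

lemma wact_seg:
  assumes "\<theta> \<in> ops k n" "length ws = n" "D ws" "i \<le> j" "j \<le> k"
  shows "prd (map ((!) (wact k \<theta> ws)) [i..<j]) = prd (map ((!) ws) [\<theta> i..<\<theta> j])"
proof -
  let ?L = "map (\<lambda>l. map ((!) ws) [\<theta> l..<\<theta> (Suc l)]) [i..<j]"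
  have c: "concat ?L = map ((!) ws) [\<theta> i..<\<theta> j]"
    using concat_upt_segments[of i j \<theta> "(!) ws"] assms ops_mono[OF assms(1)] by auto
  have D: "D (concat ?L)" unfolding c
    using assms by (intro D_seg) (auto simp: ops_le ops_mono)
  have "map ((!) (wact k \<theta> ws)) [i..<j] = map prd ?L"
    using assms(5) by (auto simp: wact_def)
  then show ?thesis using prd_concat[OF D] c by metis
qed

lemma D_wact:
  assumes "\<theta> \<in> ops k n" "length ws = n" "D ws"
  shows "D (wact k \<theta> ws)"
proof -
  let ?L = "map (\<lambda>l. map ((!) ws) [\<theta> l..<\<theta> (Suc l)]) [0..<k]"
  have c: "concat ?L = map ((!) ws) [\<theta> 0..<\<theta> k]"
    using concat_upt_segments[of 0 k \<theta> "(!) ws"] assms ops_mono[OF assms(1)] by auto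
  have D: "D (concat ?L)" unfolding c
    using assms by (intro D_seg) (auto simp: ops_le ops_mono)
  have "wact k \<theta> ws = map prd ?L" by (auto simp: wact_def)
  then show ?thesis using D_prd_concat[of "[]" ?L] D by simp
qed

lemma sset_word_sset: "sset word_sset"
  unfolding sset_def
proof (intro conjI allI ballI)
  show "act word_sset k n \<theta> \<in> simplices word_sset n \<rightarrow> simplices word_sset k" if "\<theta> \<in> ops k n" for k n \<theta>
    using that by (auto simp: simplices_word_sset act_word_sset D_wact) (simp add: wact_def)
  show "act word_sset n n (\<lambda>i\<in>{..n}. i) x = x" if "x \<in> simplices word_sset n" for n x
    using that by (auto intro!: nth_equalityI simp: simplices_word_sset act_word_sset wact_def e_m D_elem)
  show "act word_sset k n (compose {..k} \<beta> \<alpha>) x = act word_sset k l \<alpha> (act word_sset l n \<beta> x)"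
    if a: "\<alpha> \<in> ops k l" "\<beta> \<in> ops l n" "x \<in> simplices word_sset n" for k l n \<alpha> \<beta> x
  proof (rule nth_equalityI)
    fix i assume "i < length (act word_sset k n (compose {..k} \<beta> \<alpha>) x)"
    then have i: "i < k" by (simp add: act_word_sset wact_def)
    have "prd (map ((!) (wact l \<beta> x)) [\<alpha> i..<\<alpha> (Suc i)]) = prd (map ((!) x) [\<beta> (\<alpha> i)..<\<beta> (\<alpha> (Suc i))])"
      using a i by (intro wact_seg[of _ _ n]) (auto simp: simplices_word_sset ops_le ops_mono)
    then show "act word_sset k n (compose {..k} \<beta> \<alpha>) x ! i = act word_sset k l \<alpha> (act word_sset l n \<beta> x) ! i"
      using i by (simp add: act_word_sset wact_def[of k] compose_def)
  qed (simp add: act_word_sset wact_def)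
qed

lemma edge_word_sset: "edge word_sset n i j ws = [prd (map ((!) ws) [i..<j])]"
  by (simp add: edge_def act_word_sset wact_def One_nat_def)

lemma spine_word_sset: "\<lbrakk>length ws = n; D ws\<rbrakk> \<Longrightarrow> spine word_sset n ws = map (\<lambda>y. [y]) ws"
  by (auto intro!: nth_equalityI simp: edge_word_sset e_m D_elem)

lemma partial_monoid_word_sset: "partial_monoid word_sset"
  unfolding partial_monoid_def
proof (intro conjI allI impI)
  show "\<exists>!v. v \<in> simplices word_sset 0" by (auto simp: simplices_word_sset D_Nil)
  show "inj_on (spine word_sset n) (simplices word_sset n)" for n
    by (auto simp: inj_on_def simplices_word_sset spine_word_sset dest!: map_injective simp: inj_def)
qed (rule sset_word_sset)

text \<open>A letter \<open>y\<close> has become the 1-simplex \<open>[y]\<close>, which accounts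
  for the lists of singletons here and below.\<close>

lemma is_word_word_sset: "is_word word_sset xs \<longleftrightarrow> (\<exists>ws. D ws \<and> xs = map (\<lambda>y. [y]) ws)"
  unfolding is_word_def
  by (metis (mono_tags, lifting) length_map mem_Collect_eq simplices_word_sset spine_len spine_word_sset)

lemma word_word_sset: "D ws \<Longrightarrow> word word_sset (map (\<lambda>y. [y]) ws) = ws"
  unfolding word_def
proof (rule the_equality)
  fix u assume "u \<in> simplices word_sset (length (map (\<lambda>y. [y]) ws)) \<and>
    spine word_sset (length (map (\<lambda>y. [y]) ws)) u = map (\<lambda>y. [y]) ws"
  then have "length u = length ws" "map (\<lambda>y. [y]) u = map (\<lambda>y. [y]) ws"
    by (auto simp: simplices_word_sset spine_word_sset)
  then show "u = ws" by (auto dest!: map_injective simp: inj_def)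
qed (auto simp: simplices_word_sset spine_word_sset)

lemma wprod_word_sset: "D ws \<Longrightarrow> wprod word_sset (map (\<lambda>y. [y]) ws) = [prd ws]"
  by (simp add: wprod_def word_word_sset edge_word_sset map_nth)

lemma one_word_sset: "one word_sset = [e]"
  by (simp add: one_def degen_def act_word_sset wact_def One_nat_def)

end

section \<open>Words in a partial monoid\<close>

lemma pm_sset: "partial_monoid X \<Longrightarrow> sset X"
  by (simp add: partial_monoid_def)

lemma pm_spine_eqD:
  assumes "partial_monoid X" "u \<in> simplices X n" "v \<in> simplices X n" "spine X n u = spine X n v"
  shows "u = v"
proof (cases n)
  case 0
  then show ?thesis using assms by (auto simp: partial_monoid_def)
next
  case (Suc k)
  then have "1 \<le> n" by simp
  then have "inj_on (spine X n) (simplices X n)" using assms(1) by (simp add: partial_monoid_def)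
  then show ?thesis using assms by (auto dest: inj_onD)
qed

lemma is_word_spine: "u \<in> simplices X n \<Longrightarrow> is_word X (spine X n u)"
  by (auto simp: is_word_def)

lemma is_word_subset: "sset X \<Longrightarrow> is_word X xs \<Longrightarrow> set xs \<subseteq> simplices X 1"
  using spine_subset by (fastforce simp: is_word_def)

lemma word_spine: "\<lbrakk>partial_monoid X; u \<in> simplices X n\<rbrakk> \<Longrightarrow> word X (spine X n u) = u"
  unfolding word_def by (rule the_equality) (auto dest: pm_spine_eqD)

lemma word_simplex: "\<lbrakk>partial_monoid X; is_word X xs; length xs = n\<rbrakk> \<Longrightarrow> word X xs \<in> simplices X n \<and> spine X n (word X xs) = xs"
  unfolding is_word_def by (metis word_spine)

lemma vertex_in: "partial_monoid X \<Longrightarrow> vertex X \<in> simplices X 0"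
  unfolding partial_monoid_def vertex_def by (metis theI')

lemma vertex_eq: "partial_monoid X \<Longrightarrow> v \<in> simplices X 0 \<Longrightarrow> v = vertex X"
  using vertex_in unfolding partial_monoid_def by metis

lemma degen_in: "sset X \<Longrightarrow> v \<in> simplices X 0 \<Longrightarrow> degen X n v \<in> simplices X n"
  unfolding degen_def by (rule act_in) (auto intro: opsI)

lemma one_in: "partial_monoid X \<Longrightarrow> one X \<in> simplices X 1"
  unfolding one_def by (simp add: degen_in pm_sset vertex_in)

lemma edge_mult:
  assumes X: "partial_monoid X" and u: "u \<in> simplices X n" and "i \<le> j" "j \<le> k" "k \<le> n"
  shows "is_word X [edge X n i j u, edge X n j k u]"
    and "wprod X [edge X n i j u, edge X n j k u] = edge X n i k u"
proof -
  note S = pm_sset[OF X]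
  let ?\<theta> = "\<lambda>l\<in>{..2::nat}. if l = 0 then i else if l = 1 then j else k"
  have \<theta>: "?\<theta> \<in> ops 2 n" using assms by (intro opsI) auto
  let ?w = "act X 2 n ?\<theta> u"
  have w: "?w \<in> simplices X 2" by (rule act_in[OF S \<theta> u])
  have s: "spine X 2 ?w = [edge X n i j u, edge X n j k u]"
    using edge_act[OF S \<theta> _ _ u, of 0 1] edge_act[OF S \<theta> _ _ u, of 1 2] by (simp add: spine_2)
  show "is_word X [edge X n i j u, edge X n j k u]"
    using is_word_spine[OF w] s by simp
  have "word X [edge X n i j u, edge X n j k u] = ?w"
    using word_spine[OF X w] s by simp
  then show "wprod X [edge X n i j u, edge X n j k u] = edge X n i k u"
    using edge_act[OF S \<theta> _ _ u, of 0 2] by (simp add: wprod_def numeral_2_eq_2)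
qed

text \<open>The first three closure properties of words in a partial monoid reduce to naming a
  simplicial operator with the right effect on the spine.\<close>

lemma is_word_act:
  assumes X: "partial_monoid X" and xs: "is_word X xs" and \<theta>: "\<theta> \<in> ops m (length xs)"
    and ys: "length ys = m" "\<And>i. i < m \<Longrightarrow> ys ! i = edge X (length xs) (\<theta> i) (\<theta> (Suc i)) (word X xs)"
  shows "is_word X ys"
proof -
  note S = pm_sset[OF X] and w = word_simplex[OF X xs refl]
  have "spine X m (act X m (length xs) \<theta> (word X xs)) = ys"
    using ys spine_act[OF S \<theta>] w by (auto intro!: nth_equalityI)
  then show ?thesis using is_word_spine[OF act_in[OF S \<theta>]] w by metis
qed

lemma word_edge: "\<lbrakk>partial_monoid X; is_word X xs; i < length xs; n = length xs\<rbrakk> \<Longrightarrow> edge X n i (Suc i) (word X xs) = xs ! i"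
  by (metis spine_nth word_simplex)

lemma words_partial_monoid:
  assumes X: "partial_monoid X"
  shows "words (is_word X) (\<lambda>x y. wprod X [x, y]) (one X)"
proof
  note S = pm_sset[OF X]
  note E = word_edge[OF X] word_edge[OF X, of _ "Suc _", simplified]
  note W = word_simplex[OF X, THEN conjunct1, OF _ refl]
  show "is_word X b" if "is_word X (a @ b @ c)" for a b c
    by (rule is_word_act[OF X that, of "\<lambda>i\<in>{..length b}. length a + i"])
      (use that in \<open>auto intro!: opsI simp: E nth_append simp del: restrict_apply\<close>, simp add: E nth_append)
  \<comment> \<open>The operator omits the vertex \<open>length a + 1\<close>, at which the letters
    \<open>x\<close> and \<open>y\<close> meet.\<close>
  show "is_word X (a @ [wprod X [x, y]] @ b)" if xs: "is_word X (a @ [x, y] @ b)" for a b x y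
  proof (rule is_word_act[OF X xs, of "\<lambda>i\<in>{..length a + length b + 1}. if i \<le> length a then i else i + 1"])
    let ?xs = "a @ [x, y] @ b"
    have "wprod X [x, y] = edge X (length ?xs) (length a) (Suc (Suc (length a))) (word X ?xs)"
      using edge_mult(2)[OF X W[OF xs], of "length a" "Suc (length a)" "Suc (Suc (length a))"]
        E[OF xs, of "length a"] E[OF xs, of "Suc (length a)"] by (simp add: nth_append)
    then show "(a @ [wprod X [x, y]] @ b) ! i = edge X (length ?xs)
          ((\<lambda>i\<in>{..length a + length b + 1}. if i \<le> length a then i else i + 1) i)
          ((\<lambda>i\<in>{..length a + length b + 1}. if i \<le> length a then i else i + 1) (Suc i)) (word X ?xs)"
      if "i < length a + length b + 1" for i
      using that E[OF xs, of i] E[OF xs, of "Suc i"]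
      by (cases "i < length a"; cases "i = length a") (auto simp: nth_append nth_Cons' One_nat_def)
  qed (auto intro!: opsI simp del: restrict_apply)
  \<comment> \<open>The operator repeats the vertex \<open>length a\<close>, and the edge between
    its two copies is \<open>one X\<close>.\<close>
  show "is_word X (a @ [one X] @ b)" if xs: "is_word X (a @ b)" for a b
  proof (rule is_word_act[OF X xs, of "\<lambda>i\<in>{..length a + length b + 1}. if i \<le> length a then i else i - 1"])
    let ?xs = "a @ b"
    have "one X = edge X (length ?xs) (length a) (length a) (word X ?xs)"
      using edge_deg[OF X _ W[OF xs]] by simp
    then show "(a @ [one X] @ b) ! i = edge X (length ?xs)
          ((\<lambda>i\<in>{..length a + length b + 1}. if i \<le> length a then i else i - 1) i)
          ((\<lambda>i\<in>{..length a + length b + 1}. if i \<le> length a then i else i - 1) (Suc i)) (word X ?xs)"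
      if "i < length a + length b + 1" for i
      using that E[OF xs, of i] E[OF xs, of "i - 1"]
      by (cases "i < length a"; cases "i = length a") (auto simp: nth_append nth_Cons' One_nat_def)
  qed (auto intro!: opsI simp del: restrict_apply)
  show "is_word X []" using vertex_in[OF X] by (auto simp: is_word_def spine_def)
  \<comment> \<open>Both bracketings are the edge from 0 to 3 of the simplex with spine
    \<open>[x, y, z]\<close>.\<close>
  show "wprod X [wprod X [x, y], z] = wprod X [x, wprod X [y, z]]" if xs: "is_word X [x, y, z]" for x y z
    using edge_mult(2)[OF X W[OF xs], of 0 1 2] edge_mult(2)[OF X W[OF xs], of 0 2 3]
      edge_mult(2)[OF X W[OF xs], of 1 2 3] edge_mult(2)[OF X W[OF xs], of 0 1 3]
      E[OF xs, of 0] E[OF xs, of 1] E[OF xs, of 2] by (simp add: eval_nat_numeral One_nat_def)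
  show "wprod X [x, one X] = x" "wprod X [one X, x] = x" if xs: "is_word X [x]" for x
    using edge_mult(2)[OF X W[OF xs], of 0 1 1] edge_mult(2)[OF X W[OF xs], of 0 0 1] E[OF xs, of 0]
      edge_deg[OF X _ W[OF xs], of 0] edge_deg[OF X _ W[OF xs], of 1] by (auto simp: One_nat_def)
qed

section \<open>Words with inverses\<close>

locale gwords = words +
  fixes iv :: "'a \<Rightarrow> 'a"
  assumes D_inv: "D xs \<Longrightarrow> D (rev (map iv xs) @ xs)"
    and iv_m: "D [x] \<Longrightarrow> m (iv x) x = e"
begin

lemma D_iv: "D xs \<Longrightarrow> D (rev (map iv xs))"
  using D_inv D_prefix by blast

lemma D_iv1: "D [x] \<Longrightarrow> D [iv x]"
  using D_iv[of "[x]"] by simp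

lemma iv_iv: assumes "D [x]" shows "iv (iv x) = x"
proof -
  have 1: "D [iv x, x]" using D_inv[OF assms] by simp
  \<comment> \<open>\<open>D_inv\<close> applied to the word \<open>[iv x, x]\<close>. Without its
    first letter, the result brackets in one way to \<open>x\<close> and in the other to
    \<open>iv (iv x)\<close>.\<close>
  have "D [iv x, iv (iv x), iv x, x]" using D_inv[OF 1] by simp
  then have 2: "D [iv (iv x), iv x, x]" by (rule D_Cons)
  have "m (m (iv (iv x)) (iv x)) x = m (iv (iv x)) (m (iv x) x)"
    using assoc[OF 2] .
  moreover have "D [iv (iv x)]" using D_iv1 assms by blast
  ultimately show ?thesis using iv_m assms D_iv1 by (simp add: m_e e_m)
qed

lemma D_inv': "D xs \<Longrightarrow> D (xs @ rev (map iv xs))"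
proof -
  assume D: "D xs"
  have "map (iv \<circ> iv) xs = xs" using D D_elem by (auto simp: iv_iv intro: map_idI)
  then show ?thesis using D_inv[OF D_iv[OF D]] by (simp add: rev_map)
qed

lemma m_iv: "D [x] \<Longrightarrow> m x (iv x) = e"
  using iv_m[of "iv x"] D_iv1 iv_iv by simp

text \<open>Cancellation needs \<open>D_inv\<close> on words of length two:
  \<open>[iv y, iv x, x, y]\<close> contains the word in which \<open>iv x\<close> and
  \<open>x\<close> meet in front of \<open>y\<close>.\<close>

lemma D_lcancel: "D [x, y] \<Longrightarrow> D [iv x, x, y]"
  using D_inv[of "[x, y]"] D_Cons by simp

lemma D_rcancel: "D [x, y] \<Longrightarrow> D [x, y, iv y]"
  using D_inv'[of "[x, y]"] D_prefix[of "[x, y, iv y]"] by simp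

lemma lcancel: "D [x, y] \<Longrightarrow> m (iv x) (m x y) = y"
  using assoc[OF D_lcancel, of x y] D_elem[of "[x, y]"] by (simp add: iv_m e_m)

lemma rcancel: "D [x, y] \<Longrightarrow> m (m x y) (iv y) = x"
  using assoc[OF D_rcancel, of x y] D_elem[of "[x, y]"] by (simp add: m_iv m_e)

text \<open>The word \<open>[x, y, iv y, iv x]\<close> has product \<open>e\<close>. Contracted in
  pairs it says that \<open>m x y\<close> times \<open>m (iv y) (iv x)\<close> is \<open>e\<close>,
  and \<open>m x y\<close> can be cancelled on the left.\<close>

lemma iv_mult: assumes "D [x, y]" shows "iv (m x y) = m (iv y) (iv x)"
proof -
  have "D ([] @ [x, y] @ [iv y, iv x])" using D_inv'[OF assms] by simp
  then have 1: "D ([m x y] @ [iv y, iv x] @ [])" and 2: "prd ([] @ [m x y] @ [iv y, iv x]) = prd ([] @ [x, y] @ [iv y, iv x])"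
    using D_contract[of "[]" x y "[iv y, iv x]"] prd_contract[of "[]" x y "[iv y, iv x]"] by auto
  have 3: "D [m x y, m (iv y) (iv x)]" using D_contract[OF 1] by simp
  have x: "D [x]" "D [y]" using assms D_elem by auto
  have "m (m x y) (m (iv y) (iv x)) = prd [m x y, iv y, iv x]" using prd_triple 1 by simp
  also have "\<dots> = prd [x, y, iv y, iv x]" using 2 by simp
  also have "\<dots> = e" using x rcancel[OF assms] by (simp add: e_m m_iv)
  finally have "m (m x y) (m (iv y) (iv x)) = e" .
  then have "m (iv (m x y)) e = m (iv y) (iv x)" using lcancel[OF 3] by simp
  moreover have "D [iv (m x y)]" using 3 D_elem[of "[m x y, m (iv y) (iv x)]"] D_iv1 by simp
  ultimately show ?thesis by (simp add: m_e)
qed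

lemma iv_e: "iv e = e"
  using m_iv[OF D_one] e_m[OF D_iv1[OF D_one]] by simp

lemma iv_prd: "D xs \<Longrightarrow> iv (prd xs) = prd (rev (map iv xs))"
proof (induction xs rule: rev_induct)
  case (snoc x xs)
  have 1: "D [prd xs, x]" using D_prd[of "[]" xs "[x]"] snoc.prems by simp
  have 2: "D (iv x # rev (map iv xs))" using D_iv[OF snoc.prems] by simp
  show ?case using snoc.IH D_prefix[OF snoc.prems] iv_mult[OF 1] prd_Cons[OF 2] by simp
qed (simp add: iv_e)

lemma prd_inv: "D xs \<Longrightarrow> prd (rev (map iv xs) @ xs) = e"
  using prd_append[OF D_inv] iv_prd[of xs] D_prd[of "[]" xs "[]"] iv_m[of "prd xs"] by simp

end

section \<open>Partial monoids and partial groups as instances\<close>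

locale pmon =
  fixes X :: "'a sset"
  assumes pm: "partial_monoid X"
begin

sublocale words "is_word X" "\<lambda>x y. wprod X [x, y]" "one X"
  by (rule words_partial_monoid[OF pm])

lemmas ss = pm_sset[OF pm]

lemma is_word_1: "is_word X [x] \<longleftrightarrow> x \<in> simplices X 1"
  using is_word_subset[OF ss, of "[x]"] is_word_spine[of x X 1] spine_1[OF ss] by auto

lemma is_word_in: "is_word X xs \<Longrightarrow> x \<in> set xs \<Longrightarrow> x \<in> simplices X 1"
  using is_word_subset[OF ss] by auto

lemma mult_in: "is_word X [x, y] \<Longrightarrow> wprod X [x, y] \<in> simplices X 1"
  using D_contract[of "[]" x y "[]"] is_word_1 by simp

lemma edge_seg:
  assumes u: "u \<in> simplices X n" and "i \<le> j" "j \<le> n"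
  shows "edge X n i j u = prd (map ((!) (spine X n u)) [i..<j])"
  using assms(2,3)
proof (induction j rule: dec_induct)
  case base
  then show ?case using edge_deg[OF pm _ u] by simp
next
  case (step j)
  then show ?case using edge_mult(2)[OF pm u, of i j "Suc j"] by simp
qed

lemma wprod_prd: "is_word X xs \<Longrightarrow> wprod X xs = prd xs"
  using edge_seg[of "word X xs" "length xs" 0 "length xs"] word_simplex[OF pm, of xs]
  by (simp add: wprod_def map_nth)

text \<open>An inversion in all dimensions comes from inverses of letters alone. Reversing a spine
  exchanges the vertices \<open>k\<close> and \<open>n - k\<close>, which is the passage to the
  opposite simplicial set.\<close>

lemma inversion_of_words:
  assumes D: "\<And>xs. is_word X xs \<Longrightarrow> is_word X (rev (map iv xs) @ xs)"
    and iv: "\<And>x. x \<in> simplices X 1 \<Longrightarrow> wprod X [iv x, x] = one X"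
  defines "\<nu> \<equiv> \<lambda>n. \<lambda>u\<in>simplices X n. word X (rev (map iv (spine X n u)))"
  shows "inversion X \<nu>"
proof -
  interpret gwords "is_word X" "\<lambda>x y. wprod X [x, y]" "one X" iv
    by unfold_locales (auto simp: is_word_1 D iv)
  have \<nu>: "\<nu> n u \<in> simplices X n \<and> spine X n (\<nu> n u) = rev (map iv (spine X n u))"
    if "u \<in> simplices X n" for n u
    using that word_simplex[OF pm D_iv[OF is_word_spine[OF that]]] by (simp add: \<nu>_def)
  have iviv: "map (iv \<circ> iv) xs = xs" if "is_word X xs" for xs
    using that D_elem by (auto simp: iv_iv intro: map_idI)
  have edge: "edge X n i j (\<nu> n u) = iv (edge X n (n - j) (n - i) u)"
    if u: "u \<in> simplices X n" and ij: "i \<le> j" "j \<le> n" for n u i j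
  proof -
    have "map ((!) (rev (map iv (spine X n u)))) [i..<j] = rev (map iv (map ((!) (spine X n u)) [n - j..<n - i]))"
      using ij by (auto intro!: nth_equalityI simp: rev_nth algebra_simps intro!: arg_cong[where f=iv] arg_cong[where f="(!) _"])
    moreover have "is_word X (map ((!) (spine X n u)) [n - j..<n - i])"
      using ij by (intro D_seg is_word_spine u) auto
    ultimately show ?thesis using edge_seg[of "\<nu> n u" n i j] edge_seg[OF u, of "n - j" "n - i"] \<nu>[OF u] ij
      by (simp add: iv_prd del: map_map)
  qed
  have "smap X (sop X) \<nu>"
  proof (rule smapI)
    fix m n \<theta> u assume \<theta>: "\<theta> \<in> ops m n" and u: "u \<in> simplices X n"
    let ?\<theta> = "\<lambda>i\<in>{..m}. n - \<theta> (m - i)"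
    have \<theta>': "?\<theta> \<in> ops m n" using ops_mono[OF \<theta>] by (intro opsI) (auto intro!: diff_le_mono2)
    have "\<nu> m (act X m n \<theta> u) = act X m n ?\<theta> (\<nu> n u)"
    proof (rule pm_spine_eqD[OF pm])
      show "\<nu> m (act X m n \<theta> u) \<in> simplices X m" using \<nu> act_in[OF ss \<theta> u] by blast
      show "act X m n ?\<theta> (\<nu> n u) \<in> simplices X m" using \<nu>[OF u] act_in[OF ss \<theta>'] by blast
      show "spine X m (\<nu> m (act X m n \<theta> u)) = spine X m (act X m n ?\<theta> (\<nu> n u))"
      proof (rule nth_equalityI)
        fix i assume "i < length (spine X m (\<nu> m (act X m n \<theta> u)))"
        then have i: "i < m" by simp
        have "\<theta> (m - i) \<le> n" "\<theta> (m - Suc i) \<le> n" "\<theta> (m - Suc i) \<le> \<theta> (m - i)"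
          using i by (auto intro!: ops_le[OF \<theta>] ops_mono[OF \<theta>])
        moreover have "Suc (m - Suc i) = m - i" using i by simp
        ultimately show "spine X m (\<nu> m (act X m n \<theta> u)) ! i = spine X m (act X m n ?\<theta> (\<nu> n u)) ! i"
          using i \<nu>[OF act_in[OF ss \<theta> u]] \<nu>[OF u]
          by (simp add: spine_act[OF ss \<theta>' ] spine_act[OF ss \<theta> u] edge[OF u] rev_nth diff_le_mono2)
      qed simp
    qed
    then show "\<nu> m (act X m n \<theta> u) = act (sop X) m n \<theta> (\<nu> n u)" by (simp add: sop_def)
  next
    show "\<nu> n u \<in> simplices (sop X) n" if "u \<in> simplices X n" for n u
      using \<nu>[OF that] by (simp add: sop_def)
  qed (simp add: \<nu>_def)
  moreover have "scomp X \<nu> \<nu> n u = sid X n u" for n u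
  proof (cases "u \<in> simplices X n")
    case True
    have "\<nu> n (\<nu> n u) = u"
      using \<nu>[OF True] \<nu>[of "\<nu> n u" n] iviv[OF is_word_spine[OF True]] True
      by (auto intro!: pm_spine_eqD[OF pm] simp: rev_map)
    then show ?thesis using True by (simp add: scomp_def sid_def compose_eq)
  qed (simp add: scomp_def sid_def compose_def)
  moreover have "is_word X (spine X n (\<nu> n u) @ spine X n u) \<and> wprod X (spine X n (\<nu> n u) @ spine X n u) = one X"
    if u: "u \<in> simplices X n" for n u
    using \<nu>[OF u] D[OF is_word_spine[OF u]] prd_inv[OF is_word_spine[OF u]] by (simp add: wprod_prd)
  ultimately show ?thesis by (simp add: inversion_def fun_eq_iff)
qed

end

locale pgrp = pmon +
  assumes pg: "partial_group X"
begin

definition "iv = inv1 X"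

lemma inversion_of: "inversion X (inversion_of X)"
  using pg inversion_of_eq by (auto simp: partial_group_def)

lemma iv_in: "x \<in> simplices X 1 \<Longrightarrow> iv x \<in> simplices X 1"
  unfolding iv_def by (rule inversion_in[OF inversion_of])

sublocale gwords "is_word X" "\<lambda>x y. wprod X [x, y]" "one X" iv
proof
  have *: "is_word X (rev (map iv xs) @ xs) \<and> wprod X (rev (map iv xs) @ xs) = one X" if xs: "is_word X xs" "xs \<noteq> []" for xs
  proof -
    obtain u where u: "u \<in> simplices X (length xs)" "spine X (length xs) u = xs"
      using xs(1) by (auto simp: is_word_def)
    have "spine X (length xs) (inversion_of X (length xs) u) = rev (map iv xs)"
    proof (rule nth_equalityI)
      fix i assume "i < length (spine X (length xs) (inversion_of X (length xs) u))"
      then have i: "i < length xs" by simp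
      then have "Suc (length xs - Suc i) = length xs - i" by simp
      then show "spine X (length xs) (inversion_of X (length xs) u) ! i = rev (map iv xs) ! i"
        using i inversion_edge[OF ss inversion_of u(1), of i "Suc i"] u(2) spine_nth[of "length xs - Suc i" "length xs" X u]
        by (simp add: rev_nth iv_def)
    qed simp
    moreover have "1 \<le> length xs" using xs by (simp add: Suc_le_eq One_nat_def)
    ultimately show ?thesis
      using inversion_of[unfolded inversion_def, THEN conjunct2, THEN conjunct2, rule_format, of "length xs" u] u by simp
  qed
  show "is_word X (rev (map iv xs) @ xs)" if "is_word X xs" for xs
    \<comment> \<open>The axioms of an inversion concern dimensions \<open>n \<ge> 1\<close>, so the
      empty word is treated apart.\<close>
    using *[OF that] that by (cases "xs = []") auto
  show "wprod X [iv x, x] = one X" if "is_word X [x]" for x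
    using *[OF that] by simp
qed

end

lemma pgrpI: "partial_group X \<Longrightarrow> pgrp X"
  by unfold_locales (auto simp: partial_group_def)

lemma (in gwords) inversion_word_sset:
  "inversion word_sset (\<lambda>n. \<lambda>u\<in>simplices word_sset n. word word_sset (rev (map (\<lambda>y. [iv (hd y)]) (spine word_sset n u))))"
proof -
  interpret W: pmon word_sset by unfold_locales (rule partial_monoid_word_sset)
  show ?thesis
  proof (rule W.inversion_of_words)
    show "is_word word_sset (rev (map (\<lambda>y. [iv (hd y)]) xs) @ xs)" if "is_word word_sset xs" for xs
    proof -
      from that obtain ws where ws: "D ws" "xs = map (\<lambda>y. [y]) ws" using is_word_word_sset by blast
      then have "rev (map (\<lambda>y. [iv (hd y)]) xs) @ xs = map (\<lambda>y. [y]) (rev (map iv ws) @ ws)"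
        by (simp add: rev_map)
      then show ?thesis using D_inv[OF ws(1)] is_word_word_sset by blast
    qed
    show "wprod word_sset [[iv (hd x)], x] = one word_sset" if x: "x \<in> simplices word_sset 1" for x
    proof -
      obtain y where y: "x = [y]" "D [y]" using x by (auto simp: simplices_word_sset length_Suc_conv One_nat_def)
      have "D [iv y, y]" using D_inv[OF y(2)] by simp
      from wprod_word_sset[OF this] prd_pair[OF this] iv_m[OF y(2)] show ?thesis
        by (simp add: y one_word_sset)
    qed
  qed
qed

lemma (in gwords) partial_group_word_sset: "partial_group word_sset"
  unfolding partial_group_def using inversion_word_sset partial_monoid_word_sset by blast

lemma (in gwords) inv1_word_sset: "D [x] \<Longrightarrow> inv1 word_sset [x] = [iv x]"
  using inversion_of_eq[OF partial_group_word_sset inversion_word_sset] D_iv1[of x]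
    word_word_sset[of "[iv x]"] spine_word_sset[of "[x]" 1]
  by (simp add: simplices_word_sset One_nat_def)

section \<open>Maps determined by their values on edges\<close>

definition wmap :: "'a sset \<Rightarrow> 'b sset \<Rightarrow> ('a \<Rightarrow> 'b) \<Rightarrow> nat \<Rightarrow> 'a \<Rightarrow> 'b" where
  "wmap X Y F = (\<lambda>n. \<lambda>u\<in>simplices X n. word Y (map F (spine X n u)))"

text \<open>Products have to be checked on 2-simplices only: an edge from \<open>i\<close> to
  \<open>Suc j\<close> is reached through the 2-simplex on \<open>i\<close>, \<open>j\<close>,
  \<open>Suc j\<close>, by induction on \<open>j\<close>. The hypothesis on vertices starts this
  induction at the edge from \<open>i\<close> to \<open>i\<close>.\<close>

lemma smap_wmap:
  assumes X: "sset X" and Y: "partial_monoid Y"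
    and W: "\<And>n u. u \<in> simplices X n \<Longrightarrow> is_word Y (map F (spine X n u))"
    and M: "\<And>u. u \<in> simplices X 2 \<Longrightarrow> F (edge X 2 0 2 u) = wprod Y [F (edge X 2 0 1 u), F (edge X 2 1 2 u)]"
    and V: "\<And>v. v \<in> simplices X 0 \<Longrightarrow> F (edge X 0 0 0 v) = one Y"
  shows "smap X Y (wmap X Y F)"
proof -
  note SY = pm_sset[OF Y]
  have w: "wmap X Y F n u \<in> simplices Y n \<and> spine Y n (wmap X Y F n u) = map F (spine X n u)"
    if "u \<in> simplices X n" for n u
    using word_simplex[OF Y W[OF that], of n] that by (simp add: wmap_def)
  have E: "edge Y n i j (wmap X Y F n u) = F (edge X n i j u)" if u: "u \<in> simplices X n" and ij: "i \<le> j" "j \<le> n" for n u i j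
    using ij
  proof (induction j rule: dec_induct)
    case base
    let ?\<theta> = "\<lambda>k\<in>{..0::nat}. i"
    have \<theta>: "?\<theta> \<in> ops 0 n" using base by (intro opsI) auto
    show ?case using V[OF act_in[OF X \<theta> u]] edge_act[OF X \<theta> _ _ u, of 0 0] edge_deg[OF Y _ w[OF u, THEN conjunct1], of i] base
      by simp
  next
    case (step j)
    let ?\<theta> = "\<lambda>l\<in>{..2::nat}. if l = 0 then i else if l = 1 then j else Suc j"
    have \<theta>: "?\<theta> \<in> ops 2 n" using step by (intro opsI) auto
    have "edge Y n j (Suc j) (wmap X Y F n u) = F (edge X n j (Suc j) u)"
      using w[OF u] step spine_nth[of j n Y "wmap X Y F n u"] by simp
    then show ?case using M[OF act_in[OF X \<theta> u]] edge_act[OF X \<theta> _ _ u, of 0 1] edge_act[OF X \<theta> _ _ u, of 1 2]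
        edge_act[OF X \<theta> _ _ u, of 0 2] step edge_mult(2)[OF Y w[OF u, THEN conjunct1], of i j "Suc j"]
      by simp
  qed
  show ?thesis
  proof (rule smapI)
    fix m n \<theta> u assume \<theta>: "\<theta> \<in> ops m n" and u: "u \<in> simplices X n"
    show "wmap X Y F m (act X m n \<theta> u) = act Y m n \<theta> (wmap X Y F n u)"
    proof (rule pm_spine_eqD[OF Y, of _ m])
      show "spine Y m (wmap X Y F m (act X m n \<theta> u)) = spine Y m (act Y m n \<theta> (wmap X Y F n u))"
        using w[OF u] w[OF act_in[OF X \<theta> u]] ops_mono[OF \<theta>] ops_le[OF \<theta>]
        by (auto intro!: nth_equalityI simp: spine_act[OF X \<theta> u] spine_act[OF SY \<theta>] E[OF u])
    qed (use w act_in[OF X \<theta> u] act_in[OF SY \<theta>] u in blast)+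
  qed (use w in \<open>auto simp: wmap_def\<close>)
qed

lemma wmap_1:
  assumes "sset X" "partial_monoid Y" "u \<in> simplices X 1" "is_word Y [F u]"
  shows "wmap X Y F 1 u = F u"
proof -
  have "F u \<in> simplices Y 1" using is_word_subset[OF pm_sset[OF assms(2)] assms(4)] by simp
  then have "word Y [F u] = F u" using word_spine[OF assms(2)] spine_1[OF pm_sset[OF assms(2)]] by metis
  then show ?thesis using assms by (simp add: wmap_def spine_1)
qed

lemma smap_eq_word: "\<lbrakk>smap X Y f; partial_monoid Y; u \<in> simplices X n\<rbrakk> \<Longrightarrow> f n u = word Y (map (f 1) (spine X n u))"
  by (simp flip: smap_spine add: word_spine smap_in)

lemma smap_eqI_1: "\<lbrakk>smap X Y f; smap X Y g; partial_monoid Y; sset X; \<And>x. x \<in> simplices X 1 \<Longrightarrow> f 1 x = g 1 x\<rbrakk> \<Longrightarrow> f = g"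
proof (rule smap_eqI)
  assume a: "smap X Y f" "smap X Y g" "partial_monoid Y" "sset X" "\<And>x. x \<in> simplices X 1 \<Longrightarrow> f 1 x = g 1 x"
  show "f n u = g n u" if "u \<in> simplices X n" for n u
  proof -
    have "map (f 1) (spine X n u) = map (g 1) (spine X n u)"
      using a(5) spine_subset[OF a(4) that] by auto
    then show ?thesis using smap_eq_word[OF a(1,3) that] smap_eq_word[OF a(2,3) that] by (simp only:)
  qed
qed

context words
begin

lemma smap_from_word_sset:
  assumes Y: "partial_monoid Y"
    and D: "\<And>ws. D ws \<Longrightarrow> is_word Y (map \<phi> ws)"
    and m: "\<And>p q. D [p, q] \<Longrightarrow> \<phi> (m p q) = wprod Y [\<phi> p, \<phi> q]"
    and e: "\<phi> e = one Y"
  shows "smap word_sset Y (\<lambda>n. \<lambda>ws\<in>simplices word_sset n. word Y (map \<phi> ws))"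
proof -
  have s: "map (\<phi> \<circ> hd) (spine word_sset n ws) = map \<phi> ws" if "ws \<in> simplices word_sset n" for n ws
    using that by (simp add: simplices_word_sset spine_word_sset)
  \<comment> \<open>\<open>\<phi>\<close> is defined on letters, while an edge of
    \<open>word_sset\<close> is a list with one letter; hence the composition with
    \<open>hd\<close>.\<close>
  have "smap word_sset Y (wmap word_sset Y (\<phi> \<circ> hd))"
  proof (rule smap_wmap[OF sset_word_sset Y])
    fix u assume "u \<in> simplices word_sset 2"
    then obtain p q where u: "u = [p, q]" "D [p, q]" by (auto simp: simplices_word_sset length_Suc_conv numeral_2_eq_2)
    have pq: "D [p]" "D [q]" using D_elem[OF u(2)] by auto
    have "[0..<2] = [0, 1::nat]" "[0..<1] = [0::nat]" "[1..<2] = [1::nat]" by (simp_all add: upt_rec numeral_2_eq_2 One_nat_def)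
    then show "(\<phi> \<circ> hd) (edge word_sset 2 0 2 u) = wprod Y [(\<phi> \<circ> hd) (edge word_sset 2 0 1 u), (\<phi> \<circ> hd) (edge word_sset 2 1 2 u)]"
      using pq m[OF u(2)] by (simp add: edge_word_sset u(1) e_m)
  qed (use D e s in \<open>auto simp: simplices_word_sset edge_word_sset\<close>)
  moreover have "wmap word_sset Y (\<phi> \<circ> hd) = (\<lambda>n. \<lambda>ws\<in>simplices word_sset n. word Y (map \<phi> ws))"
    by (intro ext) (auto simp: wmap_def s restrict_def)
  ultimately show ?thesis by simp
qed

lemma smap_to_word_sset:
  assumes X: "sset X"
    and D: "\<And>n u. u \<in> simplices X n \<Longrightarrow> D (map \<phi> (spine X n u))"
    and m: "\<And>u. u \<in> simplices X 2 \<Longrightarrow> \<phi> (edge X 2 0 2 u) = m (\<phi> (edge X 2 0 1 u)) (\<phi> (edge X 2 1 2 u))"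
    and e: "\<And>v. v \<in> simplices X 0 \<Longrightarrow> \<phi> (edge X 0 0 0 v) = e"
  shows "smap X word_sset (\<lambda>n. \<lambda>u\<in>simplices X n. map \<phi> (spine X n u))"
proof -
  have s: "map (\<lambda>x. [\<phi> x]) (spine X n u) = map (\<lambda>y. [y]) (map \<phi> (spine X n u))" for n u by simp
  have "smap X word_sset (wmap X word_sset (\<lambda>x. [\<phi> x]))"
  proof (rule smap_wmap[OF X partial_monoid_word_sset])
    show "is_word word_sset (map (\<lambda>x. [\<phi> x]) (spine X n u))" if "u \<in> simplices X n" for n u
      unfolding s is_word_word_sset using D[OF that] by blast
    show "[\<phi> (edge X 2 0 2 u)] = wprod word_sset [[\<phi> (edge X 2 0 1 u)], [\<phi> (edge X 2 1 2 u)]]" if "u \<in> simplices X 2" for u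
    proof -
      have "D [\<phi> (edge X 2 0 1 u), \<phi> (edge X 2 1 2 u)]" using D[OF that] by (simp add: spine_2)
      from wprod_word_sset[OF this] prd_pair[OF this] m[OF that] show ?thesis by simp
    qed
  qed (use e in \<open>simp add: one_word_sset\<close>)
  moreover have "wmap X word_sset (\<lambda>x. [\<phi> x]) = (\<lambda>n. \<lambda>u\<in>simplices X n. map \<phi> (spine X n u))"
    using word_word_sset[OF D] by (intro ext) (auto simp: wmap_def s restrict_def simp del: map_map)
  ultimately show ?thesis by simp
qed

end

section \<open>Homotopies in terms of words\<close>

lemma smap_word: "\<lbrakk>smap X Y f; is_word X xs\<rbrakk> \<Longrightarrow> is_word Y (map (f 1) xs)"
  unfolding is_word_def by (metis length_map smap_in smap_spine)

lemma smap_word_word: "\<lbrakk>smap X Y f; partial_monoid X; partial_monoid Y; is_word X xs; length xs = n\<rbrakk>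
    \<Longrightarrow> f n (word X xs) = word Y (map (f 1) xs)"
  using smap_eq_word word_simplex by metis

lemma smap_wprod:
  assumes f: "smap X Y f" and X: "partial_monoid X" and Y: "partial_monoid Y" and xs: "is_word X xs"
  shows "f 1 (wprod X xs) = wprod Y (map (f 1) xs)"
  using smap_edge[OF f _ _ word_simplex[OF X xs refl, THEN conjunct1], of 0 "length xs"]
    smap_word_word[OF f X Y xs refl] by (simp add: wprod_def)

lemma smap_one: "\<lbrakk>smap X Y f; partial_monoid X; partial_monoid Y\<rbrakk> \<Longrightarrow> f 1 (one X) = one Y"
  using smap_edge[of X Y f 0 0 0 "vertex X"] edge_deg[of X 0 0 "vertex X"] edge_deg[of Y 0 0 "f 0 (vertex X)"]
    smap_in[of X Y f "vertex X" 0] vertex_in[of X] by simp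

text \<open>Writing \<open>earr i j\<close> for the edge \<open>i \<rightarrow> j\<close> of a standard simplex, the edges of \<open>\<Delta>[1]\<close> are
  \<open>earr 0 0\<close>, \<open>earr 0 1\<close> (which is \<^const>\<open>iota\<close>) and \<open>earr 1 1\<close>.\<close>

definition earr :: "nat \<Rightarrow> nat \<Rightarrow> nat \<Rightarrow> nat" where
  "earr i j = (\<lambda>k\<in>{..1}. if k = 0 then i else j)"

lemma earr_app [simp]: "earr i j 0 = i" "earr i j 1 = j"
  by (auto simp: earr_def)

lemma earr_inject [simp]: "earr i j = earr k l \<longleftrightarrow> i = k \<and> j = l"
  by (metis earr_app)

lemma earr_ops: "\<lbrakk>i \<le> j; j \<le> n\<rbrakk> \<Longrightarrow> earr i j \<in> ops 1 n"
  unfolding earr_def by (rule edge_op)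

lemma iota_earr: "iota = earr 0 1"
  by (auto simp: iota_def earr_def fun_eq_iff One_nat_def)

lemma sset_std_simplex: "sset (std_simplex n)"
  unfolding sset_def std_simplex_def
proof (simp, intro conjI allI ballI)
  show "(\<lambda>x. compose {..k} x \<theta>) \<in> ops m n \<rightarrow> ops k n" if "\<theta> \<in> ops k m" for k m \<theta>
    using that ops_comp by blast
  show "compose {..m} x (\<lambda>i\<in>{..m}. i) = x" if "x \<in> ops m n" for m x
    by (rule ops_eqI[OF ops_comp[OF _ that] that]) (auto intro: opsI simp: compose_eq)
  show "compose {..k} x (compose {..k} \<beta> \<alpha>) = compose {..k} (compose {..m} x \<beta>) \<alpha>"
    if "\<alpha> \<in> ops k m" "\<beta> \<in> ops m l" "x \<in> ops l n" for k m l \<alpha> \<beta> x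
    using that by (auto simp: compose_def fun_eq_iff ops_le)
qed

lemma sset_sprod: "\<lbrakk>sset X; sset Y\<rbrakk> \<Longrightarrow> sset (sprod X Y)"
  by (auto simp: sset_def sprod_def Pi_iff)

lemma simplices_sprod [simp]: "simplices (sprod X Y) n = simplices X n \<times> simplices Y n"
  by (simp add: sprod_def)

lemma act_sprod [simp]: "act (sprod X Y) m n \<theta> (x, y) = (act X m n \<theta> x, act Y m n \<theta> y)"
  by (simp add: sprod_def)

lemma edge_sprod [simp]: "edge (sprod X Y) n i j (x, y) = (edge X n i j x, edge Y n i j y)"
  by (simp add: edge_def)

lemma simplices_std_simplex [simp]: "simplices (std_simplex n) m = ops m n"
  by (simp add: std_simplex_def)

lemma act_std_simplex [simp]: "act (std_simplex n) k m \<theta> x = compose {..k} x \<theta>"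
  by (simp add: std_simplex_def)

lemma edge_std_simplex [simp]: "edge (std_simplex N) n i j \<theta> = earr (\<theta> i) (\<theta> j)"
  by (auto simp: edge_def earr_def compose_def fun_eq_iff)

section \<open>Intertwining elements and simplices of the prism\<close>

text \<open>Stated for functions on 1-simplices, so that composites and inverse functions can be
  inserted directly.\<close>

definition intertwines :: "'b sset \<Rightarrow> 'a sset \<Rightarrow> ('b \<Rightarrow> 'a) \<Rightarrow> 'a \<Rightarrow> ('b \<Rightarrow> 'a) \<Rightarrow> bool" where
  "intertwines Y X f \<eta> g \<longleftrightarrow>
     (\<forall>u v. is_word Y (u @ v) \<longrightarrow> is_word X (map f u @ [\<eta>] @ map g v)) \<and>
     (\<forall>x\<in>simplices Y 1. wprod X [f x, \<eta>] = wprod X [\<eta>, g x])"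

lemma intertwines_word: "intertwines Y X f \<eta> g \<Longrightarrow> is_word Y (u @ v) \<Longrightarrow> is_word X (map f u @ [\<eta>] @ map g v)"
  by (simp add: intertwines_def)

lemma intertwines_comm: "intertwines Y X f \<eta> g \<Longrightarrow> x \<in> simplices Y 1 \<Longrightarrow> wprod X [f x, \<eta>] = wprod X [\<eta>, g x]"
  by (simp add: intertwines_def)

text \<open>The simplex of the prism that runs through \<open>u\<close> at height 0, climbs along a
  degenerate edge of \<open>Y\<close> and runs through \<open>v\<close> at height 1. The inserted
  letter \<open>one Y\<close> provides the degenerate edge, so the climb goes to the value at
  \<open>(one Y, iota)\<close>, the element that determines the homotopy.\<close>

lemma cylinder_word:
  assumes Y: "partial_monoid Y" and X: "partial_monoid X" and \<phi>: "smap (sprod Y (std_simplex 1)) X \<phi>"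
    and uv: "is_word Y (u @ v)"
  defines "n \<equiv> length u + length v + 1" and "\<theta> \<equiv> \<lambda>i\<in>{..length u + length v + 1}. if i \<le> length u then 0 else 1"
  defines "\<sigma> \<equiv> word Y (u @ [one Y] @ v)"
  shows "(\<sigma>, \<theta>) \<in> simplices (sprod Y (std_simplex 1)) n"
    and "spine X n (\<phi> n (\<sigma>, \<theta>)) = map (\<lambda>x. \<phi> 1 (x, earr 0 0)) u @ [\<phi> 1 (one Y, iota)] @ map (\<lambda>x. \<phi> 1 (x, earr 1 1)) v"
    and "\<phi> 1 (wprod Y (u @ [one Y] @ v), iota) = wprod X (map (\<lambda>x. \<phi> 1 (x, earr 0 0)) u @ [\<phi> 1 (one Y, iota)] @ map (\<lambda>x. \<phi> 1 (x, earr 1 1)) v)"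
proof -
  interpret Y: pmon Y by unfold_locales (rule Y)
  have w: "is_word Y (u @ [one Y] @ v)" by (rule Y.D_unit[OF uv])
  have \<sigma>: "\<sigma> \<in> simplices Y n" "spine Y n \<sigma> = u @ [one Y] @ v"
    using word_simplex[OF Y w, of n] by (auto simp: \<sigma>_def n_def)
  show in_n: "(\<sigma>, \<theta>) \<in> simplices (sprod Y (std_simplex 1)) n"
    using \<sigma> unfolding n_def \<theta>_def by (auto intro!: opsI simp del: restrict_apply)
  show sp: "spine X n (\<phi> n (\<sigma>, \<theta>)) = map (\<lambda>x. \<phi> 1 (x, earr 0 0)) u @ [\<phi> 1 (one Y, iota)] @ map (\<lambda>x. \<phi> 1 (x, earr 1 1)) v"
  proof (rule nth_equalityI)
    fix i assume "i < length (spine X n (\<phi> n (\<sigma>, \<theta>)))"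
    then have i: "i < n" by simp
    have "edge Y n i (Suc i) \<sigma> = (u @ [one Y] @ v) ! i" using \<sigma>(2) i spine_nth by metis
    then show "spine X n (\<phi> n (\<sigma>, \<theta>)) ! i =
        (map (\<lambda>x. \<phi> 1 (x, earr 0 0)) u @ [\<phi> 1 (one Y, iota)] @ map (\<lambda>x. \<phi> 1 (x, earr 1 1)) v) ! i"
      using i by (simp add: smap_spine[OF \<phi> in_n], cases "i < length u"; cases "i = length u")
        (auto simp: nth_append nth_Cons' \<theta>_def n_def iota_earr)
  qed (simp add: n_def)
  have "wprod X (spine X n (\<phi> n (\<sigma>, \<theta>))) = edge X n 0 n (\<phi> n (\<sigma>, \<theta>))"
    using word_spine[OF X smap_in[OF \<phi> in_n]] by (simp add: wprod_def)
  also have "\<dots> = \<phi> 1 (edge (sprod Y (std_simplex 1)) n 0 n (\<sigma>, \<theta>))"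
    using smap_edge[OF \<phi> _ _ in_n, of 0 n] by simp
  also have "edge (sprod Y (std_simplex 1)) n 0 n (\<sigma>, \<theta>) = (wprod Y (u @ [one Y] @ v), iota)"
    by (simp add: wprod_def \<sigma>_def n_def \<theta>_def iota_earr One_nat_def)
  finally show "\<phi> 1 (wprod Y (u @ [one Y] @ v), iota) = wprod X (map (\<lambda>x. \<phi> 1 (x, earr 0 0)) u @ [\<phi> 1 (one Y, iota)] @ map (\<lambda>x. \<phi> 1 (x, earr 1 1)) v)"
    unfolding sp ..
qed

text \<open>Taking \<open>u = [x]\<close>, \<open>v = []\<close> and then \<open>u = []\<close>,
  \<open>v = [x]\<close> computes the image of the diagonal over \<open>x\<close> in two
  ways.\<close>

lemma cylinder_intertwines:
  assumes Y: "partial_monoid Y" and X: "partial_monoid X" and \<phi>: "smap (sprod Y (std_simplex 1)) X \<phi>"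
  shows "intertwines Y X (\<lambda>x. \<phi> 1 (x, earr 0 0)) (\<phi> 1 (one Y, iota)) (\<lambda>x. \<phi> 1 (x, earr 1 1))"
    and "x \<in> simplices Y 1 \<Longrightarrow> \<phi> 1 (x, iota) = wprod X [\<phi> 1 (x, earr 0 0), \<phi> 1 (one Y, iota)]"
proof -
  interpret Y: pmon Y by unfold_locales (rule Y)
  note C = cylinder_word[OF Y X \<phi>]
  have 1: "\<phi> 1 (x, iota) = wprod X [\<phi> 1 (x, earr 0 0), \<phi> 1 (one Y, iota)]
      \<and> \<phi> 1 (x, iota) = wprod X [\<phi> 1 (one Y, iota), \<phi> 1 (x, earr 1 1)]" if x: "x \<in> simplices Y 1" for x
  proof -
    have w: "is_word Y ([x] @ [])" "is_word Y ([] @ [x])" using x by (simp_all add: Y.is_word_1)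
    then show ?thesis using C(3)[OF w(1)] C(3)[OF w(2)] Y.m_e[of x] Y.e_m[of x] by simp
  qed
  then show "x \<in> simplices Y 1 \<Longrightarrow> \<phi> 1 (x, iota) = wprod X [\<phi> 1 (x, earr 0 0), \<phi> 1 (one Y, iota)]" by blast
  show "intertwines Y X (\<lambda>x. \<phi> 1 (x, earr 0 0)) (\<phi> 1 (one Y, iota)) (\<lambda>x. \<phi> 1 (x, earr 1 1))"
    unfolding intertwines_def
  proof (intro conjI allI impI ballI)
    fix u v assume "is_word Y (u @ v)"
    from is_word_spine[OF smap_in[OF \<phi> C(1)[OF this]]] C(2)[OF this]
    show "is_word X (map (\<lambda>x. \<phi> 1 (x, earr 0 0)) u @ [\<phi> 1 (one Y, iota)] @ map (\<lambda>x. \<phi> 1 (x, earr 1 1)) v)"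
      by simp
  qed (use 1 in metis)
qed

lemma degen_v: "degen (std_simplex 1) n v0 = (\<lambda>i\<in>{..n}. 0)" "degen (std_simplex 1) n v1 = (\<lambda>i\<in>{..n}. 1)"
  by (auto simp: degen_def v0_eq v1_eq compose_def fun_eq_iff)

lemma degen_v_1: "degen (std_simplex 1) 1 v0 = earr 0 0" "degen (std_simplex 1) 1 v1 = earr 1 1"
  by (auto simp: degen_v earr_def fun_eq_iff)

lemma smap_cyl_end:
  assumes "sset Y" and v: "v = v0 \<or> v = v1"
  shows "smap Y (sprod Y (std_simplex 1)) (cyl_end Y v)"
proof (rule smapI)
  let ?d = "\<lambda>n. degen (std_simplex 1) n v"
  have d: "?d n \<in> ops n 1" for n
    using v by (elim disjE) (simp_all only: degen_v, (rule opsI; simp)+)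
  have c: "compose {..m} (?d n) \<theta> = ?d m" if "\<theta> \<in> ops m n" for m n \<theta>
    using v by (elim disjE) (simp_all only: degen_v, auto simp: compose_def fun_eq_iff ops_le[OF that])
  show "cyl_end Y v n u \<in> simplices (sprod Y (std_simplex 1)) n" if "u \<in> simplices Y n" for n u
    using that d by (simp add: cyl_end_def)
  show "cyl_end Y v m (act Y m n \<theta> u) = act (sprod Y (std_simplex 1)) m n \<theta> (cyl_end Y v n u)"
    if "\<theta> \<in> ops m n" "u \<in> simplices Y n" for m n \<theta> u
    using that c act_in[OF assms(1) that] by (simp add: cyl_end_def)
qed (simp add: cyl_end_def)

lemma ops_to_1_cases:
  assumes "\<theta> \<in> ops n 1"
  obtains "\<And>i. i \<le> n \<Longrightarrow> \<theta> i = 1"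
  | k where "k < n" "\<And>i. i \<le> k \<Longrightarrow> \<theta> i = 0" "\<And>i. k < i \<Longrightarrow> i \<le> n \<Longrightarrow> \<theta> i = 1"
  | "\<And>i. i \<le> n \<Longrightarrow> \<theta> i = 0"
proof -
  have v: "\<theta> i = 0 \<or> \<theta> i = 1" if "i \<le> n" for i using ops_le[OF assms that] by auto
  consider "\<theta> 0 = 1" | "\<theta> n = 0" | "\<theta> 0 = 0" "\<theta> n = 1" using v[of 0] v[of n] by auto
  then show ?thesis
  proof cases
    case 1
    then have "\<theta> i = 1" if "i \<le> n" for i using v[OF that] ops_mono[OF assms, of 0 i] that by auto
    then show ?thesis by (rule that(1))
  next
    case 2
    then have "\<theta> i = 0" if "i \<le> n" for i using v[OF that] ops_mono[OF assms, of i n] that by auto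
    then show ?thesis by (rule that(3))
  next
    case 3
    \<comment> \<open>\<open>k\<close> will be the last vertex sent to 0.\<close>
    define k where "k = (LEAST k. \<theta> (Suc k) = 1)"
    obtain n' where n': "n = Suc n'" using 3 by (cases n) auto
    have "\<theta> (Suc n') = 1" using 3(2) n' by simp
    then have 4: "\<theta> (Suc k) = 1" "k \<le> n'"
      unfolding k_def by (rule LeastI, rule Least_le)
    have a: "\<theta> i = 0" if "i \<le> k" for i
    proof (cases i)
      case (Suc j)
      then have "\<theta> (Suc j) \<noteq> 1" using not_less_Least[of j "\<lambda>k. \<theta> (Suc k) = 1"] that by (auto simp: k_def)
      then show ?thesis using v[of i] 4(2) that n' Suc by auto
    qed (use 3 in simp)
    have b: "\<theta> i = 1" if "k < i" "i \<le> n" for i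
      using ops_mono[OF assms, of "Suc k" i] 4(1) v[of i] that by linarith
    have "k < n" using 4 n' by simp
    then show ?thesis by (rule that(2)) (auto simp: a b)
  qed
qed

lemma htpc_intertwines:
  assumes Y: "partial_monoid Y" and X: "partial_monoid X" and h: "htpc Y X f \<eta> g"
  shows "intertwines Y X (f 1) \<eta> (g 1)"
proof -
  obtain F where F: "smap (sprod Y (std_simplex 1)) X F" "f = scomp Y F (cyl_end Y v0)"
    "g = scomp Y F (cyl_end Y v1)" "F 1 (one Y, iota) = \<eta>"
    using h unfolding htpc_def homotopy_def by blast
  have fg: "f 1 x = F 1 (x, earr 0 0) \<and> g 1 x = F 1 (x, earr 1 1)" if "x \<in> simplices Y 1" for x
    using that by (simp add: F(2,3) scomp_app cyl_end_def degen_v_1)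
  note i = cylinder_intertwines(1)[OF Y X F(1), unfolded F(4)]
  show ?thesis unfolding intertwines_def
  proof (intro conjI allI impI ballI)
    fix u v assume w: "is_word Y (u @ v)"
    then have "set u \<union> set v \<subseteq> simplices Y 1" using is_word_subset[OF pm_sset[OF Y] w] by simp
    then have "map (f 1) u = map (\<lambda>x. F 1 (x, earr 0 0)) u" "map (g 1) v = map (\<lambda>x. F 1 (x, earr 1 1)) v"
      using fg by auto
    then show "is_word X (map (f 1) u @ [\<eta>] @ map (g 1) v)"
      using intertwines_word[OF i w] by (simp only:)
  qed (use fg intertwines_comm[OF i] in simp)
qed

text \<open>The homotopy is prescribed on the three kinds of edges of the prism; on the diagonal
  over \<open>x\<close> the value \<open>f 1 x\<close> times \<open>\<eta>\<close> is forced by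
  \<open>cylinder_intertwines\<close>.\<close>

lemma intertwines_htpc:
  assumes Y: "partial_monoid Y" and X: "partial_monoid X" and f: "smap Y X f" and g: "smap Y X g"
    and h: "intertwines Y X (f 1) \<eta> (g 1)"
  shows "htpc Y X f \<eta> g"
proof -
  interpret Y: pmon Y by unfold_locales (rule Y)
  interpret X: pmon X by unfold_locales (rule X)
  let ?P = "sprod Y (std_simplex 1)"
  have P: "sset ?P" by (intro sset_sprod Y.ss sset_std_simplex)
  define F1 where "F1 = (\<lambda>(x, \<theta>). if \<theta> = earr 0 0 then f 1 x else if \<theta> = earr 1 1 then g 1 x else wprod X [f 1 x, \<eta>])"
  have F1: "F1 (x, earr 0 0) = f 1 x" "F1 (x, earr 1 1) = g 1 x" "F1 (x, earr 0 1) = wprod X [f 1 x, \<eta>]" for x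
    by (auto simp: F1_def)
  let ?F = "wmap ?P X F1"
  have F: "smap ?P X ?F"
  proof (rule smap_wmap[OF P X])
    fix n u assume "u \<in> simplices ?P n"
    then obtain y \<theta> where u: "u = (y, \<theta>)" and y: "y \<in> simplices Y n" and \<theta>: "\<theta> \<in> ops n 1" by auto
    let ?ys = "spine Y n y"
    have ys: "is_word Y ?ys" by (rule is_word_spine[OF y])
    from \<theta> show "is_word X (map F1 (spine ?P n u))"
    proof (cases rule: ops_to_1_cases)
      case 1
      then have "map F1 (spine ?P n u) = map (g 1) ?ys"
        by (auto simp: u spine_def F1)
      then show ?thesis using smap_word[OF g ys] by simp
    next
      case (2 k)
      \<comment> \<open>The letter with index \<open>k\<close> crosses from height 0 to height 1:
        \<open>\<eta>\<close> is inserted directly behind its image and then absorbed into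
        it.\<close>
      have "is_word Y (take (Suc k) ?ys @ drop (Suc k) ?ys)" using ys by simp
      from intertwines_word[OF h this]
      have "is_word X (map (f 1) (take k ?ys) @ [f 1 (?ys ! k), \<eta>] @ map (g 1) (drop (Suc k) ?ys))"
        using 2(1) by (simp add: take_Suc_conv_app_nth)
      from X.D_contract[OF this]
      have "is_word X (map (f 1) (take k ?ys) @ [wprod X [f 1 (?ys ! k), \<eta>]] @ map (g 1) (drop (Suc k) ?ys))" .
      also have "map (f 1) (take k ?ys) @ [wprod X [f 1 (?ys ! k), \<eta>]] @ map (g 1) (drop (Suc k) ?ys) = map F1 (spine ?P n u)"
      proof (rule nth_equalityI)
        fix i assume "i < length (map (f 1) (take k ?ys) @ [wprod X [f 1 (?ys ! k), \<eta>]] @ map (g 1) (drop (Suc k) ?ys))"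
        then have i: "i < n" using 2(1) by simp
        consider "i < k" | "i = k" | "k < i" by linarith
        then show "(map (f 1) (take k ?ys) @ [wprod X [f 1 (?ys ! k), \<eta>]] @ map (g 1) (drop (Suc k) ?ys)) ! i = map F1 (spine ?P n u) ! i"
          using 2 i by cases (auto simp: nth_append nth_Cons' F1 u)
      qed (use 2 in simp)
      finally show ?thesis .
    next
      case 3
      then have "map F1 (spine ?P n u) = map (f 1) ?ys"
        by (auto simp: u spine_def F1)
      then show ?thesis using smap_word[OF f ys] by simp
    qed
  next
    fix u assume "u \<in> simplices ?P 2"
    then obtain y \<theta> where u: "u = (y, \<theta>)" and y: "y \<in> simplices Y 2" and \<theta>: "\<theta> \<in> ops 2 1" by auto
    let ?a = "edge Y 2 0 1 y" and ?b = "edge Y 2 1 2 y"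
    have w: "is_word Y [?a, ?b]" and ab: "edge Y 2 0 2 y = wprod Y [?a, ?b]"
      using edge_mult[OF Y y, of 0 1 2] by simp_all
    have a: "is_word Y [?a]" "is_word Y [?b]" using w Y.D_elem by auto
    have b: "?b \<in> simplices Y 1" using a by (simp add: Y.is_word_1)
    have fab: "f 1 (wprod Y [?a, ?b]) = wprod X [f 1 ?a, f 1 ?b]" "g 1 (wprod Y [?a, ?b]) = wprod X [g 1 ?a, g 1 ?b]"
      using smap_wprod[OF f Y X w] smap_wprod[OF g Y X w] by simp_all
    have 1: "is_word X [f 1 ?a, f 1 ?b, \<eta>]" using intertwines_word[OF h, of "[?a, ?b]" "[]"] w by simp
    have 2: "is_word X [f 1 ?a, \<eta>, g 1 ?b]" using intertwines_word[OF h, of "[?a]" "[?b]"] w by simp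
    have "(\<theta> 0 = 0 \<or> \<theta> 0 = 1) \<and> (\<theta> 1 = 0 \<or> \<theta> 1 = 1) \<and> (\<theta> 2 = 0 \<or> \<theta> 2 = 1) \<and> \<theta> 0 \<le> \<theta> 1 \<and> \<theta> 1 \<le> \<theta> 2"
      using ops_le[OF \<theta>, of 0] ops_le[OF \<theta>, of 1] ops_le[OF \<theta>, of 2] ops_mono[OF \<theta>, of 0 1] ops_mono[OF \<theta>, of 1 2]
      by (auto simp: le_Suc_eq One_nat_def)
    then consider "\<theta> 0 = 0" "\<theta> 1 = 0" "\<theta> 2 = 0" | "\<theta> 0 = 0" "\<theta> 1 = 0" "\<theta> 2 = 1"
      | "\<theta> 0 = 0" "\<theta> 1 = 1" "\<theta> 2 = 1" | "\<theta> 0 = 1" "\<theta> 1 = 1" "\<theta> 2 = 1" by auto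
    \<comment> \<open>For vertices of heights 0, 1, 1 the letter \<open>\<eta>\<close> stands in
      front of \<open>g 1 ?b\<close> and is moved behind \<open>f 1 ?b\<close> by the intertwining
      relation. For heights 0, 0, 1 associativity suffices.\<close>
    then show "F1 (edge ?P 2 0 2 u) = wprod X [F1 (edge ?P 2 0 1 u), F1 (edge ?P 2 1 2 u)]"
      using X.assoc[OF 1] X.assoc[OF 2] intertwines_comm[OF h b]
      by cases (simp_all add: u F1 ab fab)
  next
    fix u assume "u \<in> simplices ?P 0"
    then obtain y \<theta> where u: "u = (y, \<theta>)" and y: "y \<in> simplices Y 0" and \<theta>: "\<theta> \<in> ops 0 1" by auto
    have "\<theta> 0 = 0 \<or> \<theta> 0 = 1" using ops_le[OF \<theta>, of 0] by auto
    then show "F1 (edge ?P 0 0 0 u) = one X"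
      using edge_deg[OF Y _ y] smap_one[OF f Y X] smap_one[OF g Y X] by (auto simp: u F1)
  qed
  have \<eta>: "is_word X [\<eta>]" using intertwines_word[OF h, of "[]" "[]"] Y.D_Nil by simp
  have F_1: "?F 1 (x, \<theta>) = F1 (x, \<theta>)" if "x \<in> simplices Y 1" "\<theta> = earr 0 0 \<or> \<theta> = earr 1 1 \<or> \<theta> = earr 0 1" for x \<theta>
  proof (rule wmap_1[OF P X])
    show "(x, \<theta>) \<in> simplices ?P 1" using that by (auto intro!: earr_ops)
    have "is_word X [f 1 x, \<eta>]" using intertwines_word[OF h, of "[x]" "[]"] that by (simp add: Y.is_word_1)
    then show "is_word X [F1 (x, \<theta>)]" using that smap_in[OF f] smap_in[OF g]
      by (auto simp: F1 X.is_word_1 X.mult_in)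
  qed
  have e: "scomp Y ?F (cyl_end Y v0) = f" "scomp Y ?F (cyl_end Y v1) = g"
  proof -
    have s0: "smap Y X (scomp Y ?F (cyl_end Y v0))" and s1: "smap Y X (scomp Y ?F (cyl_end Y v1))"
      by (rule smap_scomp[OF Y.ss smap_cyl_end[OF Y.ss] F], simp)+
    show "scomp Y ?F (cyl_end Y v0) = f"
      by (rule smap_eqI_1[OF s0 f X Y.ss]) (simp add: scomp_app cyl_end_def degen_v_1 F_1 F1)
    show "scomp Y ?F (cyl_end Y v1) = g"
      by (rule smap_eqI_1[OF s1 g X Y.ss]) (simp add: scomp_app cyl_end_def degen_v_1 F_1 F1)
  qed
  have "?F 1 (one Y, iota) = \<eta>"
    using F_1[of "one Y" iota] one_in[OF Y] smap_one[OF f Y X] X.e_m[OF \<eta>] by (simp add: iota_earr F1)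
  with F e[symmetric] have "homotopy Y X g f ?F \<and> ?F 1 (one Y, iota) = \<eta>"
    unfolding homotopy_def by (intro conjI)
  then show ?thesis unfolding htpc_def by (rule exI[where x = ?F])
qed

section \<open>Automorphisms and the semidirect product\<close>

fun tws :: "('a \<times> ('a \<Rightarrow> 'a)) list \<Rightarrow> 'a list" where
  "tws [] = []"
| "tws ((x, f) # ws) = x # map f (tws ws)"

definition comps :: "('a \<times> ('a \<Rightarrow> 'a)) list \<Rightarrow> 'a \<Rightarrow> 'a" where
  "comps ws = foldr (\<lambda>p. (\<circ>) (snd p)) ws id"

lemma comps_simps [simp]: "comps [] = id" "comps (p # ws) = snd p \<circ> comps ws"
  by (simp_all add: comps_def)

lemma comps_append [simp]: "comps (a @ b) = comps a \<circ> comps b"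
  by (induction a) (simp_all add: comp_assoc)

lemma tws_append: "tws (a @ b) = tws a @ map (comps a) (tws b)"
  by (induction a rule: tws.induct) simp_all

lemma twisted_spine_tws: "twisted_spine t ws = tws (map (\<lambda>(x, g). (x, t g 1)) ws)"
proof (induction ws)
  case (Cons p ws)
  obtain x g where p: "p = (x, g)" by (cases p)
  have "[0..<length (p # ws)] = 0 # map Suc [0..<length ws]" by (simp add: map_Suc_upt upt_conv_Cons del: upt_Suc)
  then have "twisted_spine t (p # ws) = x # map (t g 1) (twisted_spine t ws)"
    by (simp add: twisted_spine_def p)
  then show ?case using Cons by (simp add: p)
qed (simp add: twisted_spine_def)

context pgrp
begin

abbreviation mult (infixl "\<cdot>" 70) where "x \<cdot> y \<equiv> wprod X [x, y]"

abbreviation "X1 \<equiv> simplices X 1"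

text \<open>An automorphism seen on 1-simplices. Words are preserved in both directions, since the
  inverse of a bijection that merely preserves them may fail to do so.\<close>

definition waut :: "('a \<Rightarrow> 'a) \<Rightarrow> bool" where
  "waut f \<longleftrightarrow> bij_betw f X1 X1 \<and> (\<forall>xs. set xs \<subseteq> X1 \<longrightarrow> is_word X (map f xs) = is_word X xs) \<and>
     (\<forall>x y. is_word X [x, y] \<longrightarrow> f (x \<cdot> y) = f x \<cdot> f y)"

abbreviation finv :: "('a \<Rightarrow> 'a) \<Rightarrow> 'a \<Rightarrow> 'a" where "finv f \<equiv> inv_into X1 f"

lemma waut_in: "waut f \<Longrightarrow> x \<in> X1 \<Longrightarrow> f x \<in> X1"
  by (auto simp: waut_def bij_betw_def)

lemma is_word_set: "is_word X xs \<Longrightarrow> set xs \<subseteq> X1"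
  by (auto intro: is_word_in)

lemma waut_word: "waut f \<Longrightarrow> set xs \<subseteq> X1 \<Longrightarrow> is_word X (map f xs) = is_word X xs"
  by (simp add: waut_def)

lemma waut_word': "waut f \<Longrightarrow> is_word X xs \<Longrightarrow> is_word X (map f xs)"
  using waut_word is_word_set by simp

lemma waut_mult: "waut f \<Longrightarrow> is_word X [x, y] \<Longrightarrow> f (x \<cdot> y) = f x \<cdot> f y"
  by (simp add: waut_def)

lemma waut_inj: "waut f \<Longrightarrow> x \<in> X1 \<Longrightarrow> y \<in> X1 \<Longrightarrow> f x = f y \<longleftrightarrow> x = y"
  by (auto simp: waut_def bij_betw_def inj_on_def)

lemma waut_id: "(\<And>x. x \<in> X1 \<Longrightarrow> f x = x) \<Longrightarrow> waut f"
proof -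
  assume f: "\<And>x. x \<in> X1 \<Longrightarrow> f x = x"
  have 1: "map f xs = xs" if "set xs \<subseteq> X1" for xs using that f by (auto intro: map_idI)
  have "bij_betw f X1 X1" using f by (simp add: bij_betw_def inj_on_def)
  moreover have "f (x \<cdot> y) = f x \<cdot> f y" if "is_word X [x, y]" for x y
    using f is_word_set[OF that] mult_in[OF that] by simp
  ultimately show ?thesis using 1 unfolding waut_def by simp
qed

lemma waut_comp: "waut f \<Longrightarrow> waut g \<Longrightarrow> waut (f \<circ> g)"
  unfolding waut_def[of "f \<circ> g"]
proof (intro conjI allI impI)
  assume f: "waut f" and g: "waut g"
  show "bij_betw (f \<circ> g) X1 X1" using f g bij_betw_trans unfolding waut_def by blast
  show "is_word X (map (f \<circ> g) xs) = is_word X xs" if "set xs \<subseteq> X1" for xs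
  proof -
    have "set (map g xs) \<subseteq> X1" using that waut_in[OF g] by auto
    from waut_word[OF f this] waut_word[OF g that] show ?thesis by simp
  qed
  show "(f \<circ> g) (x \<cdot> y) = (f \<circ> g) x \<cdot> (f \<circ> g) y" if "is_word X [x, y]" for x y
    using waut_mult[OF g that] waut_mult[OF f, of "g x" "g y"] waut_word'[OF g that] by simp
qed

lemma finv:
  assumes "waut f" "x \<in> X1"
  shows "finv f x \<in> X1" "f (finv f x) = x" "finv f (f x) = x"
  using assms unfolding waut_def
  by (auto simp: bij_betw_def inv_into_into f_inv_into_f)

lemma map_finv: "waut f \<Longrightarrow> set xs \<subseteq> X1 \<Longrightarrow> map f (map (finv f) xs) = xs"
  by (auto simp: finv intro!: map_idI)

lemma waut_finv: assumes f: "waut f" shows "waut (finv f)"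
  unfolding waut_def
proof (intro conjI allI impI)
  show "bij_betw (finv f) X1 X1" using f by (simp add: waut_def bij_betw_inv_into)
  show w: "is_word X (map (finv f) xs) = is_word X xs" if "set xs \<subseteq> X1" for xs
  proof -
    have "set (map (finv f) xs) \<subseteq> X1" using that finv[OF f] by auto
    from waut_word[OF f this] map_finv[OF f that] show ?thesis by simp
  qed
  show "finv f (x \<cdot> y) = finv f x \<cdot> finv f y" if xy: "is_word X [x, y]" for x y
  proof -
    have "x \<in> X1" "y \<in> X1" using is_word_set[OF xy] by auto
    moreover have "is_word X [finv f x, finv f y]" using w[OF is_word_set[OF xy]] xy by simp
    ultimately show ?thesis using waut_mult[OF f, of "finv f x" "finv f y"] mult_in
      by (metis finv(2,3) f)
  qed
qed

lemma waut_one: assumes f: "waut f" shows "f (one X) = one X"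
proof -
  have w: "is_word X [one X, one X]" using D_unit[of "[]" "[one X]"] D_one by simp
  have w': "is_word X [f (one X), f (one X)]" using waut_word'[OF f w] by simp
  have "f (one X) = f (one X) \<cdot> f (one X)" using waut_mult[OF f w] m_e[OF D_one] by simp
  then show ?thesis using lcancel[OF w'] iv_m[of "f (one X)"] D_elem[OF w'] by simp
qed

lemma waut_iv: assumes f: "waut f" and x: "x \<in> X1" shows "f (iv x) = iv (f x)"
proof -
  have w: "is_word X [iv x, x]" using D_inv[of "[x]"] x by (simp add: is_word_1)
  have w': "is_word X [f (iv x), f x]" using waut_word'[OF f w] by simp
  have "f (iv x) \<cdot> f x = one X" using waut_mult[OF f w] iv_m[of x] x waut_one[OF f] by (simp add: is_word_1)
  then show ?thesis using rcancel[OF w'] e_m[OF D_iv1[of "f x"]] waut_in[OF f x] by (simp add: is_word_1)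
qed

lemma waut_prd: "waut f \<Longrightarrow> is_word X xs \<Longrightarrow> f (prd xs) = prd (map f xs)"
proof (induction xs rule: rev_induct)
  case (snoc x xs)
  then show ?case using D_prefix[of xs "[x]"] waut_mult[of f "prd xs" x] D_prd[of "[]" xs "[x]"] by simp
qed (simp add: waut_one)

lemma Aut_waut: assumes "f \<in> Aut X" shows "waut (f 1)"
proof -
  have f: "siso X X f" using assms by (simp add: Aut_def)
  then have sf: "smap X X f" by (rule siso_smap)
  obtain g where g: "smap X X g" "\<And>x. x \<in> X1 \<Longrightarrow> g 1 (f 1 x) = x"
    using smap_sinv[OF ss sf siso_bij[OF f]] by blast
  have "is_word X (map (f 1) xs) = is_word X xs" if "set xs \<subseteq> X1" for xs
  proof
    assume "is_word X (map (f 1) xs)"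
    from smap_word[OF g(1) this] have "is_word X (map (g 1) (map (f 1) xs))" .
    moreover have "map (g 1) (map (f 1) xs) = xs" using that g(2) by (auto intro!: map_idI)
    ultimately show "is_word X xs" by simp
  qed (rule smap_word[OF sf])
  then show ?thesis using siso_bij[OF f, of 1] smap_wprod[OF sf pm pm] by (simp add: waut_def)
qed

lemma smap_waut: assumes f: "waut f" shows "smap X X (wmap X X f)" and "x \<in> X1 \<Longrightarrow> wmap X X f 1 x = f x"
proof -
  show "smap X X (wmap X X f)"
  proof (rule smap_wmap[OF ss pm])
    show "is_word X (map f (spine X n u))" if "u \<in> simplices X n" for n u
      by (rule waut_word'[OF f is_word_spine[OF that]])
    show "f (edge X 2 0 2 u) = f (edge X 2 0 1 u) \<cdot> f (edge X 2 1 2 u)" if "u \<in> simplices X 2" for u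
      using edge_mult[OF pm that, of 0 1 2] waut_mult[OF f, of "edge X 2 0 1 u" "edge X 2 1 2 u"] by simp
    show "f (edge X 0 0 0 v) = one X" if "v \<in> simplices X 0" for v
      using edge_deg[OF pm _ that] waut_one[OF f] by simp
  qed
  show "x \<in> X1 \<Longrightarrow> wmap X X f 1 x = f x"
    by (rule wmap_1[OF ss pm]) (auto simp: is_word_1 waut_in[OF f])
qed

lemma smap_spine_map: "waut f \<Longrightarrow> u \<in> simplices X n \<Longrightarrow> spine X n (wmap X X f n u) = map f (spine X n u)"
  using smap_spine[OF smap_waut(1), of f u n] smap_waut(2)[of f] spine_subset[OF ss, of u n] by auto

lemma waut_Aut: assumes f: "waut f" shows "wmap X X f \<in> Aut X"
  unfolding Aut_def mem_Collect_eq
proof (rule sisoI[OF ss smap_waut(1)[OF f]])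
  note g = waut_finv[OF f]
  have 1: "wmap X X p n (wmap X X q n u) = u"
    if "waut p" "waut q" "\<And>x. x \<in> X1 \<Longrightarrow> p (q x) = x" "u \<in> simplices X n" for p q n u
  proof (rule pm_spine_eqD[OF pm _ that(4)])
    have "map (p \<circ> q) (spine X n u) = spine X n u" using that(3) spine_subset[OF ss that(4)] by (auto intro!: map_idI)
    then show "spine X n (wmap X X p n (wmap X X q n u)) = spine X n u"
      using that smap_in[OF smap_waut(1)] by (simp add: smap_spine_map)
  qed (use that smap_in[OF smap_waut(1)] in blast)
  show "bij_betw (wmap X X f n) (simplices X n) (simplices X n)" for n
  proof (rule bij_betw_byWitness[of _ "wmap X X (finv f) n"])
    show "\<forall>u\<in>simplices X n. wmap X X (finv f) n (wmap X X f n u) = u"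
      using 1[OF g f] finv(3)[OF f] by blast
    show "\<forall>u\<in>simplices X n. wmap X X f n (wmap X X (finv f) n u) = u"
      using 1[OF f g] finv(2)[OF f] by blast
    show "wmap X X f n ` simplices X n \<subseteq> simplices X n" "wmap X X (finv f) n ` simplices X n \<subseteq> simplices X n"
      using smap_in[OF smap_waut(1)[OF f]] smap_in[OF smap_waut(1)[OF g]] by blast+
  qed
qed

section \<open>Calculus of intertwining elements\<close>

lemma intw_cong: "\<lbrakk>intertwines X X f \<eta> g; \<And>x. x \<in> X1 \<Longrightarrow> f x = f' x; \<And>x. x \<in> X1 \<Longrightarrow> g x = g' x\<rbrakk> \<Longrightarrow> intertwines X X f' \<eta> g'"
  unfolding intertwines_def
proof (intro conjI allI impI ballI)
  assume a: "(\<forall>u v. is_word X (u @ v) \<longrightarrow> is_word X (map f u @ [\<eta>] @ map g v)) \<and> (\<forall>x\<in>X1. f x \<cdot> \<eta> = \<eta> \<cdot> g x)"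
    and f: "\<And>x. x \<in> X1 \<Longrightarrow> f x = f' x" and g: "\<And>x. x \<in> X1 \<Longrightarrow> g x = g' x"
  show "is_word X (map f' u @ [\<eta>] @ map g' v)" if "is_word X (u @ v)" for u v
  proof -
    have "map f' u = map f u" "map g' v = map g v" using is_word_set[OF that] f g by auto
    then show ?thesis using a that by (simp only:)
  qed
qed auto

lemma intw_comp_right:
  assumes h: "intertwines X X f \<eta> g" and F: "waut F"
  shows "intertwines X X (f \<circ> F) \<eta> (g \<circ> F)"
  unfolding intertwines_def
proof (intro conjI allI impI ballI)
  show "is_word X (map (f \<circ> F) u @ [\<eta>] @ map (g \<circ> F) v)" if "is_word X (u @ v)" for u v
    using intertwines_word[OF h, of "map F u" "map F v"] waut_word'[OF F that] by simp
  show "(f \<circ> F) x \<cdot> \<eta> = \<eta> \<cdot> (g \<circ> F) x" if "x \<in> X1" for x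
    using intertwines_comm[OF h waut_in[OF F that]] by simp
qed

lemma intw_comp_left:
  assumes h: "intertwines X X f \<eta> g" and F: "waut F"
  shows "intertwines X X (F \<circ> f) (F \<eta>) (F \<circ> g)"
  unfolding intertwines_def
proof (intro conjI allI impI ballI)
  show "is_word X (map (F \<circ> f) u @ [F \<eta>] @ map (F \<circ> g) v)" if "is_word X (u @ v)" for u v
    using waut_word'[OF F intertwines_word[OF h that]] by simp
  show "(F \<circ> f) x \<cdot> F \<eta> = F \<eta> \<cdot> (F \<circ> g) x" if "x \<in> X1" for x
    using intertwines_comm[OF h that] waut_mult[OF F, of "f x" \<eta>] waut_mult[OF F, of \<eta> "g x"]
      intertwines_word[OF h, of "[x]" "[]"] intertwines_word[OF h, of "[]" "[x]"] that by (simp add: is_word_1)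
qed

text \<open>Every word is the image under \<open>f\<close> of another word, so requiring images in
  front of \<open>\<eta>\<close> is no restriction.\<close>

lemma intw_append:
  assumes "\<And>u. is_word X u \<Longrightarrow> is_word X (map f u @ [\<eta>])" "waut f" "is_word X xs"
  shows "is_word X (xs @ [\<eta>])"
  using assms(1)[of "map (finv f) xs"] map_finv[OF assms(2) is_word_set[OF assms(3)]]
    waut_word'[OF waut_finv[OF assms(2)] assms(3)] by simp

lemma intw_append': "\<lbrakk>intertwines X X f \<eta> g; waut f; is_word X xs\<rbrakk> \<Longrightarrow> is_word X (xs @ [\<eta>])"
  by (rule intw_append) (use intertwines_word[of X X f \<eta> g _ "[]"] in simp)

lemma intw_prepend: "\<lbrakk>intertwines X X f \<eta> g; waut g; is_word X xs\<rbrakk> \<Longrightarrow> is_word X (\<eta> # xs)"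
  using intertwines_word[of X X f \<eta> g "[]" "map (finv g) xs"] map_finv[of g xs] is_word_set[of xs]
    waut_word'[OF waut_finv, of g xs] by simp

text \<open>The words are obtained by inverting \<open>u @ v\<close>, inserting
  \<open>\<eta>\<close> and inverting again.\<close>

lemma intw_sym:
  assumes h: "intertwines X X f \<eta> g" and f: "waut f" and g: "waut g"
  shows "intertwines X X g (iv \<eta>) f"
proof -
  have w: "is_word X (map g u @ [iv \<eta>] @ map f v)" if uv: "is_word X (u @ v)" for u v
  proof -
    have "is_word X (rev (map iv v) @ rev (map iv u))" using D_iv[OF uv] by simp
    from D_iv[OF intertwines_word[OF h this]]
    have "is_word X (map (\<lambda>x. iv (g (iv x))) u @ [iv \<eta>] @ map (\<lambda>x. iv (f (iv x))) v)"
      by (simp add: rev_map comp_def)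
    moreover have "iv (f (iv x)) = f x \<and> iv (g (iv x)) = g x" if "x \<in> X1" for x
      using that waut_iv[OF f] waut_iv[OF g] waut_in[OF f] waut_in[OF g] iv_iv by (simp add: is_word_1)
    then have "map (\<lambda>x. iv (g (iv x))) u = map g u" "map (\<lambda>x. iv (f (iv x))) v = map f v"
      using is_word_set[OF uv] by auto
    ultimately show ?thesis by (simp only:)
  qed
  moreover have "g x \<cdot> iv \<eta> = iv \<eta> \<cdot> f x" if x: "x \<in> X1" for x
  proof -
    have w0: "is_word X [f x, \<eta>]" "is_word X [\<eta>, g x]"
      using x intertwines_word[OF h, of "[x]" "[]"] intertwines_word[OF h, of "[]" "[x]"] by (simp_all add: is_word_1)
    have w1: "is_word X [iv \<eta>, f x]" using w[of "[]" "[x]"] x by (simp add: is_word_1)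
    have w2: "is_word X [iv \<eta>, f x, \<eta>]" using intw_append'[OF h f w1] by simp
    have "is_word X (map g u @ [iv \<eta>])" if "is_word X u" for u using w[of u "[]"] that by simp
    from intw_append[OF this g w2] have w3: "is_word X ([iv \<eta>] @ [f x, \<eta>] @ [iv \<eta>])" by simp
    have w4: "is_word X [iv \<eta>, f x \<cdot> \<eta>, iv \<eta>]" using D_contract[OF w3] by simp
    \<comment> \<open>Of the two bracketings of \<open>w4\<close> one gives
      \<open>iv \<eta> \<cdot> f x\<close>; the other gives \<open>g x \<cdot> iv \<eta>\<close>,
      once \<open>f x \<cdot> \<eta>\<close> is replaced by
      \<open>\<eta> \<cdot> g x\<close>.\<close>
    show ?thesis using assoc[OF w4] intertwines_comm[OF h x] lcancel[OF w0(2)] rcancel[OF w0(1)] by simp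
  qed
  ultimately show ?thesis by (simp add: intertwines_def)
qed

text \<open>Pulled back along \<open>f\<close>, the word becomes one to which the definition of
  intertwining applies; pushing forward again restores the part \<open>pre\<close>.\<close>

lemma insert_word:
  assumes h: "intertwines X X f \<eta> g" and f: "waut f"
    and w: "is_word X (pre @ map f c)" and c: "set c \<subseteq> X1"
  shows "is_word X (pre @ [\<eta>] @ map g c)"
proof -
  have s: "set pre \<subseteq> X1" using is_word_set[OF w] by simp
  let ?u = "map (finv f) pre"
  have "set (?u @ c) \<subseteq> X1" using s c finv[OF f] by auto
  moreover have fu: "map f ?u = pre" by (rule map_finv[OF f s])
  then have "is_word X (map f (?u @ c))" using w by (simp only: map_append)
  ultimately have "is_word X (?u @ c)" using waut_word[OF f] by blast
  from intertwines_word[OF h this] show ?thesis by (simp only: fu)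
qed

lemma slide1:
  assumes h: "intertwines X X f \<eta> g" and f: "waut f"
    and w: "is_word X (pre @ [x] @ map f c)" and c: "set c \<subseteq> X1"
  shows "is_word X (pre @ [x \<cdot> \<eta>] @ map g c)"
  using insert_word[OF h f, of "pre @ [x]" c] w c D_contract[of pre x \<eta>] by simp

lemma mult_iv_cancel:
  assumes h: "intertwines X X f \<eta> g" and f: "waut f" and x: "x \<in> X1"
  shows "is_word X [x, \<eta>]" "(x \<cdot> \<eta>) \<cdot> iv \<eta> = x" "x \<cdot> \<eta> \<in> X1"
  using intw_append'[OF h f, of "[x]"] x rcancel[of x \<eta>] mult_in[of x \<eta>] by (simp_all add: is_word_1)

text \<open>The way back multiplies by \<open>iv \<eta>\<close>, which intertwines in the opposite
  direction.\<close>

lemma slide: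
  assumes h: "intertwines X X f \<eta> g" and f: "waut f" and g: "waut g" and x: "x \<in> X1" and c: "set c \<subseteq> X1"
  shows "is_word X (pre @ [x] @ map f c) \<longleftrightarrow> is_word X (pre @ [x \<cdot> \<eta>] @ map g c)"
  using slide1[OF h f _ c, of pre x] slide1[OF intw_sym[OF h f g] g _ c, of pre "x \<cdot> \<eta>"] mult_iv_cancel[OF h f x]
  by auto

section \<open>Words of the semidirect product\<close>

definition sw :: "('a \<times> ('a \<Rightarrow> 'a)) list \<Rightarrow> bool" where
  "sw ws \<longleftrightarrow> (\<forall>p\<in>set ws. fst p \<in> X1 \<and> waut (snd p)) \<and> is_word X (tws ws)"

lemma waut_comps: "\<forall>p\<in>set ws. waut (snd p) \<Longrightarrow> waut (comps ws)"
  by (induction ws) (auto simp: waut_comp intro!: waut_id)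

lemma tws_in: "\<forall>p\<in>set ws. fst p \<in> X1 \<and> waut (snd p) \<Longrightarrow> set (tws ws) \<subseteq> X1"
  by (induction ws rule: tws.induct) (auto simp: waut_in)

text \<open>The factor appears in the long word only under the automorphism \<open>comps a\<close>;
  here it matters that automorphisms reflect words.\<close>

lemma sw_factor: "sw (a @ b @ c) \<Longrightarrow> sw b"
proof -
  assume s: "sw (a @ b @ c)"
  then have "is_word X (tws a @ map (comps a) (tws b) @ map (comps a \<circ> comps b) (tws c))"
    by (simp add: sw_def tws_append)
  then have "is_word X (map (comps a) (tws b))" by (rule D_factor)
  moreover have "waut (comps a)" "set (tws b) \<subseteq> X1" using s waut_comps[of a] tws_in[of b] by (auto simp: sw_def)
  ultimately have "is_word X (tws b)" using waut_word by blast
  then show ?thesis using s by (auto simp: sw_def)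
qed

lemma sw_contract: assumes s: "sw (a @ [(x, f), (z, f')] @ c)" shows "sw (a @ [(x \<cdot> f z, f \<circ> f')] @ c)"
    and "is_word X [x, f z]"
proof -
  let ?A = "comps a"
  have v: "x \<in> X1" "z \<in> X1" "waut f" "waut f'" "waut ?A" "f z \<in> X1" using s by (auto simp: sw_def waut_comps waut_in)
  have w: "is_word X (tws a @ [?A x, ?A (f z)] @ map (?A \<circ> f \<circ> f') (tws c))"
    using s by (simp add: sw_def tws_append comp_assoc)
  from D_factor[OF this] have "is_word X (map ?A [x, f z])" by simp
  then show xz: "is_word X [x, f z]" using v waut_word[of ?A "[x, f z]"] by simp
  from D_contract[OF w] show "sw (a @ [(x \<cdot> f z, f \<circ> f')] @ c)"
    using s v mult_in[OF xz] waut_mult[OF v(5) xz] by (auto simp: sw_def tws_append comp_assoc waut_comp)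
qed

lemma sw_slide:
  assumes h: "intertwines X X f \<eta> f'" and f: "waut f" "waut f'" and x: "x \<in> X1"
  shows "sw (a @ [(x, f)] @ c) \<longleftrightarrow> sw (a @ [(x \<cdot> \<eta>, f')] @ c)"
\<comment> \<open>If another letter is not admissible, both sides are false. Otherwise the slide
  takes place under the automorphism \<open>comps a\<close>, hence with the image of
  \<open>\<eta>\<close> under it.\<close>
proof (cases "\<forall>p\<in>set (a @ c). fst p \<in> X1 \<and> waut (snd p)")
  case True
  let ?A = "comps a"
  have v: "waut ?A" "set (tws c) \<subseteq> X1" using True waut_comps[of a] tws_in[of c] by auto
  note x\<eta> = mult_iv_cancel[OF h f(1) x]
  have "is_word X (tws a @ [?A x] @ map (?A \<circ> f) (tws c)) \<longleftrightarrow> is_word X (tws a @ [?A x \<cdot> ?A \<eta>] @ map (?A \<circ> f') (tws c))"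
    by (rule slide[OF intw_comp_left[OF h v(1)]]) (use v f x in \<open>auto simp: waut_comp waut_in\<close>)
  then show ?thesis using True f x x\<eta> waut_mult[OF v(1) x\<eta>(1)] by (auto simp: sw_def tws_append comp_assoc)
qed (auto simp: sw_def)

text \<open>\<open>f\<close> is assumed to be the identity on \<open>X1\<close> only, because
  simplicial maps are extensional and so \<open>t (one H) 1\<close> is \<open>undefined\<close>
  elsewhere.\<close>

lemma sw_unit:
  assumes s: "sw (a @ b)" and f: "\<And>x. x \<in> X1 \<Longrightarrow> f x = x"
  shows "sw (a @ [(one X, f)] @ b)"
proof -
  have v: "waut (comps a)" "set (tws b) \<subseteq> X1" using s waut_comps[of a] tws_in[of b] by (auto simp: sw_def)
  have "map f (tws b) = tws b" using v(2) f by (auto intro!: map_idI)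
  moreover have "is_word X (tws a @ [one X] @ map (comps a) (tws b))"
    using s D_unit by (simp add: sw_def tws_append)
  ultimately show ?thesis using s waut_one[OF v(1)] waut_id[of f] f one_in[OF pm]
    by (auto simp: sw_def tws_append simp flip: map_map)
qed

lemma tws_unit_prefix:
  assumes "\<And>x. x \<in> X1 \<Longrightarrow> f x = x" "set u \<subseteq> X1" "set (tws c) \<subseteq> X1"
  shows "tws (map (\<lambda>x. (x, f)) u @ c) = u @ tws c"
  using assms(2)
proof (induction u)
  case (Cons x u)
  then have "map f (u @ tws c) = u @ tws c" using assms by (intro map_idI) auto
  then show ?case using Cons by (simp del: map_append)
qed simp

definition sinvp :: "'a \<times> ('a \<Rightarrow> 'a) \<Rightarrow> 'a \<times> ('a \<Rightarrow> 'a)" where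
  "sinvp p = (finv (snd p) (iv (fst p)), finv (snd p))"

lemma tws_sinvp: "\<forall>p\<in>set ws. fst p \<in> X1 \<and> waut (snd p) \<Longrightarrow>
    tws (rev (map sinvp ws)) = map (comps (rev (map sinvp ws))) (rev (map iv (tws ws)))"
proof (induction ws rule: tws.induct)
  case (2 x f ws)
  let ?R = "rev (map sinvp ws)"
  have f: "waut f" and T: "set (tws ws) \<subseteq> X1" using 2 tws_in[of ws] by auto
  have "map (finv f) (rev (map iv (map f (tws ws)))) = rev (map iv (tws ws))"
    using T by (auto simp: rev_map waut_iv[OF waut_finv[OF f], symmetric] finv[OF f] waut_in[OF f] waut_iv[OF f, symmetric] iv_in)
  then have "map (comps ?R \<circ> finv f) (rev (map iv (map f (tws ws)))) = map (comps ?R) (rev (map iv (tws ws)))"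
    by (simp only: flip: map_map)
  moreover have "tws (rev (map sinvp ((x, f) # ws))) = map (comps ?R) (rev (map iv (tws ws))) @ [comps ?R (finv f (iv x))]"
    using 2 by (simp add: tws_append sinvp_def[of "(x, f)"])
  moreover have "comps (rev (map sinvp ((x, f) # ws))) = comps ?R \<circ> finv f"
    by (simp add: sinvp_def[of "(x, f)"])
  ultimately show ?case by (simp only: tws.simps list.map rev.simps map_append) simp
qed simp

text \<open>Up to one automorphism, the twisted spine of the inverse word followed by
  \<open>ws\<close> is the inverse of \<open>tws ws\<close> followed by \<open>tws ws\<close>, which
  is a word by \<open>D_inv\<close>.\<close>

lemma sw_inv: assumes "sw ws" shows "sw (rev (map sinvp ws) @ ws)"
proof -
  have v: "\<forall>p\<in>set ws. fst p \<in> X1 \<and> waut (snd p)" and w: "is_word X (tws ws)" using assms by (auto simp: sw_def)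
  have v': "\<forall>p\<in>set (rev (map sinvp ws)). fst p \<in> X1 \<and> waut (snd p)"
    using v by (auto simp: sinvp_def finv iv_in waut_finv)
  have "tws (rev (map sinvp ws) @ ws) = map (comps (rev (map sinvp ws))) (rev (map iv (tws ws)) @ tws ws)"
    by (simp only: tws_append tws_sinvp[OF v] map_append)
  then show ?thesis using v v' waut_word'[OF waut_comps D_inv[OF w], of "rev (map sinvp ws)"] by (auto simp: sw_def)
qed

text \<open>If the coordinates at the vertex \<open>k\<close> of a simplex of a bundle with fibre \<open>X\<close> are changed by \<open>a k\<close>,
  the edge \<open>y\<close> starting there becomes \<open>a k y \<cdot> \<nu> k\<close>. The proof slides \<open>\<nu> k0, \<nu> (k0 + 1), \<dots>\<close> through the
  word one after the other.\<close>

lemma gauge: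
  assumes "\<And>k. k0 \<le> k \<Longrightarrow> k \<le> k0 + length ys \<Longrightarrow> waut (a k)"
    and "\<And>k. k0 \<le> k \<Longrightarrow> k < k0 + length ys \<Longrightarrow> waut (f k) \<and> intertwines X X (a k) (\<nu> k) (f k \<circ> a (Suc k))"
    and "set ys \<subseteq> X1" "waut F"
  shows "is_word X (pre @ map (F \<circ> a k0) ys) \<longleftrightarrow>
    is_word X (pre @ map F (tws (map (\<lambda>(k, y). (a k y \<cdot> \<nu> k, f k)) (zip [k0..<k0 + length ys] ys))))"
  using assms
proof (induction ys arbitrary: k0 pre F)
  case (Cons y ys)
  have z: "zip [k0..<k0 + length (y # ys)] (y # ys) = (k0, y) # zip [Suc k0..<Suc k0 + length ys] ys"
    by (simp add: upt_conv_Cons del: upt_Suc)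
  have v: "waut (a k0)" "waut (a (Suc k0))" "waut (f k0)" "waut F" "y \<in> X1" "set ys \<subseteq> X1"
    using Cons.prems by auto
  then have ay: "a k0 y \<in> X1" using waut_in by blast
  have h: "intertwines X X (a k0) (\<nu> k0) (f k0 \<circ> a (Suc k0))" using Cons.prems(2)[of k0] by (simp add: comp_def)
  have w: "waut (f k0 \<circ> a (Suc k0))" by (rule waut_comp[OF v(3,2)])
  note x\<nu> = mult_iv_cancel[OF h v(1) ay]
  have "is_word X (pre @ map (F \<circ> a k0) (y # ys)) \<longleftrightarrow>
      is_word X (pre @ [(F \<circ> a k0) y] @ map (F \<circ> a k0) ys)" by simp
  also have "\<dots> \<longleftrightarrow> is_word X (pre @ [(F \<circ> a k0) y \<cdot> F (\<nu> k0)] @ map (F \<circ> (f k0 \<circ> a (Suc k0))) ys)"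
    by (rule slide[OF intw_comp_left[OF h v(4)]]) (use v w ay in \<open>auto simp: waut_comp waut_in\<close>)
  also have "\<dots> \<longleftrightarrow> is_word X ((pre @ [F (a k0 y \<cdot> \<nu> k0)]) @ map ((F \<circ> f k0) \<circ> a (Suc k0)) ys)"
    using waut_mult[OF v(4) x\<nu>(1)] by (simp add: comp_assoc)
  also have "\<dots> \<longleftrightarrow> is_word X ((pre @ [F (a k0 y \<cdot> \<nu> k0)]) @ map (F \<circ> f k0)
      (tws (map (\<lambda>(k, y). (a k y \<cdot> \<nu> k, f k)) (zip [Suc k0..<Suc k0 + length ys] ys))))"
    by (rule Cons.IH) (use Cons.prems v waut_comp[OF v(4,3)] in \<open>auto simp: comp_def\<close>)
  finally show ?case unfolding z by (simp add: comp_def del: upt_Suc)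
qed simp

text \<open>The automorphism \<open>a 0\<close> that remains in front is dropped because it reflects
  words.\<close>

lemma gauge_sw:
  assumes a: "\<And>k. k \<le> n \<Longrightarrow> waut (a k)"
    and f: "\<And>k. k < n \<Longrightarrow> waut (f k)" and h: "\<And>k. k < n \<Longrightarrow> intertwines X X (a k) (\<nu> k) (f k \<circ> a (Suc k))"
    and ys: "set ys \<subseteq> X1" "length ys = n"
  shows "is_word X ys \<longleftrightarrow> sw (map (\<lambda>k. (a k (ys ! k) \<cdot> \<nu> k, f k)) [0..<n])"
proof -
  have "map (\<lambda>(k, y). (a k y \<cdot> \<nu> k, f k)) (zip [0..<0 + length ys] ys) = map (\<lambda>k. (a k (ys ! k) \<cdot> \<nu> k, f k)) [0..<n]"
    using ys by (auto intro!: nth_equalityI)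
  with gauge[of 0 ys a f \<nu> id "[]"] a f h ys
  have "is_word X (map (a 0) ys) \<longleftrightarrow> is_word X (tws (map (\<lambda>k. (a k (ys ! k) \<cdot> \<nu> k, f k)) [0..<n]))"
    by (auto simp: waut_id)
  moreover have "a k (ys ! k) \<cdot> \<nu> k \<in> X1" if "k < n" for k
    using mult_iv_cancel(3)[OF h[OF that] a] that a waut_in[OF a, of k "ys ! k"] ys by (simp add: subset_eq)
  ultimately show ?thesis using waut_word[OF a ys(1), of 0] f by (auto simp: sw_def)
qed

text \<open>This gives surjectivity of a change of coordinates. Each letter is solved for
  separately, by multiplying \<open>x k\<close> with the inverse of \<open>\<nu> k\<close> and
  applying the inverse of \<open>a k\<close>; the product exists because the inverse of an
  intertwining element can follow every word.\<close>

lemma gauge_solve: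
  assumes a: "\<And>k. k \<le> n \<Longrightarrow> waut (a k)"
    and f: "\<And>k. k < n \<Longrightarrow> waut (f k)" and h: "\<And>k. k < n \<Longrightarrow> intertwines X X (a k) (\<nu> k) (f k \<circ> a (Suc k))"
    and x: "\<And>k. k < n \<Longrightarrow> x k \<in> X1"
  shows "\<exists>ys. set ys \<subseteq> X1 \<and> length ys = n \<and> (\<forall>k<n. a k (ys ! k) \<cdot> \<nu> k = x k)"
proof -
  define ys where "ys = map (\<lambda>k. finv (a k) (x k \<cdot> iv (\<nu> k))) [0..<n]"
  have k: "a k (ys ! k) \<cdot> \<nu> k = x k \<and> ys ! k \<in> X1" if k: "k < n" for k
  proof -
    have ak: "waut (a k)" "waut (a (Suc k))" using a k by auto
    have w: "waut (f k \<circ> a (Suc k))" by (rule waut_comp[OF f[OF k] ak(2)])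
    note c = mult_iv_cancel[OF intw_sym[OF h[OF k] ak(1) w] w x[OF k]]
    have "\<nu> k \<in> X1" using intertwines_word[OF h[OF k], of "[]" "[]"] D_Nil by (simp add: is_word_1)
    then have ii: "iv (iv (\<nu> k)) = \<nu> k" by (simp add: iv_iv is_word_1)
    show ?thesis using c(2)[unfolded ii] finv(1,2)[OF ak(1) c(3)] k by (simp add: ys_def)
  qed
  then have "set ys \<subseteq> X1" by (auto simp: ys_def in_set_conv_nth)
  then show ?thesis using k by (intro exI[of _ ys]) (simp add: ys_def)
qed

end

section \<open>The twisted product\<close>

locale twist = M: pgrp M + H: pgrp H for M :: "'a sset" and H :: "'b sset" +
  fixes t :: "'b \<Rightarrow> nat \<Rightarrow> 'a \<Rightarrow> 'a" and \<eta> :: "'b \<Rightarrow> 'a"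
  assumes tp: "twisting_pair M H t \<eta>"
begin

abbreviation "M1 \<equiv> simplices M 1"
abbreviation "H1 \<equiv> simplices H 1"
abbreviation "eta g h \<equiv> \<eta> (word H [g, h])"
abbreviation "tw \<equiv> tw_mult M H t \<eta>"

lemma t_aut: "g \<in> H1 \<Longrightarrow> M.waut (t g 1)"
  using tp by (intro M.Aut_waut) (auto simp: twisting_pair_def)

lemma t_one: "x \<in> M1 \<Longrightarrow> t (one H) 1 x = x"
  using tp by (simp add: twisting_pair_def sid_def)

lemma H_word: "is_word H [g, h] \<Longrightarrow> g \<in> H1 \<and> h \<in> H1 \<and> wprod H [g, h] \<in> H1"
  using H.is_word_in[of "[g, h]"] H.mult_in by auto

lemma eta_intertwines:
  assumes "is_word H [g, h]"
  shows "intertwines M M (t g 1 \<circ> t h 1) (eta g h) (t (wprod H [g, h]) 1)"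
proof -
  have "htpc M M (scomp M (t g) (t h)) (eta g h) (t (wprod H [g, h]))"
    using tp assms by (simp add: twisting_pair_def)
  from htpc_intertwines[OF M.pm M.pm this] show ?thesis
    by (rule M.intw_cong) (simp_all add: scomp_app)
qed

lemma eta_one: "g \<in> H1 \<Longrightarrow> eta g (one H) = one M \<and> eta (one H) g = one M"
  using tp by (simp add: twisting_pair_def)

lemma eta_cocycle: "is_word H [g, h, k] \<Longrightarrow>
   wprod M [t g 1 (eta h k), eta g (wprod H [h, k])] = wprod M [eta g h, eta (wprod H [g, h]) k]"
  using tp by (simp add: twisting_pair_def Let_def)

lemma eta_in: "is_word H [g, h] \<Longrightarrow> eta g h \<in> M1"
  using intertwines_word[OF eta_intertwines, of g h "[]" "[]"] M.D_Nil by (simp add: M.is_word_1)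

lemma append_eta: "\<lbrakk>is_word H [g, h]; is_word M xs\<rbrakk> \<Longrightarrow> is_word M (xs @ [eta g h])"
  by (rule M.intw_append'[OF eta_intertwines]) (auto intro!: M.waut_comp t_aut dest: H_word)

lemma append_t_eta:
  assumes "is_word H [g, h]" "M.waut F" "is_word M xs"
  shows "is_word M (xs @ [F (eta g h)])"
proof -
  note w = H_word[OF assms(1)] and t = t_aut
  have "intertwines M M (F \<circ> (t g 1 \<circ> t h 1)) (F (eta g h)) (F \<circ> t (wprod H [g, h]) 1)"
    by (rule M.intw_comp_left[OF eta_intertwines[OF assms(1)] assms(2)])
  from M.intw_append'[OF this _ assms(3)] show ?thesis using assms(2) w by (auto intro!: M.waut_comp t)
qed

lemma insert_eta:
  assumes "is_word H [g, h]" "is_word M (xs @ map (t g 1) (map (t h 1) c))" "set c \<subseteq> M1"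
  shows "is_word M (xs @ [eta g h] @ map (t (wprod H [g, h]) 1) c)"
  by (rule M.insert_word[OF eta_intertwines[OF assms(1)]]) (use assms H_word t_aut in \<open>auto intro!: M.waut_comp\<close>)

lemma eta_comm: "is_word H [g, h] \<Longrightarrow> x \<in> M1 \<Longrightarrow>
    wprod M [t g 1 (t h 1 x), eta g h] = wprod M [eta g h, t (wprod H [g, h]) 1 x]"
  using intertwines_comm[OF eta_intertwines] by simp

definition tword :: "('a \<times> 'b) list \<Rightarrow> bool" where
  "tword ws \<longleftrightarrow> set ws \<subseteq> M1 \<times> H1 \<and> is_word H (map snd ws) \<and> is_word M (twisted_spine t ws)"

definition sp :: "'a \<times> 'b \<Rightarrow> 'a \<times> ('a \<Rightarrow> 'a)" where
  "sp = (\<lambda>(x, g). (x, t g 1))"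

lemma twisted_spine_sp: "twisted_spine t ws = tws (map sp ws)"
  by (simp add: twisted_spine_tws sp_def)

lemma tword_sw: "tword ws \<longleftrightarrow> set ws \<subseteq> M1 \<times> H1 \<and> is_word H (map snd ws) \<and> M.sw (map sp ws)"
  by (auto simp: tword_def M.sw_def twisted_spine_sp sp_def t_aut)

lemma tword_single: "tword [(x, g)] \<longleftrightarrow> x \<in> M1 \<and> g \<in> H1"
  by (auto simp: tword_def twisted_spine_sp sp_def M.is_word_1 H.is_word_1)

lemma tw_pair:
  assumes "tword [(x, g), (z, h)]"
  shows "is_word M [x, t g 1 z, eta g h]" "is_word M [x, t g 1 z]" "is_word H [g, h]"
    "tw (x, g) (z, h) = (wprod M [wprod M [x, t g 1 z], eta g h], wprod H [g, h])"
    "tw (x, g) (z, h) = (wprod M [x, t g 1 z, eta g h], wprod H [g, h])"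
proof -
  show 1: "is_word M [x, t g 1 z]" and 2: "is_word H [g, h]"
    using assms by (auto simp: tword_def twisted_spine_sp sp_def)
  show 3: "is_word M [x, t g 1 z, eta g h]" using append_eta[OF 2 1] by simp
  show "tw (x, g) (z, h) = (wprod M [x, t g 1 z, eta g h], wprod H [g, h])"
    by (simp add: tw_mult_def)
  then show "tw (x, g) (z, h) = (wprod M [wprod M [x, t g 1 z], eta g h], wprod H [g, h])"
    using M.wprod_prd[OF 3] M.prd_triple[OF 3] M.assoc[OF 3] by simp
qed

text \<open>Closure under contraction rests on the intertwining property of \<open>eta\<close>,
  associativity on that property together with the cocycle condition, and the unit laws on the
  normalization.\<close>

lemma words_tword: "words tword tw (one M, one H)"
proof
  show "tword b" if "tword (a @ b @ c)" for a b c
    using that M.sw_factor[of "map sp a" "map sp b" "map sp c"] H.D_factor[of "map snd a" "map snd b" "map snd c"]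
    by (auto simp: tword_sw)
  show "tword (a @ [tw p q] @ b)" if w: "tword (a @ [p, q] @ b)" for a p q b
  proof -
    obtain x g z h where pq: "p = (x, g)" "q = (z, h)" by (cases p, cases q)
    have v: "x \<in> M1" "z \<in> M1" "g \<in> H1" "h \<in> H1" and
      hw: "is_word H (map snd a @ [g, h] @ map snd b)" and
      s: "M.sw (map sp a @ [(x, t g 1), (z, t h 1)] @ map sp b)" using w by (auto simp: pq tword_sw sp_def)
    have gh: "is_word H [g, h]" using H.D_factor[OF hw] .
    have xz: "is_word M [x, t g 1 z]" by (rule M.sw_contract(2)[OF s])
    have p: "tword [p, q]" using v gh xz by (simp add: pq tword_def twisted_spine_sp sp_def)
    \<comment> \<open>Contraction in the semidirect product leaves the automorphism
      \<open>t g 1 \<circ> t h 1\<close>; sliding \<open>eta g h\<close> into the letter replaces it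
      by \<open>t\<close> of the product.\<close>
    have s': "M.sw (map sp a @ [(wprod M [wprod M [x, t g 1 z], eta g h], t (wprod H [g, h]) 1)] @ map sp b)"
      using M.sw_contract(1)[OF s] M.sw_slide[OF eta_intertwines[OF gh], of "wprod M [x, t g 1 z]"]
        M.waut_comp[OF t_aut t_aut] t_aut H_word[OF gh] M.mult_in[OF xz] by simp
    then have "wprod M [wprod M [x, t g 1 z], eta g h] \<in> M1" by (auto simp: M.sw_def)
    moreover have "is_word H (map snd a @ [wprod H [g, h]] @ map snd b)" by (rule H.D_contract[OF hw])
    ultimately show ?thesis using s' w H_word[OF gh] by (auto simp: pq tword_sw tw_pair(4)[OF p[unfolded pq]] sp_def)
  qed
  show "tword (a @ [(one M, one H)] @ b)" if "tword (a @ b)" for a b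
    using that M.sw_unit[of "map sp a" "map sp b" "t (one H) 1"] H.D_unit[of "map snd a" "map snd b"] t_one
      one_in[OF M.pm] one_in[OF H.pm] by (simp add: tword_sw sp_def)
  show "tword []" by (simp add: tword_def twisted_spine_def M.D_Nil H.D_Nil)
  show "tw (tw p q) r = tw p (tw q r)" if w: "tword [p, q, r]" for p q r
  proof -
    obtain x g z h y k where pqr: "p = (x, g)" "q = (z, h)" "r = (y, k)" by (cases p, cases q, cases r)
    have v: "x \<in> M1" "z \<in> M1" "y \<in> M1" "g \<in> H1" "h \<in> H1" "k \<in> H1" and hw: "is_word H [g, h, k]"
      and mw: "is_word M [x, t g 1 z, t g 1 (t h 1 y)]"
      using w by (auto simp: pqr tword_def twisted_spine_sp sp_def)
    define gh hk where "gh = wprod H [g, h]" and "hk = wprod H [h, k]"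
    have W: "is_word H [g, h]" "is_word H [h, k]" "is_word H [gh, k]" "is_word H [g, hk]"
      using H.D_prefix[of "[g, h]" "[k]"] H.D_Cons[of g "[h, k]"] H.D_contract[of "[]" g h "[k]"] H.D_contract[of "[g]" h k "[]"] hw
      by (auto simp: gh_def hk_def)
    note G = t_aut[OF v(4)]
    define a b c p1 q1 r1 s1 where "a = t g 1 z" and "b = t g 1 (t h 1 y)" and "c = t gh 1 y" and "p1 = eta g h"
      and "q1 = eta gh k" and "r1 = t g 1 (eta h k)" and "s1 = eta g hk"
    note defs = a_def b_def c_def p1_def q1_def r1_def s1_def
    \<comment> \<open>The two bracketings are the products of the words in \<open>w3\<close> and
      \<open>w2\<close>. They are compared through \<open>w1\<close>: \<open>p1 c = b p1\<close>
      holds because \<open>eta g h\<close> intertwines, and \<open>r1 s1 = p1 q1\<close> is the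
      cocycle identity.\<close>
    have w1: "is_word M [x, a, b, p1, q1]"
      using append_eta[OF W(3), of "[x, a, b, p1]"] append_eta[OF W(1) mw] by (simp add: defs)
    have w2: "is_word M [x, a, b, r1, s1]"
      using append_eta[OF W(4), of "[x, a, b, r1]"] append_t_eta[OF W(2) G mw] by (simp add: defs)
    have w3: "is_word M [x, a, p1, c, q1]"
      using append_eta[OF W(3), of "[x, a, p1, c]"] insert_eta[OF W(1), of "[x, a]" "[y]"] mw v by (simp add: defs gh_def)
    have e1: "wprod M [p1, c] = wprod M [b, p1]" using eta_comm[OF W(1) v(3)] by (simp add: defs gh_def)
    have e2: "wprod M [r1, s1] = wprod M [p1, q1]" using eta_cocycle[OF hw] by (simp add: defs gh_def hk_def)
    have pq: "tword [p, q]" "tword [q, r]"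
    proof -
      have "is_word M [x, t g 1 z]" using M.D_prefix[of "[x, t g 1 z]"] mw by simp
      then show "tword [p, q]" using v W by (simp add: pqr tword_def twisted_spine_sp sp_def)
      have "is_word M (map (t g 1) [z, t h 1 y])" using M.D_Cons[OF mw] by simp
      then have "is_word M [z, t h 1 y]" using M.waut_word[OF G, of "[z, t h 1 y]"] v M.waut_in[OF t_aut[OF v(5)]] by simp
      then show "tword [q, r]" using v W by (simp add: pqr tword_def twisted_spine_sp sp_def)
    qed
    note pq' = pq[unfolded pqr]
    have 1: "is_word M [x, a, p1]" using M.D_prefix[of "[x, a, p1]"] w3 by simp
    have 2: "is_word M [z, t h 1 y, eta h k]" by (rule tw_pair(1)[OF pq'(2)])
    have 3: "is_word M [a, b, r1]" using M.D_factor[of "[x]" "[a, b, r1]" "[s1]"] w2 by simp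
    have tl: "tw p q = (M.prd [x, a, p1], gh)" "tw q r = (M.prd [z, t h 1 y, eta h k], hk)"
      using tw_pair(5)[OF pq'(1)] tw_pair(5)[OF pq'(2)] M.wprod_prd[OF 1] M.wprod_prd[OF 2]
      by (simp_all add: pqr defs gh_def hk_def)
    have 4: "is_word M [M.prd [x, a, p1], c, q1]" using M.D_prd[of "[]" "[x, a, p1]"] w3 by simp
    have 5: "is_word M [x, M.prd [a, b, r1], s1]" using M.D_prd[of "[x]" "[a, b, r1]" "[s1]"] w2 by simp
    have tg: "t g 1 (M.prd [z, t h 1 y, eta h k]) = M.prd [a, b, r1]"
      using M.waut_prd[OF G 2] by (simp add: defs)
    have "tw (tw p q) r = (M.prd [M.prd [x, a, p1], c, q1], wprod H [gh, k])"
      unfolding tl(1) pqr(3) using M.wprod_prd[OF 4] by (simp add: tw_mult_def defs del: foldl.simps)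
    also have "M.prd [M.prd [x, a, p1], c, q1] = M.prd ([] @ [x, a, p1] @ [c, q1])"
      using M.prd_nested[of "[]" "[x, a, p1]" "[c, q1]"] w3 by simp
    also have "\<dots> = M.prd ([x, a] @ [p1, c] @ [q1])" by simp
    also have "\<dots> = M.prd ([x, a] @ [b, p1] @ [q1])"
      by (rule M.prd_mid) (use w1 w3 e1 M.prd_pair M.D_factor[of "[x, a]" "[p1, c]" "[q1]"] M.D_factor[of "[x, a]" "[b, p1]" "[q1]"] in simp_all)
    also have "\<dots> = M.prd ([x, a, b] @ [p1, q1] @ [])" by simp
    also have "\<dots> = M.prd ([x, a, b] @ [r1, s1] @ [])"
      by (rule M.prd_mid) (use w1 w2 e2 M.prd_pair M.D_factor[of "[x, a, b]" "[p1, q1]" "[]"] M.D_factor[of "[x, a, b]" "[r1, s1]" "[]"] in simp_all)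
    also have "\<dots> = M.prd [x, M.prd [a, b, r1], s1]"
      using M.prd_nested[of "[x]" "[a, b, r1]" "[s1]"] w2 by simp
    also have "(\<dots>, wprod H [gh, k]) = tw p (tw q r)"
      unfolding tl(2) pqr(1) using M.wprod_prd[OF 5] H.assoc[OF hw] tg
      by (simp add: tw_mult_def defs gh_def hk_def del: foldl.simps)
    finally show ?thesis .
  qed
  show "tw p (one M, one H) = p" "tw (one M, one H) p = p" if w: "tword [p]" for p
  proof -
    obtain x g where p: "p = (x, g)" by (cases p)
    then have v: "x \<in> M1" "g \<in> H1" using w by (auto simp: tword_single)
    have "is_word M [x]" using v by (simp add: M.is_word_1)
    then have w': "is_word M [x, one M, one M]" "is_word M [one M, x, one M]"
      using M.D_unit[of "[x]" "[]"] M.D_unit[of "[x]" "[one M]"] M.D_unit[of "[]" "[x, one M]"] by auto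
    have "wprod M [x, one M, one M] = x" "wprod M [one M, x, one M] = x"
      using M.wprod_prd[OF w'(1)] M.wprod_prd[OF w'(2)] v M.m_e M.e_m one_in[OF M.pm] by (simp_all add: M.is_word_1)
    then show "tw p (one M, one H) = p" "tw (one M, one H) p = p"
      using v eta_one[OF v(2)] t_one[OF v(1)] M.waut_one[OF t_aut[OF v(2)]] H.m_e[of g] H.e_m[of g]
      by (simp_all add: p tw_mult_def H.is_word_1)
  qed
qed

section \<open>Inverses in the twisted product\<close>

definition ivp :: "'a \<times> 'b \<Rightarrow> 'a \<times> 'b" where
  "ivp = (\<lambda>(x, g). (wprod M [M.iv (eta (H.iv g) g), t (H.iv g) 1 (M.iv x)], H.iv g))"

lemma iv_word: "g \<in> H1 \<Longrightarrow> is_word H [H.iv g, g]"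
  using H.D_inv[of "[g]"] by (simp add: H.is_word_1)

text \<open>Since \<open>t (one H)\<close> is the identity, \<open>eta (H.iv g) g\<close> relates
  the composite of \<open>t (H.iv g) 1\<close> and \<open>t g 1\<close> to the identity.
  Precomposition with the inverse of \<open>t g 1\<close> relates \<open>t (H.iv g) 1\<close> to
  that inverse. This is the origin of the correcting factor in the formula for inverses.\<close>

lemma inv_intertwines:
  assumes g: "g \<in> H1"
  shows "intertwines M M (t (H.iv g) 1) (eta (H.iv g) g) (M.finv (t g 1))"
    and "intertwines M M (M.finv (t g 1)) (M.iv (eta (H.iv g) g)) (t (H.iv g) 1)"
proof -
  have a: "M.waut (t g 1)" "M.waut (t (H.iv g) 1)" using t_aut g H.iv_in by auto
  have "wprod H [H.iv g, g] = one H" using H.iv_m g by (simp add: H.is_word_1)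
  then have "intertwines M M (t (H.iv g) 1 \<circ> t g 1 \<circ> M.finv (t g 1)) (eta (H.iv g) g) (t (one H) 1 \<circ> M.finv (t g 1))"
    using M.intw_comp_right[OF eta_intertwines[OF iv_word[OF g]] M.waut_finv[OF a(1)]] by simp
  then show 1: "intertwines M M (t (H.iv g) 1) (eta (H.iv g) g) (M.finv (t g 1))"
    by (rule M.intw_cong) (use M.finv[OF a(1)] t_one in simp_all)
  from M.intw_sym[OF 1 a(2) M.waut_finv[OF a(1)]]
  show "intertwines M M (M.finv (t g 1)) (M.iv (eta (H.iv g) g)) (t (H.iv g) 1)" .
qed

lemma ivp_word:
  assumes x: "x \<in> M1" and g: "g \<in> H1"
  shows "is_word M [M.iv (eta (H.iv g) g), t (H.iv g) 1 (M.iv x)]"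
    and "wprod M [M.iv (eta (H.iv g) g), t (H.iv g) 1 (M.iv x)] = wprod M [M.finv (t g 1) (M.iv x), M.iv (eta (H.iv g) g)]"
  using intertwines_word[OF inv_intertwines(2)[OF g], of "[]" "[M.iv x]"] M.iv_in[OF x]
    intertwines_comm[OF inv_intertwines(2)[OF g], of "M.iv x"]
  by (simp_all add: M.is_word_1)

text \<open>Each letter of the inverse in the semidirect product is turned into the letter over
  \<open>H.iv g\<close> by one slide; \<open>pre\<close> collects the letters already
  turned.\<close>

lemma sw_ivp:
  "set ws \<subseteq> M1 \<times> H1 \<Longrightarrow> M.sw (pre @ map (M.sinvp \<circ> sp) ws @ c) \<Longrightarrow> M.sw (pre @ map (sp \<circ> ivp) ws @ c)"
proof (induction ws arbitrary: pre)
  case (Cons p ws)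
  obtain x g where p: "p = (x, g)" by (cases p)
  then have v: "x \<in> M1" "g \<in> H1" using Cons.prems by auto
  note a = t_aut[OF v(2)] t_aut[OF H.iv_in[OF v(2)]]
  have i: "M.finv (t g 1) (M.iv x) \<in> M1" using M.finv(1)[OF a(1) M.iv_in[OF v(1)]] .
  have e: "(M.sinvp \<circ> sp) p = (M.finv (t g 1) (M.iv x), M.finv (t g 1))"
    by (simp add: p sp_def M.sinvp_def)
  have "M.sw (pre @ [(M.finv (t g 1) (M.iv x), M.finv (t g 1))] @ map (M.sinvp \<circ> sp) ws @ c)"
    using Cons.prems(2) e by (simp only: list.map append.simps append_assoc)
  then have "M.sw ((pre @ [sp (ivp p)]) @ map (M.sinvp \<circ> sp) ws @ c)"
    unfolding M.sw_slide[OF inv_intertwines(2)[OF v(2)] M.waut_finv[OF a(1)] a(2) i]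
    by (simp add: p sp_def ivp_def ivp_word(2)[OF v])
  from Cons.IH[OF _ this] Cons.prems(1) show ?case by simp
qed simp

lemma gwords_tword: "gwords tword tw (one M, one H) ivp"
proof -
  interpret words tword tw "(one M, one H)" by (rule words_tword)
  show ?thesis
  proof
    show "tword (rev (map ivp ws) @ ws)" if w: "tword ws" for ws
    proof -
      have s: "set ws \<subseteq> M1 \<times> H1" and hw: "is_word H (map snd ws)" and sw: "M.sw (map sp ws)"
        using w by (auto simp: tword_sw)
      have "ivp p \<in> M1 \<times> H1" if "p \<in> M1 \<times> H1" for p
        using that ivp_word(1) M.mult_in H.iv_in by (auto simp: ivp_def)
      then have "ivp ` set ws \<subseteq> M1 \<times> H1" using s by blast
      moreover have "map snd (rev (map ivp ws) @ ws) = rev (map H.iv (map snd ws)) @ map snd ws"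
        by (simp add: rev_map ivp_def case_prod_beta)
      moreover have "M.sw ([] @ map (M.sinvp \<circ> sp) (rev ws) @ map sp ws)"
        using M.sw_inv[OF sw] by (simp add: rev_map)
      from sw_ivp[OF _ this] s have "M.sw (map sp (rev (map ivp ws) @ ws))" by (simp add: rev_map)
      ultimately show ?thesis using s H.D_inv[OF hw] by (auto simp: tword_sw)
    qed
    show "tw (ivp p) p = (one M, one H)" if w: "tword [p]" for p
    proof -
      obtain x g where p: "p = (x, g)" by (cases p)
      then have v: "x \<in> M1" "g \<in> H1" using w by (auto simp: tword_single)
      note a = t_aut[OF v(2)] t_aut[OF H.iv_in[OF v(2)]]
      define e where "e = eta (H.iv g) g"
      define x' where "x' = t (H.iv g) 1 x"
      have x': "x' \<in> M1" "t (H.iv g) 1 (M.iv x) = M.iv x'"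
        using M.waut_in[OF a(2) v(1)] M.waut_iv[OF a(2) v(1)] by (simp_all add: x'_def)
      \<comment> \<open>The first component of the product is that of the inverse of
        \<open>e\<close>, the inverse of \<open>x'\<close>, \<open>x'\<close> and \<open>e\<close>.
        These form a word because \<open>e\<close> may be appended to any word and its inverse put
        in front of any word.\<close>
      have "is_word M [M.iv x', x']" using M.D_inv[of "[x']"] x' by (simp add: M.is_word_1)
      then have "is_word M [M.iv e, M.iv x', x']" using M.intw_prepend[OF inv_intertwines(2)[OF v(2)] a(2)] by (simp add: e_def)
      from append_eta[OF iv_word[OF v(2)] this] have W: "is_word M [M.iv e, M.iv x', x', e]" by (simp add: e_def)
      have e: "is_word M [e]" using M.D_suffix[of "[M.iv e, M.iv x', x']" "[e]"] W by simp
      have e': "is_word M [M.iv e, e]" using M.D_inv[OF e] by simp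
      have W2: "is_word M [M.iv e, M.iv x']" using M.D_prefix[of "[M.iv e, M.iv x']"] W by simp
      have W3: "is_word M [wprod M [M.iv e, M.iv x'], x', e]" using M.D_contract[of "[]" "M.iv e" "M.iv x'" "[x', e]"] W by simp
      have "wprod M [wprod M [M.iv e, M.iv x'], x', e] = M.prd ([] @ [wprod M [M.iv e, M.iv x']] @ [x', e])"
        using M.wprod_prd[OF W3] by simp
      also have "\<dots> = M.prd ([M.iv e] @ [M.iv x', x'] @ [e])"
        using M.prd_contract[of "[]" "M.iv e" "M.iv x'" "[x', e]"] W by simp
      also have "\<dots> = M.prd ([M.iv e] @ [] @ [e])"
        by (rule M.prd_mid) (use W e' M.D_factor[of "[M.iv e]" "[M.iv x', x']" "[e]"] M.prd_pair M.iv_m x' in \<open>simp_all add: M.is_word_1\<close>)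
      also have "\<dots> = one M" using M.prd_pair[OF e'] M.iv_m[OF e] by simp
      finally have "wprod M [wprod M [M.iv e, M.iv x'], x', e] = one M" .
      then show ?thesis using H.iv_m[of g] v by (simp add: p ivp_def tw_mult_def x'(2) H.is_word_1 flip: e_def x'_def)
    qed
  qed
qed

sublocale T: gwords tword tw "(one M, one H)" ivp
  by (rule gwords_tword)

lemma twisted_product_eq: "twisted_product M H t \<eta> = T.word_sset"
  by (simp add: twisted_product_def T.word_sset_def T.wact_def tword_def fun_eq_iff)

end

section \<open>Local trivializations\<close>

text \<open>The inverse of a trivialization of the pullback, followed by the projection to
  \<open>E\<close>. A trivialization keeps the coordinate in the standard simplex, so bijectivity is
  demanded over one \<open>\<theta>\<close> at a time.\<close>

definition local_triv ::
  "'f sset \<Rightarrow> 'e sset \<Rightarrow> 'b sset \<Rightarrow> (nat \<Rightarrow> 'e \<Rightarrow> 'b) \<Rightarrow> nat \<Rightarrow> 'b \<Rightarrow> (nat \<Rightarrow> 'f \<times> (nat \<Rightarrow> nat) \<Rightarrow> 'e) \<Rightarrow> bool" where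
  "local_triv F E B f n b \<phi> \<longleftrightarrow> smap (sprod F (std_simplex n)) E \<phi> \<and>
     (\<forall>m. \<forall>\<theta>\<in>ops m n. bij_betw (\<lambda>y. \<phi> m (y, \<theta>)) (simplices F m) {e \<in> simplices E m. f m e = act B m n \<theta> b})"

lemma local_trivI:
  assumes "smap (sprod F (std_simplex n)) E \<phi>"
    and "\<And>m \<theta>. \<theta> \<in> ops m n \<Longrightarrow> bij_betw (\<lambda>y. \<phi> m (y, \<theta>)) (simplices F m) {e \<in> simplices E m. f m e = act B m n \<theta> b}"
  shows "local_triv F E B f n b \<phi>"
  using assms by (simp add: local_triv_def)

lemma local_trivD:
  assumes "local_triv F E B f n b \<phi>"
  shows "smap (sprod F (std_simplex n)) E \<phi>"
    and "\<theta> \<in> ops m n \<Longrightarrow> bij_betw (\<lambda>y. \<phi> m (y, \<theta>)) (simplices F m) {e \<in> simplices E m. f m e = act B m n \<theta> b}"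
  using assms by (simp_all add: local_triv_def)

lemma act_pullback: "act (pullback E B f n b) = act (sprod E (std_simplex n))"
  by (simp add: pullback_def)

lemma simplices_pullback: "p \<in> simplices (pullback E B f n b) m \<longleftrightarrow>
    fst p \<in> simplices E m \<and> snd p \<in> ops m n \<and> f m (fst p) = act B m n (snd p) b"
  by (simp add: pullback_def case_prod_beta)

lemma local_triv_siso:
  assumes F: "sset F" and lt: "local_triv F E B f n b \<phi>"
  shows "\<exists>\<psi>. siso (pullback E B f n b) (sprod F (std_simplex n)) \<psi> \<and>
        (\<forall>m. \<forall>p\<in>simplices (pullback E B f n b) m. snd (\<psi> m p) = snd p)"
proof -
  let ?S = "sprod F (std_simplex n)" and ?P = "pullback E B f n b"
  define \<chi> where "\<chi> = (\<lambda>m. \<lambda>q\<in>simplices ?S m. (\<phi> m q, snd q))"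
  have \<phi>: "smap ?S E \<phi>" and bij: "\<And>m \<theta>. \<theta> \<in> ops m n \<Longrightarrow>
      bij_betw (\<lambda>y. \<phi> m (y, \<theta>)) (simplices F m) {e \<in> simplices E m. f m e = act B m n \<theta> b}"
    using lt by (auto simp: local_triv_def)
  have S: "sset ?S" by (intro sset_sprod F sset_std_simplex)
  have in_P: "(\<phi> m (y, \<theta>), \<theta>) \<in> simplices ?P m" if "y \<in> simplices F m" "\<theta> \<in> ops m n" for m y \<theta>
    using bij_betwE[OF bij[OF that(2)]] that by (simp add: simplices_pullback)
  have \<chi>: "smap ?S ?P \<chi>"
  proof (rule smapI)
    show "\<chi> m (act ?S m k \<theta> u) = act ?P m k \<theta> (\<chi> k u)" if "\<theta> \<in> ops m k" "u \<in> simplices ?S k" for m k \<theta> u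
    proof -
      obtain y \<alpha> where u: "u = (y, \<alpha>)" by (cases u)
      show ?thesis using that act_in[OF S that] smap_act[OF \<phi> that]
        by (simp add: \<chi>_def act_pullback u)
    qed
  qed (use in_P in \<open>auto simp: \<chi>_def\<close>)
  have bij\<chi>: "bij_betw (\<chi> m) (simplices ?S m) (simplices ?P m)" for m
  proof (rule bij_betwI')
    show "\<chi> m p = \<chi> m q \<longleftrightarrow> p = q" if "p \<in> simplices ?S m" "q \<in> simplices ?S m" for p q
      using that bij[of "snd p" m] by (cases p, cases q) (auto simp: \<chi>_def bij_betw_def inj_on_def)
    show "\<chi> m p \<in> simplices ?P m" if "p \<in> simplices ?S m" for p
      by (rule smap_in[OF \<chi> that])
    show "\<exists>q\<in>simplices ?S m. p = \<chi> m q" if p: "p \<in> simplices ?P m" for p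
    proof -
      have "fst p \<in> (\<lambda>y. \<phi> m (y, snd p)) ` simplices F m"
        using p bij[of "snd p" m] by (simp add: simplices_pullback bij_betw_def)
      then obtain y where "y \<in> simplices F m" "fst p = \<phi> m (y, snd p)" by blast
      then show ?thesis using p
        by (intro bexI[of _ "(y, snd p)"]) (auto simp: \<chi>_def simplices_pullback prod_eq_iff)
    qed
  qed
  note \<psi> = smap_sinv[OF S \<chi> bij\<chi>]
  have "siso ?P ?S (sinv ?S ?P \<chi>)"
    unfolding siso_def
  proof (intro conjI exI[of _ \<chi>])
    show "scomp ?P \<chi> (sinv ?S ?P \<chi>) = sid ?P" "scomp ?S (sinv ?S ?P \<chi>) \<chi> = sid ?S"
      by (intro ext; simp add: scomp_def sid_def compose_def restrict_def \<psi> del: simplices_sprod)+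
  qed (use \<psi> \<chi> in auto)
  moreover have "snd (sinv ?S ?P \<chi> m p) = snd p" if "p \<in> simplices ?P m" for m p
    using \<psi>(3)[OF that] smap_in[OF \<psi>(1) that] by (auto simp: \<chi>_def split: if_splits)
  ultimately show ?thesis by blast
qed

text \<open>Surjectivity follows from local triviality: any simplex of the fibre, paired with the
  identity operator, is sent to a simplex over \<open>b\<close>.\<close>

lemma fibre_bundleI:
  assumes "sset F" "sset E" "sset B" "smap E B f" "\<And>n. simplices F n \<noteq> {}"
    and lt: "\<And>n b. b \<in> simplices B n \<Longrightarrow> \<exists>\<phi>. local_triv F E B f n b \<phi>"
  shows "fibre_bundle F E B f"
proof -
  have "b \<in> f n ` simplices E n" if b: "b \<in> simplices B n" for n b
  proof -
    obtain \<phi> where "local_triv F E B f n b \<phi>" using lt[OF b] by blast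
    moreover have i: "(\<lambda>i\<in>{..n}. i) \<in> ops n n" by (rule opsI) auto
    ultimately have "bij_betw (\<lambda>y. \<phi> n (y, \<lambda>i\<in>{..n}. i)) (simplices F n) {e \<in> simplices E n. f n e = act B n n (\<lambda>i\<in>{..n}. i) b}"
      unfolding local_triv_def by blast
    moreover obtain y where "y \<in> simplices F n" using assms(5)[of n] by blast
    ultimately have "\<phi> n (y, \<lambda>i\<in>{..n}. i) \<in> {e \<in> simplices E n. f n e = act B n n (\<lambda>i\<in>{..n}. i) b}"
      using bij_betwE by blast
    then show ?thesis using act_id[OF assms(3) b] by auto
  qed
  moreover have "f n ` simplices E n \<subseteq> simplices B n" for n using smap_in[OF assms(4)] by blast
  ultimately have "f n ` simplices E n = simplices B n" for n by blast
  moreover have "\<exists>\<psi>. siso (pullback E B f n b) (sprod F (std_simplex n)) \<psi> \<and>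
        (\<forall>m. \<forall>p\<in>simplices (pullback E B f n b) m. snd (\<psi> m p) = snd p)" if "b \<in> simplices B n" for n b
    using lt[OF that] by (elim exE) (rule local_triv_siso[OF assms(1)])
  ultimately show ?thesis using assms(1-4) unfolding fibre_bundle_def by (intro conjI allI ballI)
qed

lemma fibre_bundleD:
  assumes fb: "fibre_bundle F E B f" and b: "b \<in> simplices B n"
  shows "\<exists>\<phi>. local_triv F E B f n b \<phi>"
proof -
  let ?S = "sprod F (std_simplex n)" and ?P = "pullback E B f n b"
  obtain \<psi> where \<psi>0: "siso ?P ?S \<psi> \<and> (\<forall>m. \<forall>p\<in>simplices ?P m. snd (\<psi> m p) = snd p)"
    using fb[unfolded fibre_bundle_def, THEN conjunct2, THEN conjunct2, THEN conjunct2, THEN conjunct2, THEN conjunct2, rule_format, OF b]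
    by (rule exE)
  note \<psi> = \<psi>0[THEN conjunct1] \<psi>0[THEN conjunct2, rule_format]
  from \<psi>(1) obtain \<chi> where \<chi>: "smap ?P ?S \<psi>" "smap ?S ?P \<chi>" "scomp ?P \<chi> \<psi> = sid ?P" "scomp ?S \<psi> \<chi> = sid ?S"
    unfolding siso_def by (elim conjE exE)
  have 1: "\<chi> m (\<psi> m p) = p" if "p \<in> simplices ?P m" for m p
    using fun_cong[OF fun_cong[OF \<chi>(3)], of m p] scomp_app[OF that, of \<chi> \<psi>] that by (simp only: sid_def restrict_apply')
  have 2: "\<psi> m (\<chi> m q) = q" if "q \<in> simplices ?S m" for m q
    using fun_cong[OF fun_cong[OF \<chi>(4)], of m q] scomp_app[OF that, of \<psi> \<chi>] that by (simp only: sid_def restrict_apply')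
  define \<phi> where "\<phi> = (\<lambda>m. \<lambda>q\<in>simplices ?S m. fst (\<chi> m q))"
  have S: "sset ?S" by (intro sset_sprod sset_std_simplex fb[unfolded fibre_bundle_def, THEN conjunct1])
  have \<chi>\<phi>: "\<chi> m (y, \<theta>) = (\<phi> m (y, \<theta>), \<theta>)" if "y \<in> simplices F m" "\<theta> \<in> ops m n" for m y \<theta>
  proof -
    have q: "(y, \<theta>) \<in> simplices ?S m" using that by simp
    have "snd (\<chi> m (y, \<theta>)) = \<theta>" using \<psi>(2)[OF smap_in[OF \<chi>(2) q]] 2[OF q] by simp
    then show ?thesis using that by (cases "\<chi> m (y, \<theta>)") (simp add: \<phi>_def)
  qed
  have smap: "smap ?S E \<phi>"
  proof (rule smapI)
    show "\<phi> m u \<in> simplices E m" if "u \<in> simplices ?S m" for m u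
      using smap_in[OF \<chi>(2) that] that by (simp add: \<phi>_def simplices_pullback)
    show "\<phi> m (act ?S m k \<theta> u) = act E m k \<theta> (\<phi> k u)" if "\<theta> \<in> ops m k" "u \<in> simplices ?S k" for m k \<theta> u
    proof -
      have "fst (act ?P m k \<theta> p) = act E m k \<theta> (fst p)" for p by (cases p) (simp add: act_pullback)
      then show ?thesis using that(2) act_in[OF S that] smap_act[OF \<chi>(2) that] unfolding \<phi>_def restrict_def by (simp only: if_True)
    qed
  qed (simp add: \<phi>_def)
  have bij: "bij_betw (\<lambda>y. \<phi> m (y, \<theta>)) (simplices F m) {e \<in> simplices E m. f m e = act B m n \<theta> b}"
    if \<theta>: "\<theta> \<in> ops m n" for m \<theta>
  proof (rule bij_betwI')
    show "\<phi> m (y, \<theta>) = \<phi> m (z, \<theta>) \<longleftrightarrow> y = z" if "y \<in> simplices F m" "z \<in> simplices F m" for y z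
    proof
      assume "\<phi> m (y, \<theta>) = \<phi> m (z, \<theta>)"
      then have yz: "\<chi> m (y, \<theta>) = \<chi> m (z, \<theta>)" by (simp only: \<chi>\<phi>[OF that(1) \<theta>] \<chi>\<phi>[OF that(2) \<theta>])
      have "(y, \<theta>) = \<psi> m (\<chi> m (y, \<theta>))" using 2[of "(y, \<theta>)" m] that(1) \<theta> by simp
      also have "\<dots> = (z, \<theta>)" unfolding yz using 2[of "(z, \<theta>)" m] that(2) \<theta> by simp
      finally show "y = z" by simp
    qed simp
    show "\<phi> m (y, \<theta>) \<in> {e \<in> simplices E m. f m e = act B m n \<theta> b}" if "y \<in> simplices F m" for y
      using smap_in[OF \<chi>(2), of "(y, \<theta>)" m] that \<theta> \<chi>\<phi>[OF that \<theta>] by (simp add: simplices_pullback)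
    show "\<exists>y\<in>simplices F m. e = \<phi> m (y, \<theta>)" if "e \<in> {e \<in> simplices E m. f m e = act B m n \<theta> b}" for e
    proof -
      have p: "(e, \<theta>) \<in> simplices ?P m" using that \<theta> by (simp add: simplices_pullback)
      define y where "y = fst (\<psi> m (e, \<theta>))"
      have y: "\<psi> m (e, \<theta>) = (y, \<theta>)" using \<psi>(2)[OF p] by (simp add: y_def prod_eq_iff)
      have "y \<in> simplices F m" using smap_in[OF \<chi>(1) p] y by simp
      moreover have "e = \<phi> m (y, \<theta>)" using 1[OF p] y \<chi>\<phi>[OF calculation \<theta>] by simp
      ultimately show ?thesis by blast
    qed
  qed
  have "local_triv F E B f n b \<phi>" by (rule local_trivI[OF smap bij])
  then show ?thesis by (rule exI[of _ \<phi>])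
qed

lemma spine_degen: "partial_monoid X \<Longrightarrow> spine X n (degen X n (vertex X)) = replicate n (one X)"
proof (rule nth_equalityI)
  assume X: "partial_monoid X"
  note v = vertex_in[OF X] and S = pm_sset[OF X]
  fix i assume "i < length (spine X n (degen X n (vertex X)))"
  then have i: "i < n" by simp
  have o: "(\<lambda>i\<in>{..n}. 0) \<in> ops n 0" by (rule opsI) auto
  have "edge X n i (Suc i) (degen X n (vertex X)) = edge X 0 0 0 (vertex X)"
    unfolding degen_def using edge_act[OF S o _ _ v, of i "Suc i"] i by simp
  then show "spine X n (degen X n (vertex X)) ! i = replicate n (one X) ! i"
    using i edge_deg[OF X _ v] by simp
qed simp

context twist
begin

abbreviation "TT \<equiv> T.word_sset"
abbreviation "\<tau> \<equiv> tw_proj M H t \<eta>"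

lemma tau_eq: "\<tau> = (\<lambda>n. \<lambda>ws\<in>simplices TT n. word H (map snd ws))"
  by (simp add: tw_proj_def twisted_product_eq)

lemma smap_tau: "smap TT H \<tau>"
  unfolding tau_eq
  by (rule T.smap_from_word_sset[OF H.pm]) (auto simp: tword_def tw_mult_def)

lemma spine_tau: "ws \<in> simplices TT n \<Longrightarrow> spine H n (\<tau> n ws) = map snd ws"
  using word_simplex[OF H.pm, of "map snd ws" n] by (simp add: tau_eq tword_def T.simplices_word_sset)

lemma tau_eq_iff:
  assumes "ws \<in> simplices TT n" "b \<in> simplices H n"
  shows "\<tau> n ws = b \<longleftrightarrow> map snd ws = spine H n b"
proof
  show "\<tau> n ws = b" if "map snd ws = spine H n b"
    by (rule pm_spine_eqD[OF H.pm smap_in[OF smap_tau assms(1)] assms(2)]) (simp add: spine_tau[OF assms(1)] that)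
qed (use spine_tau[OF assms(1)] in simp)

section \<open>Trivialization of the twisted product over a simplex\<close>

context
  fixes n :: nat and b :: 'b
  assumes b: "b \<in> simplices H n"
begin

abbreviation "ed i j \<equiv> edge H n i j b"

text \<open>\<open>t\<close> of an edge carries fibre coordinates at its end to its start. The
  trivial coordinates refer to the vertex 0 and are brought to the vertex \<open>i\<close> by the
  inverse.\<close>

definition "gauge_aut i = M.finv (t (ed 0 i) 1)"

definition "gauge_elt i j = M.iv (gauge_aut i (eta (ed 0 i) (ed i j)))"

lemma ed_word: "i \<le> j \<Longrightarrow> j \<le> k \<Longrightarrow> k \<le> n \<Longrightarrow> is_word H [ed i j, ed j k] \<and> wprod H [ed i j, ed j k] = ed i k"
  by (simp add: edge_mult[OF H.pm b])

lemma ed_in: "i \<le> j \<Longrightarrow> j \<le> n \<Longrightarrow> ed i j \<in> H1"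
  by (rule edge_in[OF H.ss _ _ b])

lemma gauge_aut: "i \<le> n \<Longrightarrow> M.waut (gauge_aut i)"
  unfolding gauge_aut_def by (rule M.waut_finv[OF t_aut[OF ed_in]]) auto

text \<open>The relation for the edges from 0 to \<open>i\<close> and from \<open>i\<close> to
  \<open>j\<close> is composed with \<open>gauge_aut i\<close> on the left and
  \<open>gauge_aut j\<close> on the right, so that both \<open>t\<close> at edges from 0 cancel. The
  resulting relation has the two sides in the wrong order, which explains the inverse in
  \<open>gauge_elt\<close>.\<close>

lemma gauge_intertwines:
  assumes ij: "i \<le> j" "j \<le> n"
  shows "intertwines M M (gauge_aut i) (gauge_elt i j) (t (ed i j) 1 \<circ> gauge_aut j)"
proof -
  have g: "M.waut (t (ed 0 i) 1)" "M.waut (t (ed 0 j) 1)" "M.waut (t (ed i j) 1)" using t_aut ed_in ij by auto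
  note a = gauge_aut[of i] gauge_aut[of j]
  have w: "is_word H [ed 0 i, ed i j]" "wprod H [ed 0 i, ed i j] = ed 0 j" using ed_word[of 0 i j] ij by auto
  have "intertwines M M (gauge_aut i \<circ> (t (ed 0 i) 1 \<circ> t (ed i j) 1)) (gauge_aut i (eta (ed 0 i) (ed i j))) (gauge_aut i \<circ> t (ed 0 j) 1)"
    by (rule M.intw_comp_left[OF eta_intertwines[OF w(1), unfolded w(2)]]) (use a ij in simp)
  from M.intw_comp_right[OF this a(2)] ij
  have "intertwines M M (gauge_aut i \<circ> (t (ed 0 i) 1 \<circ> t (ed i j) 1) \<circ> gauge_aut j) (gauge_aut i (eta (ed 0 i) (ed i j))) (gauge_aut i \<circ> t (ed 0 j) 1 \<circ> gauge_aut j)"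
    by simp
  then have "intertwines M M (t (ed i j) 1 \<circ> gauge_aut j) (gauge_aut i (eta (ed 0 i) (ed i j))) (gauge_aut i)"
  proof (rule M.intw_cong)
    fix x assume x: "x \<in> M1"
    have y: "t (ed i j) 1 (gauge_aut j x) \<in> M1" using M.waut_in[OF g(3) M.waut_in[OF a(2) x]] ij by simp
    show "(gauge_aut i \<circ> (t (ed 0 i) 1 \<circ> t (ed i j) 1) \<circ> gauge_aut j) x = (t (ed i j) 1 \<circ> gauge_aut j) x"
      using M.finv(3)[OF g(1) y] by (simp add: gauge_aut_def[of i])
    show "(gauge_aut i \<circ> t (ed 0 j) 1 \<circ> gauge_aut j) x = gauge_aut i x"
      using M.finv(2)[OF g(2) x] by (simp add: gauge_aut_def[of j])
  qed
  then show ?thesis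
    unfolding gauge_elt_def by (rule M.intw_sym) (use a g ij in \<open>auto intro: M.waut_comp\<close>)
qed

definition tpair :: "'a \<times> (nat \<Rightarrow> nat) \<Rightarrow> 'a \<times> 'b" where
  "tpair = (\<lambda>(x, \<theta>). (wprod M [gauge_aut (\<theta> 0) x, gauge_elt (\<theta> 0) (\<theta> 1)], ed (\<theta> 0) (\<theta> 1)))"

text \<open>This determines the edge \<open>tpair (x, earr i j)\<close>: it is the quotient of
  \<open>(x, ed 0 j)\<close> by the lift \<open>(one M, ed 0 i)\<close> of the edge from 0 to
  \<open>i\<close>.\<close>

lemma base_tpair:
  assumes x: "x \<in> M1" and ij: "i \<le> j" "j \<le> n"
  shows "tw (one M, ed 0 i) (tpair (x, earr i j)) = (x, ed 0 j)" and "tpair (x, earr i j) \<in> M1 \<times> H1"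
proof -
  note h = gauge_intertwines[OF ij]
  have i: "i \<le> n" using ij by simp
  note g = t_aut[OF ed_in[OF le0 i]] and gi = gauge_aut[OF i]
  have w: "is_word H [ed 0 i, ed i j]" "wprod H [ed 0 i, ed i j] = ed 0 j" using ed_word[of 0 i j] ij by auto
  note e = eta_in[OF w(1)]
  note ax = M.waut_in[OF gi x]
  note c = M.mult_iv_cancel[OF h gi ax]
  show "tpair (x, earr i j) \<in> M1 \<times> H1" using c(3) ed_in[OF ij] by (simp add: tpair_def)
  have ta: "t (ed 0 i) 1 (gauge_aut i y) = y" if "y \<in> M1" for y
    using M.finv(2)[OF g that] by (simp add: gauge_aut_def)
  have "t (ed 0 i) 1 (gauge_elt i j) = M.iv (eta (ed 0 i) (ed i j))"
    using M.waut_iv[OF g M.waut_in[OF gi e]] ta[OF e] by (simp add: gauge_elt_def)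
  note te = this
  have 1: "t (ed 0 i) 1 (wprod M [gauge_aut i x, gauge_elt i j]) = wprod M [x, M.iv (eta (ed 0 i) (ed i j))]"
    and 2: "is_word M [x, M.iv (eta (ed 0 i) (ed i j))]"
    using M.waut_mult[OF g c(1)] M.waut_word'[OF g c(1)] by (simp_all only: list.map te ta[OF x])
  have 3: "wprod M [wprod M [x, M.iv (eta (ed 0 i) (ed i j))], eta (ed 0 i) (ed i j)] = x"
    using M.rcancel[OF 2] M.iv_iv[of "eta (ed 0 i) (ed i j)"] e by (simp add: M.is_word_1)
  have 4: "is_word M [wprod M [x, M.iv (eta (ed 0 i) (ed i j))], eta (ed 0 i) (ed i j)]"
    using append_eta[OF w(1), of "[wprod M [x, M.iv (eta (ed 0 i) (ed i j))]]"] M.mult_in[OF 2]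
    by (simp only: M.is_word_1 append.simps)
  have 5: "is_word M [one M, wprod M [x, M.iv (eta (ed 0 i) (ed i j))], eta (ed 0 i) (ed i j)]"
    using M.D_unit[of "[]" "[_, _]"] 4 by (simp only: append.simps)
  have "wprod M [one M, wprod M [x, M.iv (eta (ed 0 i) (ed i j))], eta (ed 0 i) (ed i j)] = x"
    unfolding M.wprod_prd[OF 5] M.prd_triple[OF 5] 3 using x by (intro M.e_m) (simp add: M.is_word_1)
  then show "tw (one M, ed 0 i) (tpair (x, earr i j)) = (x, ed 0 j)"
    unfolding tw_mult_def tpair_def by (simp only: prod.case earr_app 1 w(2))
qed

lemma tword_tpair:
  assumes \<theta>: "\<theta> \<in> ops m n" and ys: "set ys \<subseteq> M1" "length ys = m"
  shows "is_word M ys \<longleftrightarrow> tword (map (\<lambda>k. tpair (ys ! k, earr (\<theta> k) (\<theta> (Suc k)))) [0..<m])"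
proof -
  let ?ws = "map (\<lambda>k. tpair (ys ! k, earr (\<theta> k) (\<theta> (Suc k)))) [0..<m]"
  have le: "\<theta> k \<le> \<theta> (Suc k)" "\<theta> (Suc k) \<le> n" if "k < m" for k
    using that ops_mono[OF \<theta>, of k "Suc k"] ops_le[OF \<theta>, of "Suc k"] by auto
  have s: "map snd ?ws = spine H m (act H m n \<theta> b)"
    using spine_act[OF H.ss \<theta> b] by (simp add: tpair_def)
  have "is_word M ys \<longleftrightarrow> M.sw (map (\<lambda>k. (wprod M [gauge_aut (\<theta> k) (ys ! k), gauge_elt (\<theta> k) (\<theta> (Suc k))], t (ed (\<theta> k) (\<theta> (Suc k))) 1)) [0..<m])"
  proof (rule M.gauge_sw[of m "\<lambda>k. gauge_aut (\<theta> k)"])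
    show "M.waut (gauge_aut (\<theta> k))" if "k \<le> m" for k using gauge_aut ops_le[OF \<theta> that] .
    show "M.waut (t (ed (\<theta> k) (\<theta> (Suc k))) 1)" if "k < m" for k using t_aut[OF ed_in[OF le[OF that]]] .
    show "intertwines M M (gauge_aut (\<theta> k)) (gauge_elt (\<theta> k) (\<theta> (Suc k))) (t (ed (\<theta> k) (\<theta> (Suc k))) 1 \<circ> gauge_aut (\<theta> (Suc k)))"
      if "k < m" for k using gauge_intertwines[OF le[OF that]] .
  qed (use ys in auto)
  also have "map (\<lambda>k. (wprod M [gauge_aut (\<theta> k) (ys ! k), gauge_elt (\<theta> k) (\<theta> (Suc k))], t (ed (\<theta> k) (\<theta> (Suc k))) 1)) [0..<m] = map sp ?ws"
    by (simp add: sp_def tpair_def)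
  finally have 1: "is_word M ys \<longleftrightarrow> M.sw (map sp ?ws)" .
  have "is_word H (map snd ?ws)" unfolding s by (rule is_word_spine[OF act_in[OF H.ss \<theta> b]])
  moreover have "set ?ws \<subseteq> M1 \<times> H1"
  proof -
    have "tpair (ys ! k, earr (\<theta> k) (\<theta> (Suc k))) \<in> M1 \<times> H1" if "k < m" for k
      using base_tpair(2)[OF _ le[OF that]] ys that by (simp add: subset_eq)
    then have "(\<lambda>k. tpair (ys ! k, earr (\<theta> k) (\<theta> (Suc k)))) ` {0..<m} \<subseteq> M1 \<times> H1" by (intro image_subsetI) simp
    then show ?thesis by simp
  qed
  ultimately show ?thesis using 1 by (simp only: tword_sw) simp
qed

text \<open>After multiplication by \<open>(one M, ed 0 i)\<close> on the left both sides are
  \<open>(wprod M [x, z], ed 0 k)\<close>, and left factors cancel.\<close>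

lemma tpair_mult:
  assumes xz: "is_word M [x, z]" and ijk: "i \<le> j" "j \<le> k" "k \<le> n"
  shows "tpair (wprod M [x, z], earr i k) = tw (tpair (x, earr i j)) (tpair (z, earr j k))"
proof -
  let ?P = "(one M, ed 0 i)" and ?Q = "tpair (x, earr i j)" and ?R = "tpair (z, earr j k)" and ?S = "tpair (wprod M [x, z], earr i k)"
  have x: "x \<in> M1" "z \<in> M1" using M.is_word_in[OF xz] by auto
  let ?\<theta> = "\<lambda>l\<in>{..2::nat}. if l = 0 then i else if l = 1 then j else k"
  have "?\<theta> \<in> ops 2 n" using ijk by (intro opsI) auto
  from tword_tpair[OF this, of "[x, z]"] have QR: "tword [?Q, ?R]"
    using xz x by (simp add: numeral_2_eq_2 One_nat_def)
  have S: "?S \<in> M1 \<times> H1" using base_tpair(2)[OF M.mult_in[OF xz]] ijk by simp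
  \<comment> \<open>The first component of \<open>?P\<close> is a unit and \<open>t\<close> moves
    the rest by an automorphism, so only the word in \<open>H\<close> restricts what may
    follow.\<close>
  have prep: "tword (?P # ws)" if "tword ws" "is_word H (ed 0 i # map snd ws)" for ws
  proof -
    have "is_word M ([one M] @ map (t (ed 0 i) 1) (twisted_spine t ws))"
      using that M.D_unit[of "[]"] M.waut_word'[OF t_aut[OF ed_in]] ijk by (simp add: tword_def)
    then show ?thesis using that ed_in[of 0 i] ijk one_in[OF M.pm] by (auto simp: tword_def twisted_spine_sp sp_def)
  qed
  have sQ: "snd ?Q = ed i j" "snd ?R = ed j k" "snd ?S = ed i k" by (simp_all add: tpair_def)
  \<comment> \<open>The word in \<open>H\<close> is the spine of the simplex on the vertices 0,
    \<open>i\<close>, \<open>j\<close>, \<open>k\<close> of \<open>b\<close>.\<close>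
  let ?\<theta>' = "\<lambda>l\<in>{..3::nat}. if l = 0 then 0 else if l = 1 then i else if l = 2 then j else k"
  have "?\<theta>' \<in> ops 3 n" using ijk by (intro opsI) auto
  from is_word_spine[OF act_in[OF H.ss this b]] spine_act[OF H.ss this b]
  have "is_word H [ed 0 i, ed i j, ed j k]" by (simp add: numeral_3_eq_3 numeral_2_eq_2 One_nat_def)
  then have PQR: "tword [?P, ?Q, ?R]" using prep[OF QR] sQ by simp
  have PS: "tword [?P, ?S]" using prep[of "[?S]"] S sQ ed_word[of 0 i k] ijk by (cases ?S) (auto simp: tword_single)
  have PS': "tword [?P, tw ?Q ?R]" using T.D_contract[of "[?P]" ?Q ?R "[]"] PQR by simp
  have "tw ?P (tw ?Q ?R) = tw (tw ?P ?Q) ?R" using T.assoc[OF PQR] by simp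
  also have "\<dots> = tw (x, ed 0 j) ?R" using base_tpair(1)[OF x(1)] ijk by simp
  also have "\<dots> = (wprod M [x, z], ed 0 k)"
  proof -
    obtain z' where z': "?R = (z', ed j k)" using sQ(2) by (cases ?R) auto
    have "tw (one M, ed 0 j) ?R = (z, ed 0 k)" using base_tpair(1)[OF x(2)] ijk by simp
    then have 1: "wprod M [one M, t (ed 0 j) 1 z', eta (ed 0 j) (ed j k)] = z" by (simp add: z' tw_mult_def)
    have "tword ([tw ?P ?Q] @ [?R])" using T.D_contract[of "[]" ?P ?Q "[?R]"] PQR by simp
    then have "tword [(x, ed 0 j), (z', ed j k)]" using base_tpair(1)[OF x(1)] ijk z' by simp
    note tw = tw_pair[OF this]
    have 2: "is_word M [t (ed 0 j) 1 z', eta (ed 0 j) (ed j k)]" using M.D_Cons[OF tw(1)] by simp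
    have 3: "is_word M [one M, t (ed 0 j) 1 z', eta (ed 0 j) (ed j k)]" using M.D_unit[of "[]"] 2 by simp
    have "wprod M [t (ed 0 j) 1 z', eta (ed 0 j) (ed j k)] = z"
      using 1[unfolded M.wprod_prd[OF 3] M.prd_triple[OF 3]] M.e_m[of "wprod M [t (ed 0 j) 1 z', eta (ed 0 j) (ed j k)]"]
        M.mult_in[OF 2] by (simp only: M.is_word_1)
    then have "wprod M [x, t (ed 0 j) 1 z', eta (ed 0 j) (ed j k)] = wprod M [x, z]"
      by (simp only: M.wprod_prd[OF tw(1)] M.prd_triple[OF tw(1)])
    then show ?thesis using tw(5) ed_word[of 0 j k] ijk by (simp add: z')
  qed
  also have "\<dots> = tw ?P ?S" using base_tpair(1)[OF M.mult_in[OF xz], of i k] ijk by simp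
  finally show ?thesis using T.lcancel[OF PS] T.lcancel[OF PS'] by simp
qed

lemma local_triv_twisted: "\<exists>\<phi>. local_triv M TT H \<tau> n b \<phi>"
proof -
  let ?S = "sprod M (std_simplex n)"
  let ?\<phi> = "\<lambda>m. \<lambda>u\<in>simplices ?S m. map tpair (spine ?S m u)"
  have sp: "map tpair (spine ?S m (y, \<theta>)) = map (\<lambda>k. tpair (spine M m y ! k, earr (\<theta> k) (\<theta> (Suc k)))) [0..<m]" for m y \<theta>
    by (auto intro!: nth_equalityI)
  have smap: "smap ?S TT ?\<phi>"
  proof (rule T.smap_to_word_sset)
    show "sset ?S" by (intro sset_sprod M.ss sset_std_simplex)
    show "tword (map tpair (spine ?S m u))" if u: "u \<in> simplices ?S m" for m u
    proof -
      obtain y \<theta> where "u = (y, \<theta>)" "y \<in> simplices M m" "\<theta> \<in> ops m n" using u by auto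
      then show ?thesis using tword_tpair[of \<theta> m "spine M m y"] is_word_spine[of y M m] spine_subset[OF M.ss] sp by simp
    qed
    show "tpair (edge ?S 2 0 2 u) = tw (tpair (edge ?S 2 0 1 u)) (tpair (edge ?S 2 1 2 u))" if u: "u \<in> simplices ?S 2" for u
    proof -
      obtain y \<theta> where u: "u = (y, \<theta>)" "y \<in> simplices M 2" "\<theta> \<in> ops 2 n" using u by auto
      then show ?thesis using edge_mult[OF M.pm u(2), of 0 1 2] tpair_mult[of "edge M 2 0 1 y" "edge M 2 1 2 y" "\<theta> 0" "\<theta> 1" "\<theta> 2"]
          ops_mono[OF u(3), of 0 1] ops_mono[OF u(3), of 1 2] ops_le[OF u(3), of 2] by simp
    qed
    show "tpair (edge ?S 0 0 0 v) = (one M, one H)" if v: "v \<in> simplices ?S 0" for v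
    proof -
      obtain y \<theta> where v: "v = (y, \<theta>)" "y \<in> simplices M 0" "\<theta> \<in> ops 0 n" using v by auto
      have i: "\<theta> 0 \<le> n" by (rule ops_le[OF v(3)]) simp
      have e: "ed (\<theta> 0) (\<theta> 0) = one H" by (rule edge_deg[OF H.pm i b])
      \<comment> \<open>On a degenerate edge the gauge element is trivial because \<open>eta\<close>
        is normalized in its second argument.\<close>
      have "gauge_elt (\<theta> 0) (\<theta> 0) = one M"
        using eta_one[OF ed_in, of 0 "\<theta> 0"] M.waut_one[OF gauge_aut] M.iv_e i by (simp add: gauge_elt_def e)
      then show ?thesis using M.waut_one[OF gauge_aut[OF i]] M.m_e[OF M.D_one] edge_deg[OF M.pm _ v(2)]
        by (simp add: v(1) tpair_def e)
    qed
  qed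
  have bij: "bij_betw (\<lambda>y. ?\<phi> m (y, \<theta>)) (simplices M m) {ws \<in> simplices TT m. \<tau> m ws = act H m n \<theta> b}"
    if \<theta>: "\<theta> \<in> ops m n" for m \<theta>
  proof -
    have le: "\<theta> k \<le> \<theta> (Suc k)" "\<theta> (Suc k) \<le> n" "\<theta> k \<le> n" if "k < m" for k
      using that ops_mono[OF \<theta>, of k "Suc k"] ops_le[OF \<theta>, of "Suc k"] ops_le[OF \<theta>, of k] by auto
    have \<theta>b: "act H m n \<theta> b \<in> simplices H m" by (rule act_in[OF H.ss \<theta> b])
    have sb: "spine H m (act H m n \<theta> b) = map (\<lambda>k. ed (\<theta> k) (\<theta> (Suc k))) [0..<m]" by (rule spine_act[OF H.ss \<theta> b])
    let ?f = "\<lambda>ys. map (\<lambda>k. tpair (ys ! k, earr (\<theta> k) (\<theta> (Suc k)))) [0..<m]"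
    have \<phi>: "?\<phi> m (y, \<theta>) = ?f (spine M m y)" if "y \<in> simplices M m" for y using that \<theta> sp by simp
    have snd_f: "map snd (?f ys) = spine H m (act H m n \<theta> b)" for ys by (simp add: sb tpair_def)
    show ?thesis
    proof (rule bij_betwI')
      fix y z assume y: "y \<in> simplices M m" and z: "z \<in> simplices M m"
      show "?\<phi> m (y, \<theta>) = ?\<phi> m (z, \<theta>) \<longleftrightarrow> y = z"
      proof
        assume "?\<phi> m (y, \<theta>) = ?\<phi> m (z, \<theta>)"
        then have eq: "?f (spine M m y) = ?f (spine M m z)" by (simp only: \<phi>[OF y] \<phi>[OF z])
        have "spine M m y = spine M m z"
        proof (rule nth_equalityI)
          fix k assume "k < length (spine M m y)"
          then have k: "k < m" by simp
          have v: "spine M m y ! k \<in> M1" "spine M m z ! k \<in> M1"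
            using spine_subset[OF M.ss y] spine_subset[OF M.ss z] k nth_mem[of k "spine M m y"] nth_mem[of k "spine M m z"] by auto
          note a = gauge_aut[OF le(3)[OF k]] and h = gauge_intertwines[OF le(1,2)[OF k]]
          have "fst (?f (spine M m y) ! k) = fst (?f (spine M m z) ! k)" using eq by (rule arg_cong)
          with k
          have "wprod M [gauge_aut (\<theta> k) (spine M m y ! k), gauge_elt (\<theta> k) (\<theta> (Suc k))] =
              wprod M [gauge_aut (\<theta> k) (spine M m z ! k), gauge_elt (\<theta> k) (\<theta> (Suc k))]"
            by (simp add: tpair_def)
          \<comment> \<open>Multiplying by the inverse of the gauge element recovers the letter up
            to an automorphism, so the trivialization is injective.\<close>
          from arg_cong[OF this, of "\<lambda>p. wprod M [p, M.iv (gauge_elt (\<theta> k) (\<theta> (Suc k)))]"]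
          have "gauge_aut (\<theta> k) (spine M m y ! k) = gauge_aut (\<theta> k) (spine M m z ! k)"
            by (simp only: M.mult_iv_cancel(2)[OF h a M.waut_in[OF a v(1)]] M.mult_iv_cancel(2)[OF h a M.waut_in[OF a v(2)]])
          then show "spine M m y ! k = spine M m z ! k" using M.waut_inj[OF a v] by simp
        qed simp
        then show "y = z" by (rule pm_spine_eqD[OF M.pm y z])
      qed simp
    next
      fix y assume y: "y \<in> simplices M m"
      have "tword (?f (spine M m y))"
        using tword_tpair[OF \<theta>, of "spine M m y"] is_word_spine[OF y] spine_subset[OF M.ss y] by simp
      then have "?f (spine M m y) \<in> simplices TT m" by (simp add: T.simplices_word_sset)
      then show "?\<phi> m (y, \<theta>) \<in> {ws \<in> simplices TT m. \<tau> m ws = act H m n \<theta> b}"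
        unfolding \<phi>[OF y] using tau_eq_iff[OF _ \<theta>b] snd_f by blast
    next
      fix ws assume ws: "ws \<in> {ws \<in> simplices TT m. \<tau> m ws = act H m n \<theta> b}"
      then have w: "tword ws" "length ws = m" "map snd ws = spine H m (act H m n \<theta> b)"
        using tau_eq_iff[OF _ \<theta>b] by (auto simp: T.simplices_word_sset)
      have wk: "fst (ws ! k) \<in> M1" "snd (ws ! k) = ed (\<theta> k) (\<theta> (Suc k))" if "k < m" for k
      proof -
        have "ws ! k \<in> set ws" using that w by simp
        then show "fst (ws ! k) \<in> M1" using w(1) by (auto simp: tword_def)
        show "snd (ws ! k) = ed (\<theta> k) (\<theta> (Suc k))"
          using arg_cong[OF w(3), of "\<lambda>l. l ! k"] that w(2) by (simp add: sb)
      qed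
      obtain ys where ys: "set ys \<subseteq> M1" "length ys = m"
        and k: "\<And>k. k < m \<Longrightarrow> wprod M [gauge_aut (\<theta> k) (ys ! k), gauge_elt (\<theta> k) (\<theta> (Suc k))] = fst (ws ! k)"
        using M.gauge_solve[where n = m and a = "\<lambda>k. gauge_aut (\<theta> k)" and x = "\<lambda>k. fst (ws ! k)", OF gauge_aut[OF ops_le[OF \<theta>]]
              t_aut[OF ed_in[OF le(1,2)]] gauge_intertwines[OF le(1,2)] wk(1)] by blast
      have fy: "?f ys = ws" using k wk(2) w(2) by (auto intro!: nth_equalityI simp: tpair_def prod_eq_iff)
      have "is_word M ys" using tword_tpair[OF \<theta> ys] w(1) fy by simp
      from word_simplex[OF M.pm this ys(2)] have y: "word M ys \<in> simplices M m" "spine M m (word M ys) = ys" by auto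
      have "ws = ?\<phi> m (word M ys, \<theta>)" unfolding \<phi>[OF y(1)] y(2) fy ..
      with y(1) show "\<exists>y\<in>simplices M m. ws = ?\<phi> m (y, \<theta>)" by (rule bexI[rotated])
    qed
  qed
  have "local_triv M TT H \<tau> n b ?\<phi>" by (rule local_trivI[OF smap bij])
  then show ?thesis by (rule exI[of _ ?\<phi>])
qed

end

section \<open>The fibre inclusion and the formulas for the twisted product\<close>

lemma tws_incl: "set xs \<subseteq> M1 \<Longrightarrow> tws (map sp (map (\<lambda>x. (x, one H)) xs)) = xs"
proof (induction xs)
  case (Cons x xs)
  then have "tws (map sp (map (\<lambda>x. (x, one H)) xs)) = xs" by simp
  moreover have "map (t (one H) 1) xs = xs" using Cons.prems by (intro map_idI t_one) auto
  ultimately show ?case by (simp add: sp_def)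
qed simp

lemma is_word_ones: "is_word H (replicate n (one H))"
  using is_word_spine[OF degen_in[OF H.ss vertex_in[OF H.pm]], of n] spine_degen[OF H.pm] by simp

lemma tword_incl: "tword (map (\<lambda>x. (x, one H)) xs) \<longleftrightarrow> is_word M xs"
proof -
  have "is_word H (map snd (map (\<lambda>x. (x, one H)) xs))" using is_word_ones[of "length xs"] by (simp add: comp_def map_replicate_const)
  moreover have "set (map (\<lambda>x. (x, one H)) xs) \<subseteq> M1 \<times> H1 \<longleftrightarrow> set xs \<subseteq> M1" using one_in[OF H.pm] by auto
  ultimately show ?thesis unfolding tword_def twisted_spine_sp using tws_incl[of xs] M.is_word_set by metis
qed

lemma tw_incl_mult: assumes xz: "is_word M [x, z]" shows "tw (x, one H) (z, one H) = (wprod M [x, z], one H)"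
proof -
  have "tword [(x, one H), (z, one H)]" using tword_incl[of "[x, z]"] xz by simp
  note tw = tw_pair(4)[OF this]
  have z: "z \<in> M1" using M.is_word_in[OF xz] by simp
  have "wprod M [wprod M [x, z], one M] = wprod M [x, z]" using M.m_e M.mult_in[OF xz] by (simp add: M.is_word_1)
  then show ?thesis using tw t_one[OF z] eta_one[OF one_in[OF H.pm]] H.m_e[OF H.D_one] by simp
qed

lemma smap_tw_incl: "smap M TT (tw_incl M H)"
  unfolding tw_incl_def
proof (rule T.smap_to_word_sset[OF M.ss])
  show "tword (map (\<lambda>x. (x, one H)) (spine M n u))" if "u \<in> simplices M n" for n u
    using tword_incl is_word_spine[OF that] by simp
  show "(edge M 2 0 2 u, one H) = tw (edge M 2 0 1 u, one H) (edge M 2 1 2 u, one H)" if u: "u \<in> simplices M 2" for u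
  proof -
    have "is_word M [edge M 2 0 1 u, edge M 2 1 2 u]" "wprod M [edge M 2 0 1 u, edge M 2 1 2 u] = edge M 2 0 2 u"
      using edge_mult[OF M.pm u, of 0 1 2] by simp_all
    then show ?thesis using tw_incl_mult by simp
  qed
  show "(edge M 0 0 0 v, one H) = (one M, one H)" if "v \<in> simplices M 0" for v
    using edge_deg[OF M.pm _ that] by simp
qed

lemma fibre_TT: "ws \<in> simplices (fibre TT H \<tau> (vertex H)) n \<longleftrightarrow> ws \<in> simplices TT n \<and> map snd ws = replicate n (one H)"
  using tau_eq_iff[OF _ degen_in[OF H.ss vertex_in[OF H.pm]], of ws n] spine_degen[OF H.pm, of n]
  by (auto simp: fibre_def)

lemma siso_tw_incl: "siso M (fibre TT H \<tau> (vertex H)) (tw_incl M H)"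
proof (rule sisoI[OF M.ss])
  have incl: "tw_incl M H n u = map (\<lambda>x. (x, one H)) (spine M n u)" if "u \<in> simplices M n" for n u
    using that by (simp add: tw_incl_def)
  have in_f: "tw_incl M H n u \<in> simplices (fibre TT H \<tau> (vertex H)) n" if "u \<in> simplices M n" for n u
    using smap_in[OF smap_tw_incl that] that by (simp add: fibre_TT incl comp_def map_replicate_const)
  show "smap M (fibre TT H \<tau> (vertex H)) (tw_incl M H)"
  proof (rule smapI)
    show "tw_incl M H m (act M m n \<theta> u) = act (fibre TT H \<tau> (vertex H)) m n \<theta> (tw_incl M H n u)"
      if "\<theta> \<in> ops m n" "u \<in> simplices M n" for m n \<theta> u
      using smap_act[OF smap_tw_incl that] by (simp add: fibre_def)
  qed (simp_all add: in_f, simp add: tw_incl_def)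
  show "bij_betw (tw_incl M H n) (simplices M n) (simplices (fibre TT H \<tau> (vertex H)) n)" for n
  proof (rule bij_betwI')
    fix y z assume y: "y \<in> simplices M n" and z: "z \<in> simplices M n"
    show "tw_incl M H n y = tw_incl M H n z \<longleftrightarrow> y = z"
    proof
      assume "tw_incl M H n y = tw_incl M H n z"
      then have "map fst (tw_incl M H n y) = map fst (tw_incl M H n z)" by simp
      then have "spine M n y = spine M n z" by (simp add: incl y z comp_def)
      then show "y = z" by (rule pm_spine_eqD[OF M.pm y z])
    qed simp
  next
    fix ws assume ws: "ws \<in> simplices (fibre TT H \<tau> (vertex H)) n"
    then have w: "tword ws" "length ws = n" "map snd ws = replicate n (one H)"
      by (auto simp: fibre_TT T.simplices_word_sset)
    have e: "map (\<lambda>x. (x, one H)) (map fst ws) = ws"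
    proof (rule nth_equalityI)
      fix i assume "i < length (map (\<lambda>x. (x, one H)) (map fst ws))"
      then have i: "i < n" using w(2) by simp
      then have "snd (ws ! i) = one H" using arg_cong[OF w(3), of "\<lambda>l. l ! i"] w(2) by simp
      then show "map (\<lambda>x. (x, one H)) (map fst ws) ! i = ws ! i" using i w(2) by (simp add: prod_eq_iff)
    qed simp
    then have "is_word M (map fst ws)" using tword_incl[of "map fst ws"] w(1) by (simp only:)
    from word_simplex[OF M.pm this, of n] w(2)
    have u: "word M (map fst ws) \<in> simplices M n" "spine M n (word M (map fst ws)) = map fst ws" by auto
    have "ws = tw_incl M H n (word M (map fst ws))" by (simp only: incl[OF u(1)] u(2) e)
    with u(1) show "\<exists>u\<in>simplices M n. ws = tw_incl M H n u" by (rule bexI[rotated])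
  qed (rule in_f)
qed

lemma extension_twisted: "extension M TT H (tw_incl M H) \<tau>"
proof -
  have "fibre_bundle M TT H \<tau>"
  proof (rule fibre_bundleI[OF M.ss T.sset_word_sset H.ss smap_tau])
    show "simplices M n \<noteq> {}" for n using degen_in[OF M.ss vertex_in[OF M.pm]] by blast
  qed (rule local_triv_twisted)
  then show ?thesis using siso_tw_incl by (simp add: extension_def)
qed

lemma is_word_TT: "is_word TT (map (\<lambda>y. [y]) ws) \<longleftrightarrow> tword ws"
proof -
  have "map (\<lambda>y. [y]) ws = map (\<lambda>y. [y]) vs \<longleftrightarrow> ws = vs" for vs :: "('a \<times> 'b) list"
    by (auto dest!: map_injective simp: inj_def)
  then show ?thesis unfolding T.is_word_word_sset by auto
qed

lemma pair_TT:
  assumes "is_word TT [[(x, g)], [(z, h)]]"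
  shows "is_word M [x, t g 1 z, eta g h]"
    and "wprod TT [[(x, g)], [(z, h)]] = [(wprod M [x, t g 1 z, eta g h], wprod H [g, h])]"
proof -
  have w: "tword [(x, g), (z, h)]" using is_word_TT[of "[(x, g), (z, h)]"] assms by simp
  show "is_word M [x, t g 1 z, eta g h]" by (rule tw_pair(1)[OF w])
  show "wprod TT [[(x, g)], [(z, h)]] = [(wprod M [x, t g 1 z, eta g h], wprod H [g, h])]"
    using T.wprod_word_sset[OF w] unfolding T.prd_pair[OF w] tw_pair(5)[OF w] by simp
qed

lemma simplices_TT_1: "simplices TT 1 = (\<lambda>y. [y]) ` (M1 \<times> H1)"
proof (intro equalityI subsetI)
  fix ws assume "ws \<in> simplices TT 1"
  then obtain y where "ws = [y]" "tword [y]" by (auto simp: T.simplices_word_sset length_Suc_conv One_nat_def)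
  then show "ws \<in> (\<lambda>y. [y]) ` (M1 \<times> H1)" by (cases y) (auto simp: tword_single)
qed (auto simp: T.simplices_word_sset tword_single)

lemma tau_word:
  assumes "is_word TT (map (\<lambda>y. [y]) ws)"
  shows "\<tau> (length ws) (word TT (map (\<lambda>y. [y]) ws)) = word H (map snd ws)"
proof -
  have w: "tword ws" using assms is_word_TT by blast
  show ?thesis unfolding T.word_word_sset[OF w] tau_eq using w by (simp add: T.simplices_word_sset)
qed

lemma inv1_TT:
  assumes "x \<in> M1" "g \<in> H1"
  shows "is_word H [inv1 H g, g]"
    and "is_word M [inv1 M (eta (inv1 H g) g), t (inv1 H g) 1 (inv1 M x)]"
    and "inv1 TT [(x, g)] = [(wprod M [inv1 M (eta (inv1 H g) g), t (inv1 H g) 1 (inv1 M x)], inv1 H g)]"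
  using T.inv1_word_sset[of "(x, g)"] iv_word ivp_word(1) assms
  by (simp_all add: tword_single ivp_def M.iv_def H.iv_def)

lemma is_word_TT_iff: "set ws \<subseteq> M1 \<times> H1 \<Longrightarrow>
    is_word TT (map (\<lambda>y. [y]) ws) \<longleftrightarrow> is_word H (map snd ws) \<and> is_word M (twisted_spine t ws)"
  by (simp add: is_word_TT tword_def)

lemma tw_incl_1: "x \<in> M1 \<Longrightarrow> tw_incl M H 1 x = [(x, one H)]"
  by (simp add: tw_incl_def spine_1[OF M.ss])

end

section \<open>Extensions come from twisting pairs\<close>

text \<open>This makes a trivialization over \<open>b\<close> comparable with one chosen for an edge
  of \<open>b\<close> alone.\<close>

lemma local_triv_edge:
  assumes F: "sset F" and B: "sset B" and b: "b \<in> simplices B n" and lt: "local_triv F E B f n b \<phi>" and ij: "i \<le> j" "j \<le> n"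
  shows "local_triv F E B f 1 (edge B n i j b)
    (\<lambda>m. \<lambda>u\<in>simplices (sprod F (std_simplex 1)) m. \<phi> m (fst u, compose {..m} (earr i j) (snd u)))" (is "local_triv _ _ _ _ _ _ ?\<phi>")
proof (rule local_trivI)
  note \<phi> = local_trivD[OF lt]
  let ?S = "sprod F (std_simplex 1)"
  have S: "sset ?S" by (intro sset_sprod F sset_std_simplex)
  note e = earr_ops[OF ij]
  have c: "compose {..m} (earr i j) \<theta> \<in> ops m n" if "\<theta> \<in> ops m 1" for m \<theta>
    using ops_comp[OF that e] .
  show "smap ?S E ?\<phi>"
  proof (rule smapI)
    show "?\<phi> m u \<in> simplices E m" if "u \<in> simplices ?S m" for m u
      using smap_in[OF \<phi>(1), of "(fst u, compose {..m} (earr i j) (snd u))" m] c that by (cases u) simp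
    show "?\<phi> m (act ?S m k \<theta> u) = act E m k \<theta> (?\<phi> k u)" if \<theta>: "\<theta> \<in> ops m k" and u: "u \<in> simplices ?S k" for m k \<theta> u
    proof -
      obtain y \<alpha> where y: "u = (y, \<alpha>)" "y \<in> simplices F k" "\<alpha> \<in> ops k 1" using u by auto
      have q: "(y, compose {..k} (earr i j) \<alpha>) \<in> simplices (sprod F (std_simplex n)) k" using y c by simp
      have "compose {..m} (earr i j) (compose {..m} \<alpha> \<theta>) = compose {..m} (compose {..k} (earr i j) \<alpha>) \<theta>"
        using ops_le[OF \<theta>] by (auto simp: compose_def fun_eq_iff)
      then show ?thesis using act_in[OF S \<theta> u] smap_act[OF \<phi>(1) \<theta> q] y by simp
    qed
  qed simp
  show "bij_betw (\<lambda>y. ?\<phi> m (y, \<theta>)) (simplices F m) {e \<in> simplices E m. f m e = act B m 1 \<theta> (edge B n i j b)}"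
    if \<theta>: "\<theta> \<in> ops m 1" for m \<theta>
  proof -
    have "act B m 1 \<theta> (edge B n i j b) = act B m n (compose {..m} (earr i j) \<theta>) b"
      using act_act[OF B \<theta> e b] by (simp add: edge_def earr_def)
    moreover have "bij_betw (\<lambda>y. ?\<phi> m (y, \<theta>)) (simplices F m) A \<longleftrightarrow> bij_betw (\<lambda>y. \<phi> m (y, compose {..m} (earr i j) \<theta>)) (simplices F m) A" for A
      using \<theta> by (intro bij_betw_cong) simp
    ultimately show ?thesis using \<phi>(2)[OF c[OF \<theta>]] by simp
  qed
qed

text \<open>Over each \<open>\<theta>\<close> the two trivializations differ by a bijection of the
  fibre. For \<open>n = 1\<close> the map \<open>l\<close> is a homotopy between self-maps of
  \<open>F\<close>, and this is how elements of \<open>F\<close> arise from a bundle.\<close>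

lemma local_triv_transition:
  assumes F: "sset F" and lt: "local_triv F E B f n b \<phi>" "local_triv F E B f n b \<phi>'"
  obtains l where "smap (sprod F (std_simplex n)) F l"
    and "\<And>m y \<theta>. y \<in> simplices F m \<Longrightarrow> \<theta> \<in> ops m n \<Longrightarrow> \<phi> m (l m (y, \<theta>), \<theta>) = \<phi>' m (y, \<theta>)"
proof -
  note \<phi> = local_trivD[OF lt(1)] and \<phi>' = local_trivD[OF lt(2)]
  let ?S = "sprod F (std_simplex n)"
  have S: "sset ?S" by (intro sset_sprod F sset_std_simplex)
  define l where "l = (\<lambda>m. \<lambda>u\<in>simplices ?S m. inv_into (simplices F m) (\<lambda>z. \<phi> m (z, snd u)) (\<phi>' m u))"
  have l: "l m (y, \<theta>) \<in> simplices F m \<and> \<phi> m (l m (y, \<theta>), \<theta>) = \<phi>' m (y, \<theta>)" if y: "y \<in> simplices F m" and \<theta>: "\<theta> \<in> ops m n" for m y \<theta>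
  proof -
    have "\<phi>' m (y, \<theta>) \<in> (\<lambda>z. \<phi> m (z, \<theta>)) ` simplices F m"
      using bij_betwE[OF \<phi>'(2)[OF \<theta>]] y bij_betw_imp_surj_on[OF \<phi>(2)[OF \<theta>]] by blast
    from inv_into_into[OF this] f_inv_into_f[OF this] show ?thesis using y \<theta> by (simp add: l_def)
  qed
  have "smap ?S F l"
  proof (rule smapI)
    show "l m (act ?S m k \<theta> u) = act F m k \<theta> (l k u)" if \<theta>: "\<theta> \<in> ops m k" and u: "u \<in> simplices ?S k" for m k \<theta> u
    proof -
      obtain y \<alpha> where y: "u = (y, \<alpha>)" "y \<in> simplices F k" "\<alpha> \<in> ops k n" using u by auto
      have \<alpha>\<theta>: "compose {..m} \<alpha> \<theta> \<in> ops m n" "act F m k \<theta> y \<in> simplices F m" using ops_comp[OF \<theta> y(3)] act_in[OF F \<theta> y(2)] by auto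
      have q: "(l k (y, \<alpha>), \<alpha>) \<in> simplices ?S k" using l[OF y(2,3)] y by simp
      \<comment> \<open>Naturality of \<open>l\<close> is checked after applying
        \<open>\<phi>\<close>, which is injective over a fixed operator.\<close>
      have "\<phi> m (l m (act F m k \<theta> y, compose {..m} \<alpha> \<theta>), compose {..m} \<alpha> \<theta>) = \<phi>' m (act ?S m k \<theta> (y, \<alpha>))"
        using l[OF \<alpha>\<theta>(2,1)] by simp
      also have "\<dots> = act E m k \<theta> (\<phi> k (l k (y, \<alpha>), \<alpha>))" using smap_act[OF \<phi>'(1) \<theta>, of "(y, \<alpha>)"] l[OF y(2,3)] y by simp
      also have "\<dots> = \<phi> m (act F m k \<theta> (l k (y, \<alpha>)), compose {..m} \<alpha> \<theta>)" using smap_act[OF \<phi>(1) \<theta> q] by simp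
      finally show ?thesis
        using bij_betw_imp_inj_on[OF \<phi>(2)[OF \<alpha>\<theta>(1)]] l[OF \<alpha>\<theta>(2,1)] act_in[OF F \<theta>] l[OF y(2,3)] by (auto simp: y(1) inj_on_def)
    qed
  qed (use l in \<open>auto simp: l_def\<close>)
  then show ?thesis using l that by blast
qed

section \<open>The total space of an extension as a partial monoid\<close>

locale extn = M: pgrp M + H: pgrp H for M :: "'a sset" and H :: "'b sset" +
  fixes E :: "'e sset" and i :: "nat \<Rightarrow> 'a \<Rightarrow> 'e" and \<rho> :: "nat \<Rightarrow> 'e \<Rightarrow> 'b"
  assumes ext: "extension M E H i \<rho>"
begin

abbreviation "M1 \<equiv> simplices M 1"
abbreviation "H1 \<equiv> simplices H 1"
abbreviation "v \<equiv> vertex H"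
abbreviation "Fib \<equiv> fibre E H \<rho> v"

lemma fb: "fibre_bundle M E H \<rho>"
  using ext by (simp add: extension_def)

lemma sset_E: "sset E"
  by (rule fb[unfolded fibre_bundle_def, THEN conjunct2, THEN conjunct1])

lemma smap_rho: "smap E H \<rho>"
  by (rule fb[unfolded fibre_bundle_def, THEN conjunct2, THEN conjunct2, THEN conjunct2, THEN conjunct1])

lemma siso_i: "siso M Fib i"
  using ext by (simp add: extension_def)

lemma Fib_simplices: "e \<in> simplices Fib n \<longleftrightarrow> e \<in> simplices E n \<and> \<rho> n e = degen H n v"
  by (simp add: fibre_def)

lemma Fib_act: "act Fib = act E"
  by (simp add: fibre_def)

lemma i_in: "u \<in> simplices M n \<Longrightarrow> i n u \<in> simplices E n \<and> \<rho> n (i n u) = degen H n v"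
  using smap_in[OF siso_smap[OF siso_i]] by (simp add: Fib_simplices)

lemma smap_i: "smap M E i"
proof (rule smapI)
  show "i m (act M m n \<theta> u) = act E m n \<theta> (i n u)" if "\<theta> \<in> ops m n" "u \<in> simplices M n" for m n \<theta> u
    using smap_act[OF siso_smap[OF siso_i] that] by (simp add: Fib_act)
  show "i n \<in> extensional (simplices M n)" for n
    using siso_smap[OF siso_i] by (auto simp: smap_def PiE_iff)
qed (use i_in in blast)

lemma i_inj: "x \<in> simplices M n \<Longrightarrow> y \<in> simplices M n \<Longrightarrow> i n x = i n y \<Longrightarrow> x = y"
  using siso_bij[OF siso_i, of n] by (auto simp: bij_betw_def inj_on_def)

lemma act_vertex: "\<lbrakk>\<theta> \<in> ops m 0; w \<in> simplices H 0\<rbrakk> \<Longrightarrow> act H m 0 \<theta> w = degen H m v"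
proof -
  assume \<theta>: "\<theta> \<in> ops m 0" and w: "w \<in> simplices H 0"
  have "\<theta> = (\<lambda>i\<in>{..m}. 0)"
    by (rule ops_eqI[OF \<theta>]) (use ops_le[OF \<theta>] in \<open>auto intro!: opsI simp del: restrict_apply\<close>, use ops_le[OF \<theta>] in auto)
  then show ?thesis using vertex_eq[OF H.pm w] by (simp add: degen_def)
qed

lemma act_const: "\<lbrakk>b \<in> simplices H n; k \<le> n\<rbrakk> \<Longrightarrow> act H m n (\<lambda>l\<in>{..m}. k) b = degen H m v"
proof -
  assume b: "b \<in> simplices H n" and k: "k \<le> n"
  have o: "(\<lambda>l\<in>{..m}. 0) \<in> ops m 0" "(\<lambda>l\<in>{..0}. k) \<in> ops 0 n" by (rule opsI; use k in simp)+
  have "compose {..m} (\<lambda>l\<in>{..0::nat}. k) (\<lambda>l\<in>{..m}. 0) = (\<lambda>l\<in>{..m}. k)" by (auto simp: compose_def fun_eq_iff)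
  then show ?thesis using act_act[OF H.ss o b] act_vertex[OF o(1) act_in[OF H.ss o(2) b]] by simp
qed

lemma const_earr: "(\<lambda>l\<in>{..1}. k) = earr k k"
  by (auto simp: earr_def fun_eq_iff)

text \<open>All vertices of \<open>E\<close> lie in the fibre over the vertex of \<open>H\<close>,
  so there is just one. Simplices with the same spine lie over the same \<open>b\<close>, because
  \<open>H\<close> is a partial monoid, and a trivialization over \<open>b\<close> compares them
  through their spines in \<open>M\<close>.\<close>

lemma pm_E: "partial_monoid E"
  unfolding partial_monoid_def
proof (intro conjI allI impI sset_E)
  have "e \<in> simplices Fib 0" if "e \<in> simplices E 0" for e
  proof -
    have "\<rho> 0 e = v" "degen H 0 v = v"
      by (rule vertex_eq[OF H.pm smap_in[OF smap_rho that]], rule vertex_eq[OF H.pm degen_in[OF H.ss vertex_in[OF H.pm]]])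
    then show ?thesis using that by (simp add: Fib_simplices)
  qed
  then have E0: "simplices E 0 = simplices Fib 0" by (auto simp: Fib_simplices)
  have M0: "simplices M 0 = {vertex M}" using vertex_in[OF M.pm] vertex_eq[OF M.pm] by blast
  have "simplices E 0 = {i 0 (vertex M)}" unfolding E0
    using bij_betw_imp_surj_on[OF siso_bij[OF siso_i, of 0]] by (simp add: M0)
  then show "\<exists>!e. e \<in> simplices E 0" by simp
  show "inj_on (spine E n) (simplices E n)" for n
  proof (rule inj_onI)
    fix e e' assume e: "e \<in> simplices E n" "e' \<in> simplices E n" and sp: "spine E n e = spine E n e'"
    define b where "b = \<rho> n e"
    have b: "b \<in> simplices H n" using smap_in[OF smap_rho e(1)] by (simp add: b_def)
    have "spine H n (\<rho> n e) = spine H n (\<rho> n e')" using smap_spine[OF smap_rho e(1)] smap_spine[OF smap_rho e(2)] sp by simp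
    then have eq: "\<rho> n e' = b" unfolding b_def
      by (rule pm_spine_eqD[OF H.pm smap_in[OF smap_rho e(1)] smap_in[OF smap_rho e(2)], symmetric])
    obtain \<phi> where "local_triv M E H \<rho> n b \<phi>" using fibre_bundleD[OF fb b] by (rule exE)
    note \<phi> = local_trivD[OF this]
    let ?id = "\<lambda>l\<in>{..n}. l"
    have id: "?id \<in> ops n n" by (rule opsI) auto
    have "e \<in> {e \<in> simplices E n. \<rho> n e = act H n n ?id b}" "e' \<in> {e \<in> simplices E n. \<rho> n e = act H n n ?id b}"
      using e eq act_id[OF H.ss b] by (simp_all add: b_def)
    then obtain y y' where y: "y \<in> simplices M n" "e = \<phi> n (y, ?id)" and y': "y' \<in> simplices M n" "e' = \<phi> n (y', ?id)"
      using bij_betw_imp_surj_on[OF \<phi>(2)[OF id]] by blast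
    have ed: "edge E n k (Suc k) (\<phi> n (z, ?id)) = \<phi> 1 (edge M n k (Suc k) z, earr k (Suc k))" if "z \<in> simplices M n" "k < n" for z k
      using smap_edge[OF \<phi>(1), of k "Suc k" n "(z, ?id)"] that id by simp
    have "spine M n y = spine M n y'"
    proof (rule nth_equalityI)
      fix k assume "k < length (spine M n y)"
      then have k: "k < n" by simp
      have "edge E n k (Suc k) e = edge E n k (Suc k) e'" using arg_cong[OF sp, of "\<lambda>l. l ! k"] k by simp
      then have eq': "\<phi> 1 (edge M n k (Suc k) y, earr k (Suc k)) = \<phi> 1 (edge M n k (Suc k) y', earr k (Suc k))"
        by (simp only: y(2) y'(2) ed[OF y(1) k] ed[OF y'(1) k])
      have o: "earr k (Suc k) \<in> ops 1 n" using k by (intro earr_ops) auto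
      have in1: "edge M n k (Suc k) y \<in> M1" "edge M n k (Suc k) y' \<in> M1" using edge_in[OF M.ss _ _ y(1)] edge_in[OF M.ss _ _ y'(1)] k by auto
      show "spine M n y ! k = spine M n y' ! k"
        using inj_onD[OF bij_betw_imp_inj_on[OF \<phi>(2)[OF o]] eq' in1] k by simp
    qed simp
    then have "y = y'" by (rule pm_spine_eqD[OF M.pm y(1) y'(1)])
    then show "e = e'" using y y' by simp
  qed
qed

sublocale E: pmon E
  by unfold_locales (rule pm_E)

text \<open>The automorphism of \<open>M\<close> by which a local trivialization differs from \<open>i\<close> at the vertex \<open>k\<close>.\<close>

definition vaut :: "(nat \<Rightarrow> 'a \<times> (nat \<Rightarrow> nat) \<Rightarrow> 'e) \<Rightarrow> nat \<Rightarrow> nat \<Rightarrow> 'a \<Rightarrow> 'a" where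
  "vaut \<phi> k = scomp M (sinv M Fib i) (\<lambda>m. \<lambda>y\<in>simplices M m. \<phi> m (y, \<lambda>l\<in>{..m}. k))"

lemma vaut:
  assumes lt: "local_triv M E H \<rho> n b \<phi>" and b: "b \<in> simplices H n" and k: "k \<le> n"
  shows "vaut \<phi> k \<in> Aut M" and "\<And>x. x \<in> M1 \<Longrightarrow> i 1 (vaut \<phi> k 1 x) = \<phi> 1 (x, earr k k)"
proof -
  note \<phi> = local_trivD[OF lt]
  let ?r = "\<lambda>m. \<lambda>y\<in>simplices M m. \<phi> m (y, \<lambda>l\<in>{..m}. k)"
  have c: "(\<lambda>l\<in>{..m}. k) \<in> ops m n" for m using k by (intro opsI) auto
  have r: "bij_betw (?r m) (simplices M m) (simplices Fib m)" for m
  proof -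
    have "bij_betw (\<lambda>y. \<phi> m (y, \<lambda>l\<in>{..m}. k)) (simplices M m) (simplices Fib m)"
      using \<phi>(2)[OF c, of m] act_const[OF b k] by (simp add: fibre_def)
    then show ?thesis by (subst bij_betw_cong[where g = "\<lambda>y. \<phi> m (y, \<lambda>l\<in>{..m}. k)"]) simp_all
  qed
  have sr: "smap M Fib ?r"
  proof (rule smapI)
    show "?r m (act M m j \<theta> u) = act Fib m j \<theta> (?r j u)" if \<theta>: "\<theta> \<in> ops m j" and u: "u \<in> simplices M j" for m j \<theta> u
    proof -
      have "compose {..m} (\<lambda>l\<in>{..j}. k) \<theta> = (\<lambda>l\<in>{..m}. k)" using ops_le[OF \<theta>] by (auto simp: compose_def fun_eq_iff)
      then show ?thesis using smap_act[OF \<phi>(1) \<theta>, of "(u, \<lambda>l\<in>{..j}. k)"] u c act_in[OF M.ss \<theta> u] by (simp add: Fib_act)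
    qed
    show "?r m u \<in> simplices Fib m" if "u \<in> simplices M m" for m u using bij_betwE[OF r] that by blast
  qed simp
  note s = smap_sinv[OF M.ss siso_smap[OF siso_i] siso_bij[OF siso_i]]
  have sv: "smap M M (vaut \<phi> k)" unfolding vaut_def by (rule smap_scomp[OF M.ss sr s(1)])
  have app: "vaut \<phi> k m y = sinv M Fib i m (?r m y)" if "y \<in> simplices M m" for m y
    unfolding vaut_def by (rule scomp_app[OF that])
  have iv: "i m (vaut \<phi> k m y) = ?r m y" if "y \<in> simplices M m" for m y
    using app[OF that] s(3)[OF smap_in[OF sr that]] by simp
  show "i 1 (vaut \<phi> k 1 x) = \<phi> 1 (x, earr k k)" if "x \<in> M1" for x
    using iv[OF that] that by (simp add: const_earr)
  have "bij_betw (vaut \<phi> k m) (simplices M m) (simplices M m)" for m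
  proof (rule bij_betwI')
    show "vaut \<phi> k m x = vaut \<phi> k m y \<longleftrightarrow> x = y" if "x \<in> simplices M m" "y \<in> simplices M m" for x y
      using iv[OF that(1)] iv[OF that(2)] inj_onD[OF bij_betw_imp_inj_on[OF r], of m x y] that by auto
    show "vaut \<phi> k m x \<in> simplices M m" if "x \<in> simplices M m" for x by (rule smap_in[OF sv that])
    show "\<exists>x\<in>simplices M m. y = vaut \<phi> k m x" if y: "y \<in> simplices M m" for y
    proof -
      have "i m y \<in> ?r m ` simplices M m" unfolding bij_betw_imp_surj_on[OF r] by (rule smap_in[OF siso_smap[OF siso_i] y])
      then obtain x where x: "x \<in> simplices M m" "i m y = ?r m x" by (rule imageE)
      have "y = vaut \<phi> k m x" by (rule i_inj[OF y smap_in[OF sv x(1)]]) (simp only: iv[OF x(1)] x(2))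
      then show ?thesis using x(1) by blast
    qed
  qed
  then show "vaut \<phi> k \<in> Aut M" using sisoI[OF M.ss sv] by (simp add: Aut_def)
qed

text \<open>The normalizations yield \<open>t(g)(x) s(g) = s(g) x\<close>, \<open>t(1) = Id\<close> and \<open>s(1) = 1\<close> below.\<close>

lemma normalized_triv_exists:
  assumes g: "g \<in> H1"
  shows "\<exists>\<phi>. local_triv M E H \<rho> 1 g \<phi> \<and> (\<forall>x\<in>M1. \<phi> 1 (x, earr 1 1) = i 1 x) \<and>
    (g = one H \<longrightarrow> (\<forall>x\<in>M1. \<forall>\<theta>\<in>ops 1 1. \<phi> 1 (x, \<theta>) = i 1 x))"
proof (cases "g = one H")
  case True
  let ?S = "sprod M (std_simplex 1)"
  \<comment> \<open>Over the degenerate edge all simplices lie in the fibre over the vertex, so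
    \<open>i\<close>, constant in the direction of the standard simplex, is a
    trivialization.\<close>
  let ?\<phi> = "\<lambda>m. \<lambda>u\<in>simplices ?S m. i m (fst u)"
  have S: "sset ?S" by (intro sset_sprod M.ss sset_std_simplex)
  have o: "(\<lambda>l\<in>{..1}. 0) \<in> ops 1 0" by (rule opsI) auto
  have "local_triv M E H \<rho> 1 g ?\<phi>"
  proof (rule local_trivI)
    show "smap ?S E ?\<phi>"
    proof (rule smapI)
      show "?\<phi> m (act ?S m k \<theta> u) = act E m k \<theta> (?\<phi> k u)" if "\<theta> \<in> ops m k" "u \<in> simplices ?S k" for m k \<theta> u
      proof -
        from that obtain y \<alpha> where u: "u = (y, \<alpha>)" "y \<in> simplices M k" by auto
        show ?thesis using smap_act[OF smap_i that(1) u(2)] act_in[OF S that] that u by simp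
      qed
    qed (use i_in in auto)
    show "bij_betw (\<lambda>y. ?\<phi> m (y, \<theta>)) (simplices M m) {e \<in> simplices E m. \<rho> m e = act H m 1 \<theta> g}" if \<theta>: "\<theta> \<in> ops m 1" for m \<theta>
    proof -
      have "act H m 1 \<theta> g = act H m 0 (compose {..m} (\<lambda>l\<in>{..1}. 0) \<theta>) v"
        unfolding True one_def degen_def by (rule act_act[OF H.ss \<theta> o vertex_in[OF H.pm]])
      also have "\<dots> = degen H m v" by (rule act_vertex[OF ops_comp[OF \<theta> o] vertex_in[OF H.pm]])
      finally have "{e \<in> simplices E m. \<rho> m e = act H m 1 \<theta> g} = simplices Fib m" by (simp add: fibre_def)
      moreover have "bij_betw (\<lambda>y. ?\<phi> m (y, \<theta>)) (simplices M m) A \<longleftrightarrow> bij_betw (i m) (simplices M m) A" for A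
        using \<theta> by (intro bij_betw_cong) simp
      ultimately show ?thesis using siso_bij[OF siso_i, of m] by simp
    qed
  qed
  moreover have "?\<phi> 1 (x, \<theta>) = i 1 x" if "x \<in> M1" "\<theta> \<in> ops 1 1" for x \<theta> using that by simp
  moreover have "earr 1 1 \<in> ops 1 1" by (rule earr_ops) auto
  ultimately show ?thesis by (intro exI[of _ ?\<phi>]) blast
next
  case False
  obtain \<phi> where lt: "local_triv M E H \<rho> 1 g \<phi>" using fibre_bundleD[OF fb g] by (rule exE)
  note \<phi> = local_trivD[OF lt]
  let ?S = "sprod M (std_simplex 1)"
  have S: "sset ?S" by (intro sset_sprod M.ss sset_std_simplex)
  define \<alpha> where "\<alpha> = vaut \<phi> 1"
  have \<alpha>: "siso M M \<alpha>" and i\<alpha>: "\<And>x. x \<in> M1 \<Longrightarrow> i 1 (\<alpha> 1 x) = \<phi> 1 (x, earr 1 1)"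
    using vaut[OF lt g order_refl] by (simp_all add: \<alpha>_def Aut_def)
  \<comment> \<open>Precomposing the fibre coordinate with the inverse of \<open>\<alpha>\<close>
    makes the trivialization agree with \<open>i\<close> at the vertex 1.\<close>
  define \<beta> where "\<beta> = sinv M M \<alpha>"
  note s = smap_sinv[OF M.ss siso_smap[OF \<alpha>] siso_bij[OF \<alpha>], folded \<beta>_def]
  let ?\<phi> = "\<lambda>m. \<lambda>u\<in>simplices ?S m. \<phi> m (\<beta> m (fst u), snd u)"
  have "local_triv M E H \<rho> 1 g ?\<phi>"
  proof (rule local_trivI)
    show "smap ?S E ?\<phi>"
    proof (rule smapI)
      show "?\<phi> m u \<in> simplices E m" if "u \<in> simplices ?S m" for m u
        using that smap_in[OF \<phi>(1), of "(\<beta> m (fst u), snd u)" m] smap_in[OF s(1)] by auto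
      show "?\<phi> m (act ?S m k \<theta> u) = act E m k \<theta> (?\<phi> k u)" if "\<theta> \<in> ops m k" "u \<in> simplices ?S k" for m k \<theta> u
      proof -
        from that obtain y \<gamma> where u: "u = (y, \<gamma>)" "y \<in> simplices M k" "\<gamma> \<in> ops k 1" by auto
        show ?thesis using smap_act[OF \<phi>(1) that(1), of "(\<beta> k y, \<gamma>)"] smap_act[OF s(1) that(1) u(2)] smap_in[OF s(1) u(2)]
            act_in[OF S that] that u by simp
      qed
    qed simp
    show "bij_betw (\<lambda>y. ?\<phi> m (y, \<theta>)) (simplices M m) {e \<in> simplices E m. \<rho> m e = act H m 1 \<theta> g}" if \<theta>: "\<theta> \<in> ops m 1" for m \<theta>
    proof -
      have "bij_betw (\<beta> m) (simplices M m) (simplices M m)"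
        by (rule bij_betw_byWitness[of _ "\<alpha> m"]) (use s smap_in[OF s(1)] smap_in[OF siso_smap[OF \<alpha>]] in auto)
      from bij_betw_trans[OF this \<phi>(2)[OF \<theta>]]
      have "bij_betw (\<lambda>y. \<phi> m (\<beta> m y, \<theta>)) (simplices M m) {e \<in> simplices E m. \<rho> m e = act H m 1 \<theta> g}"
        by (simp add: comp_def)
      moreover have "bij_betw (\<lambda>y. ?\<phi> m (y, \<theta>)) (simplices M m) A \<longleftrightarrow> bij_betw (\<lambda>y. \<phi> m (\<beta> m y, \<theta>)) (simplices M m) A" for A
        using \<theta> by (intro bij_betw_cong) simp
      ultimately show ?thesis by blast
    qed
  qed
  moreover have "?\<phi> 1 (x, earr 1 1) = i 1 x" if x: "x \<in> M1" for x
    using i\<alpha>[OF smap_in[OF s(1) x]] s(3)[OF x] x earr_ops[of 1 1 1] by simp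
  ultimately show ?thesis using False by (intro exI[of _ ?\<phi>]) blast
qed

section \<open>Lifts of edges and the twisting automorphisms\<close>

definition Phi :: "'b \<Rightarrow> nat \<Rightarrow> 'a \<times> (nat \<Rightarrow> nat) \<Rightarrow> 'e" where
  "Phi g = (SOME \<phi>. local_triv M E H \<rho> 1 g \<phi> \<and> (\<forall>x\<in>M1. \<phi> 1 (x, earr 1 1) = i 1 x) \<and>
    (g = one H \<longrightarrow> (\<forall>x\<in>M1. \<forall>\<theta>\<in>ops 1 1. \<phi> 1 (x, \<theta>) = i 1 x)))"

lemma Phi: assumes g: "g \<in> H1"
  shows "local_triv M E H \<rho> 1 g (Phi g)" "\<And>x. x \<in> M1 \<Longrightarrow> Phi g 1 (x, earr 1 1) = i 1 x"
    and "\<And>x \<theta>. g = one H \<Longrightarrow> x \<in> M1 \<Longrightarrow> \<theta> \<in> ops 1 1 \<Longrightarrow> Phi g 1 (x, \<theta>) = i 1 x"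
proof -
  have *: "local_triv M E H \<rho> 1 g (Phi g) \<and> (\<forall>x\<in>M1. Phi g 1 (x, earr 1 1) = i 1 x) \<and>
    (g = one H \<longrightarrow> (\<forall>x\<in>M1. \<forall>\<theta>\<in>ops 1 1. Phi g 1 (x, \<theta>) = i 1 x))"
    unfolding Phi_def by (rule someI_ex[OF normalized_triv_exists[OF g]])
  show "local_triv M E H \<rho> 1 g (Phi g)" "\<And>x. x \<in> M1 \<Longrightarrow> Phi g 1 (x, earr 1 1) = i 1 x"
    "\<And>x \<theta>. g = one H \<Longrightarrow> x \<in> M1 \<Longrightarrow> \<theta> \<in> ops 1 1 \<Longrightarrow> Phi g 1 (x, \<theta>) = i 1 x"
    by (rule *[THEN conjunct1], rule *[THEN conjunct2, THEN conjunct1, rule_format], assumption,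
      rule *[THEN conjunct2, THEN conjunct2, rule_format])
qed

text \<open>\<open>Phi g\<close> agrees with \<open>i\<close> at the terminal vertex, so its
  deviation from \<open>i\<close> at the initial vertex is the whole twist along
  \<open>g\<close>.\<close>

definition t :: "'b \<Rightarrow> nat \<Rightarrow> 'a \<Rightarrow> 'a" where
  "t g = vaut (Phi g) 0"

definition s :: "'b \<Rightarrow> 'e" where
  "s g = Phi g 1 (one M, iota)"

definition el :: "'a \<times> 'b \<Rightarrow> 'e" where
  "el p = wprod E [i 1 (fst p), s (snd p)]"

lemma t_Aut: "g \<in> H1 \<Longrightarrow> t g \<in> Aut M"
  unfolding t_def by (rule vaut(1)[OF Phi(1)]) auto

lemma t_waut: "g \<in> H1 \<Longrightarrow> M.waut (t g 1)"
  by (rule M.Aut_waut[OF t_Aut])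

lemma i_t: "g \<in> H1 \<Longrightarrow> x \<in> M1 \<Longrightarrow> i 1 (t g 1 x) = Phi g 1 (x, earr 0 0)"
  unfolding t_def by (rule vaut(2)[OF Phi(1)]) auto

lemma el_t: "g \<in> H1 \<Longrightarrow> x \<in> M1 \<Longrightarrow> el (t g 1 x, g) = Phi g 1 (x, iota)"
  using cylinder_intertwines(2)[OF M.pm pm_E local_trivD(1)[OF Phi(1)], of g x] i_t by (simp add: el_def s_def)

lemma iota_ops: "iota \<in> ops 1 1"
  unfolding iota_earr by (rule earr_ops) auto

lemma act_iota: "g \<in> H1 \<Longrightarrow> act H 1 1 iota g = g"
  using act_id[OF H.ss] by (simp add: iota_def)

text \<open>The trivialization sends \<open>x\<close> to the edge \<open>el (t g 1 x, g)\<close>; it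
  remains to undo the bijection \<open>t g 1\<close> of \<open>M1\<close>.\<close>

lemma el_bij: assumes g: "g \<in> H1" shows "bij_betw (\<lambda>x. el (x, g)) M1 {e \<in> simplices E 1. \<rho> 1 e = g}"
proof -
  have f: "bij_betw (M.finv (t g 1)) M1 M1" using M.waut_finv[OF t_waut[OF g]] by (simp add: M.waut_def)
  have "bij_betw (\<lambda>x. Phi g 1 (x, iota)) M1 {e \<in> simplices E 1. \<rho> 1 e = g}"
    using local_trivD(2)[OF Phi(1)[OF g] iota_ops] act_iota[OF g] by simp
  from bij_betw_trans[OF f this]
  have "bij_betw (\<lambda>x. Phi g 1 (M.finv (t g 1) x, iota)) M1 {e \<in> simplices E 1. \<rho> 1 e = g}" by (simp add: comp_def)
  moreover have "el (x, g) = Phi g 1 (M.finv (t g 1) x, iota)" if "x \<in> M1" for x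
    using el_t[OF g M.finv(1)[OF t_waut[OF g] that]] M.finv(2)[OF t_waut[OF g] that] by simp
  then have "bij_betw (\<lambda>x. el (x, g)) M1 A \<longleftrightarrow> bij_betw (\<lambda>x. Phi g 1 (M.finv (t g 1) x, iota)) M1 A" for A
    by (rule bij_betw_cong)
  ultimately show ?thesis by blast
qed

lemma el_in: "x \<in> M1 \<Longrightarrow> g \<in> H1 \<Longrightarrow> el (x, g) \<in> simplices E 1 \<and> \<rho> 1 (el (x, g)) = g"
  using bij_betwE[OF el_bij] by blast

lemma el_eq_iff: "\<lbrakk>x \<in> M1; y \<in> M1; g \<in> H1\<rbrakk> \<Longrightarrow> el (x, g) = el (y, g) \<longleftrightarrow> x = y"
  using inj_onD[OF bij_betw_imp_inj_on[OF el_bij], of g x y] by blast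

lemma el_inj: "p \<in> M1 \<times> H1 \<Longrightarrow> q \<in> M1 \<times> H1 \<Longrightarrow> el p = el q \<Longrightarrow> p = q"
proof -
  assume a: "p \<in> M1 \<times> H1" "q \<in> M1 \<times> H1" "el p = el q"
  obtain x g y h where pq: "p = (x, g)" "q = (y, h)" by (cases p, cases q)
  have "g = h" using el_in[of x g] el_in[of y h] a by (auto simp: pq)
  then show ?thesis using el_eq_iff[of x y g] a by (simp add: pq)
qed

lemma el_surj: assumes e: "e \<in> simplices E 1" obtains p where "p \<in> M1 \<times> H1" "e = el p"
proof -
  have g: "\<rho> 1 e \<in> H1" by (rule smap_in[OF smap_rho e])
  then have "e \<in> (\<lambda>x. el (x, \<rho> 1 e)) ` M1" using bij_betw_imp_surj_on[OF el_bij[OF g]] e by simp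
  then obtain x where "e = el (x, \<rho> 1 e)" "x \<in> M1" by (rule imageE)
  with g show ?thesis by (intro that[of "(x, \<rho> 1 e)"]) simp_all
qed

lemma s_intertwines: assumes g: "g \<in> H1" shows "intertwines M E (i 1 \<circ> t g 1) (s g) (i 1)"
proof -
  note c = cylinder_intertwines(1)[OF M.pm pm_E local_trivD(1)[OF Phi(1)[OF g]]]
  show ?thesis
    unfolding intertwines_def
  proof (intro conjI allI impI ballI)
    fix u v assume uv: "is_word M (u @ v)"
    have "map (i 1 \<circ> t g 1) u = map (\<lambda>x. Phi g 1 (x, earr 0 0)) u" "map (i 1) v = map (\<lambda>x. Phi g 1 (x, earr 1 1)) v"
      using i_t[OF g] Phi(2)[OF g] M.is_word_set[OF uv] by auto
    then show "is_word E (map (i 1 \<circ> t g 1) u @ [s g] @ map (i 1) v)"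
      using intertwines_word[OF c uv] by (simp only: s_def)
  next
    fix x assume x: "x \<in> M1"
    show "wprod E [(i 1 \<circ> t g 1) x, s g] = wprod E [s g, i 1 x]"
      using intertwines_comm[OF c x] i_t[OF g x] Phi(2)[OF g x] by (simp add: s_def)
  qed
qed

lemma i_one: "i 1 (one M) = one E"
  by (rule smap_one[OF smap_i M.pm pm_E])

lemma s_one: "s (one H) = one E"
  using Phi(3)[OF one_in[OF H.pm] refl one_in[OF M.pm] iota_ops] i_one by (simp add: s_def)

lemma s_in: "g \<in> H1 \<Longrightarrow> s g \<in> simplices E 1"
  unfolding s_def using smap_in[OF local_trivD(1)[OF Phi(1)], of g "(one M, iota)" 1] one_in[OF M.pm] iota_ops by simp

lemma el_one: "x \<in> M1 \<Longrightarrow> el (x, one H) = i 1 x" "g \<in> H1 \<Longrightarrow> el (one M, g) = s g"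
  using E.m_e[of "i 1 x"] E.e_m[of "s g"] i_in[of x 1] s_in by (simp_all add: el_def s_one i_one E.is_word_1)

lemma t_one: assumes x: "x \<in> M1" shows "t (one H) 1 x = x"
proof (rule i_inj[OF _ x])
  note o = one_in[OF H.pm]
  show "t (one H) 1 x \<in> M1" by (rule M.waut_in[OF t_waut[OF o] x])
  show "i 1 (t (one H) 1 x) = i 1 x"
    using i_t[OF o x] Phi(3)[OF o refl x earr_ops[of 0 0 1]] by simp
qed

section \<open>Words of an extension\<close>

text \<open>Over the edge starting at \<open>k\<close>, \<open>\<phi>\<close> and
  \<open>Phi g\<close> differ by a homotopy of self-maps of \<open>M\<close>. The ends of
  \<open>Phi g\<close> are \<open>i \<circ> t g\<close> and \<open>i\<close>, so the ends of the
  homotopy are known from \<open>vaut\<close>, up to \<open>t g 1\<close> at the first of them. Its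
  value at the unit, moved by \<open>t g 1\<close>, is the required element. These are the data for
  \<open>gauge_sw\<close>.\<close>

lemma transition:
  assumes b: "b \<in> simplices H n" and lt: "local_triv M E H \<rho> n b \<phi>" and k: "k < n"
  defines "g \<equiv> edge H n k (Suc k) b"
  shows "\<exists>\<nu>. intertwines M M (vaut \<phi> k 1) \<nu> (t g 1 \<circ> vaut \<phi> (Suc k) 1) \<and>
    (\<forall>y\<in>M1. \<phi> 1 (y, earr k (Suc k)) = el (wprod M [vaut \<phi> k 1 y, \<nu>], g))"
proof -
  have k': "k \<le> Suc k" "Suc k \<le> n" "k \<le> n" using k by auto
  have g: "g \<in> H1" unfolding g_def by (rule edge_in[OF H.ss k'(1,2) b])
  note lte = local_triv_edge[OF M.ss H.ss b lt k'(1,2), folded g_def]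
  obtain l where l: "smap (sprod M (std_simplex 1)) M l"
    and l_eq: "\<And>m y \<theta>. y \<in> simplices M m \<Longrightarrow> \<theta> \<in> ops m 1 \<Longrightarrow> Phi g m (l m (y, \<theta>), \<theta>) =
      (\<lambda>u\<in>simplices (sprod M (std_simplex 1)) m. \<phi> m (fst u, compose {..m} (earr k (Suc k)) (snd u))) (y, \<theta>)"
    using local_triv_transition[OF M.ss Phi(1)[OF g] lte] by blast
  have ce: "compose {..1} (earr k (Suc k)) (earr p q) = earr (if p = 0 then k else Suc k) (if q = 0 then k else Suc k)"
    if "p \<le> 1" "q \<le> 1" for p q using that by (auto simp: compose_def earr_def fun_eq_iff le_Suc_eq One_nat_def)
  have l1: "Phi g 1 (l 1 (y, earr p q), earr p q) = \<phi> 1 (y, earr (if p = 0 then k else Suc k) (if q = 0 then k else Suc k))"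
    if "y \<in> M1" "p \<le> q" "q \<le> 1" for y p q
    using l_eq[OF that(1) earr_ops[OF that(2,3)]] that earr_ops[OF that(2,3)] ce[of p q] by simp
  have l_in: "l 1 (y, earr p q) \<in> M1" if "y \<in> M1" "p \<le> q" "q \<le> 1" for y p q
    using smap_in[OF l, of "(y, earr p q)" 1] that earr_ops[OF that(2,3)] by simp
  let ?f0 = "\<lambda>x. l 1 (x, earr 0 0)" and ?f1 = "\<lambda>x. l 1 (x, earr 1 1)"
  define \<mu> where "\<mu> = l 1 (one M, iota)"
  note c = cylinder_intertwines[OF M.pm M.pm l, folded \<mu>_def]
  note tg = t_waut[OF g]
  note va = vaut[OF lt b k'(3)] vaut[OF lt b k'(2)]
  have va_in: "vaut \<phi> k 1 x \<in> M1" "vaut \<phi> (Suc k) 1 x \<in> M1" if "x \<in> M1" for x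
    using M.waut_in[OF M.Aut_waut[OF va(1)] that] M.waut_in[OF M.Aut_waut[OF va(3)] that] .
  have f0: "t g 1 (?f0 x) = vaut \<phi> k 1 x" if x: "x \<in> M1" for x
  proof (rule i_inj[OF M.waut_in[OF tg l_in[OF x]] va_in(1)[OF x]])
    show "i 1 (t g 1 (?f0 x)) = i 1 (vaut \<phi> k 1 x)"
      using i_t[OF g l_in[OF x], of 0 0] l1[OF x, of 0 0] va(2)[OF x] by simp
  qed simp_all
  have f1: "?f1 x = vaut \<phi> (Suc k) 1 x" if x: "x \<in> M1" for x
  proof (rule i_inj[OF l_in[OF x] va_in(2)[OF x]])
    show "i 1 (?f1 x) = i 1 (vaut \<phi> (Suc k) 1 x)"
      using Phi(2)[OF g l_in[OF x], of 1 1] l1[OF x, of 1 1] va(4)[OF x] by simp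
  qed simp_all
  have "intertwines M M (vaut \<phi> k 1) (t g 1 \<mu>) (t g 1 \<circ> vaut \<phi> (Suc k) 1)"
    by (rule M.intw_cong[OF M.intw_comp_left[OF c(1) tg]]) (simp_all add: f0 f1)
  moreover have "\<phi> 1 (y, earr k (Suc k)) = el (wprod M [vaut \<phi> k 1 y, t g 1 \<mu>], g)" if y: "y \<in> M1" for y
  proof -
    have w: "is_word M [?f0 y, \<mu>]" using intertwines_word[OF c(1), of "[y]" "[]"] y by (simp add: M.is_word_1)
    have li: "l 1 (y, iota) \<in> M1" using l_in[OF y, of 0 1] by (simp add: iota_earr)
    have "\<phi> 1 (y, earr k (Suc k)) = Phi g 1 (l 1 (y, iota), iota)" using l1[OF y, of 0 1] by (simp add: iota_earr)
    also have "\<dots> = el (t g 1 (l 1 (y, iota)), g)" by (rule el_t[OF g li, symmetric])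
    also have "t g 1 (l 1 (y, iota)) = wprod M [vaut \<phi> k 1 y, t g 1 \<mu>]"
      unfolding c(2)[OF y] M.waut_mult[OF tg w] f0[OF y] ..
    finally show ?thesis .
  qed
  ultimately show ?thesis by blast
qed

definition sp :: "'a \<times> 'b \<Rightarrow> 'a \<times> ('a \<Rightarrow> 'a)" where
  "sp = (\<lambda>(x, g). (x, t g 1))"

text \<open>A trivialization over the simplex of \<open>H\<close> identifies the simplices of
  \<open>E\<close> above it with words \<open>ys\<close> of \<open>M\<close>. Written in the form
  \<open>el\<close>, the letters of their spines have first components \<open>a k (ys ! k)\<close>
  times \<open>\<nu> k\<close>, so the change of coordinates compares the two conditions.\<close>

lemma is_word_el:
  assumes ws: "set ws \<subseteq> M1 \<times> H1"
  shows "is_word E (map el ws) \<longleftrightarrow> is_word H (map snd ws) \<and> M.sw (map sp ws)"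
proof (cases "is_word H (map snd ws)")
  case False
  \<comment> \<open>A word of \<open>E\<close> projects to a word of \<open>H\<close>, so both sides
    are false.\<close>
  have "map (\<rho> 1) (map el ws) = map snd ws"
    using ws el_in by (auto simp: subset_eq)
  then show ?thesis using False smap_word[OF smap_rho, of "map el ws"] by metis
next
  case True
  define n b where "n = length ws" and "b = word H (map snd ws)"
  have b: "b \<in> simplices H n" "spine H n b = map snd ws"
    using word_simplex[OF H.pm True, of n] by (simp_all add: n_def b_def)
  have wk: "fst (ws ! k) \<in> M1" "snd (ws ! k) \<in> H1" "ws ! k \<in> M1 \<times> H1" "edge H n k (Suc k) b = snd (ws ! k)" if "k < n" for k
  proof -
    have "ws ! k \<in> set ws" using that by (simp add: n_def)
    then show "fst (ws ! k) \<in> M1" "snd (ws ! k) \<in> H1" "ws ! k \<in> M1 \<times> H1" using ws by auto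
    show "edge H n k (Suc k) b = snd (ws ! k)" using arg_cong[OF b(2), of "\<lambda>l. l ! k"] that by (simp add: n_def)
  qed
  obtain \<phi> where lt: "local_triv M E H \<rho> n b \<phi>" using fibre_bundleD[OF fb b(1)] by (rule exE)
  note \<phi> = local_trivD[OF lt]
  define a where "a k = vaut \<phi> k 1" for k
  have a: "M.waut (a k)" if "k \<le> n" for k unfolding a_def by (rule M.Aut_waut[OF vaut(1)[OF lt b(1) that]])
  have "\<exists>\<nu>. intertwines M M (a k) \<nu> (t (snd (ws ! k)) 1 \<circ> a (Suc k)) \<and>
      (\<forall>y\<in>M1. \<phi> 1 (y, earr k (Suc k)) = el (wprod M [a k y, \<nu>], snd (ws ! k)))" if "k < n" for k
    using transition[OF b(1) lt that] by (simp add: wk(4)[OF that] a_def)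
  then obtain \<nu> where h: "\<And>k. k < n \<Longrightarrow> intertwines M M (a k) (\<nu> k) (t (snd (ws ! k)) 1 \<circ> a (Suc k))"
    and el\<nu>: "\<And>k y. k < n \<Longrightarrow> y \<in> M1 \<Longrightarrow> \<phi> 1 (y, earr k (Suc k)) = el (wprod M [a k y, \<nu> k], snd (ws ! k))"
    by metis
  have f: "M.waut (t (snd (ws ! k)) 1)" if "k < n" for k by (rule t_waut[OF wk(2)[OF that]])
  let ?id = "\<lambda>l\<in>{..n}. l"
  have id: "?id \<in> ops n n" by (rule opsI) auto
  have bid: "{e \<in> simplices E n. \<rho> n e = act H n n ?id b} = {e \<in> simplices E n. \<rho> n e = b}"
    using act_id[OF H.ss b(1)] by simp
  have sp_e: "spine E n (\<phi> n (y, ?id)) = map (\<lambda>k. el (wprod M [a k (spine M n y ! k), \<nu> k], snd (ws ! k))) [0..<n]"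
    if y: "y \<in> simplices M n" for y
  proof (rule nth_equalityI)
    fix k assume "k < length (spine E n (\<phi> n (y, ?id)))"
    then have k: "k < n" by simp
    have "edge E n k (Suc k) (\<phi> n (y, ?id)) = \<phi> 1 (edge M n k (Suc k) y, earr k (Suc k))"
      using smap_edge[OF \<phi>(1), of k "Suc k" n "(y, ?id)"] y k id by simp
    then show "spine E n (\<phi> n (y, ?id)) ! k = map (\<lambda>k. el (wprod M [a k (spine M n y ! k), \<nu> k], snd (ws ! k))) [0..<n] ! k"
      using el\<nu>[OF k edge_in[OF M.ss _ _ y], of k "Suc k"] k by simp
  qed simp
  have gauge: "is_word M ys \<longleftrightarrow> M.sw (map sp ws)"
    if "set ys \<subseteq> M1" "length ys = n" "\<And>k. k < n \<Longrightarrow> wprod M [a k (ys ! k), \<nu> k] = fst (ws ! k)" for ys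
  proof -
    have "map (\<lambda>k. (wprod M [a k (ys ! k), \<nu> k], t (snd (ws ! k)) 1)) [0..<n] = map sp ws"
      using that(3) by (auto intro!: nth_equalityI simp: n_def sp_def case_prod_beta)
    with M.gauge_sw[where n = n and a = a and \<nu> = \<nu> and f = "\<lambda>k. t (snd (ws ! k)) 1", OF a f h that(1,2)]
    show ?thesis by simp
  qed
  have "is_word E (map el ws) \<longleftrightarrow> M.sw (map sp ws)"
  proof
    assume "is_word E (map el ws)"
    then obtain e where e: "e \<in> simplices E n" "spine E n e = map el ws" by (auto simp: is_word_def n_def)
    have "spine H n (\<rho> n e) = map snd ws"
      using smap_spine[OF smap_rho e(1)] ws el_in by (auto simp: e(2) subset_eq)
    then have "\<rho> n e = b" using pm_spine_eqD[OF H.pm smap_in[OF smap_rho e(1)] b(1)] b(2) by simp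
    then have "e \<in> (\<lambda>y. \<phi> n (y, ?id)) ` simplices M n"
      using bij_betw_imp_surj_on[OF \<phi>(2)[OF id]] e(1) unfolding bid by simp
    then obtain y where y: "y \<in> simplices M n" "e = \<phi> n (y, ?id)" by blast
    have ys: "set (spine M n y) \<subseteq> M1" by (rule spine_subset[OF M.ss y(1)])
    have "wprod M [a k (spine M n y ! k), \<nu> k] = fst (ws ! k)" if k: "k < n" for k
    proof -
      have yk: "spine M n y ! k \<in> M1" using ys k nth_mem[of k "spine M n y"] by auto
      have "el (ws ! k) = el (wprod M [a k (spine M n y ! k), \<nu> k], snd (ws ! k))"
        using arg_cong[OF sp_e[OF y(1)], of "\<lambda>l. l ! k"] e(2) y(2) k by (simp add: n_def)
      moreover have ak: "M.waut (a k)" using a k by simp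
      ultimately have "el (fst (ws ! k), snd (ws ! k)) = el (wprod M [a k (spine M n y ! k), \<nu> k], snd (ws ! k))" by simp
      then show ?thesis
        using el_eq_iff[OF wk(1)[OF k] M.mult_iv_cancel(3)[OF h[OF k] ak M.waut_in[OF ak yk]] wk(2)[OF k]] by simp
    qed
    then show "M.sw (map sp ws)" using gauge[OF ys] is_word_spine[OF y(1)] by simp
  next
    assume sw: "M.sw (map sp ws)"
    obtain ys where ys: "set ys \<subseteq> M1" "length ys = n"
      and k: "\<And>k. k < n \<Longrightarrow> wprod M [a k (ys ! k), \<nu> k] = fst (ws ! k)"
      using M.gauge_solve[where n = n and a = a and \<nu> = \<nu> and f = "\<lambda>k. t (snd (ws ! k)) 1" and x = "\<lambda>k. fst (ws ! k)",
          OF a f h wk(1)] by blast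
    have "is_word M ys" using gauge[OF ys] k sw by simp
    from word_simplex[OF M.pm this ys(2)] have y: "word M ys \<in> simplices M n" "spine M n (word M ys) = ys" by auto
    have "spine E n (\<phi> n (word M ys, ?id)) = map el ws"
      unfolding sp_e[OF y(1)] y(2) using k by (auto intro!: nth_equalityI simp: n_def)
    moreover have "\<phi> n (word M ys, ?id) \<in> simplices E n" using bij_betwE[OF \<phi>(2)[OF id]] y(1) by blast
    ultimately show "is_word E (map el ws)" using is_word_spine by metis
  qed
  then show ?thesis using True by simp
qed

lemma el_word:
  assumes "set ws \<subseteq> M1 \<times> H1" "is_word H (map snd ws)" "is_word M (tws (map sp ws))"
  shows "is_word E (map el ws)"
  using assms t_waut is_word_el[OF assms(1)] by (auto simp: M.sw_def sp_def)

lemma el_wordD: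
  "set ws \<subseteq> M1 \<times> H1 \<Longrightarrow> is_word E (map el ws) \<Longrightarrow> is_word M (tws (map sp ws))"
  using is_word_el by (simp add: M.sw_def)

lemma rho_s: "g \<in> H1 \<Longrightarrow> \<rho> 1 (s g) = g"
  using el_in[OF one_in[OF M.pm], of g] el_one(2) by simp

lemma ss_word: "is_word H [g, h] \<Longrightarrow> is_word E [s g, s h]"
proof -
  assume gh: "is_word H [g, h]"
  have v: "g \<in> H1" "h \<in> H1" using H.is_word_in[OF gh] by auto
  have "is_word E (map el [(one M, g), (one M, h)])"
    by (rule el_word) (use v gh one_in[OF M.pm] M.D_one M.D_e1 M.waut_one[OF t_waut] in \<open>auto simp: sp_def\<close>)
  then show ?thesis by (simp add: el_one v)
qed

section \<open>The twisting pair of an extension\<close>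

definition \<eta> :: "'b \<Rightarrow> 'a" where
  "\<eta> u = (SOME x. x \<in> M1 \<and> el (x, wprod H (spine H 2 u)) = wprod E (map s (spine H 2 u)))"

abbreviation "eta g h \<equiv> \<eta> (word H [g, h])"

lemma eta:
  assumes gh: "is_word H [g, h]"
  shows "eta g h \<in> M1" "el (eta g h, wprod H [g, h]) = wprod E [s g, s h]"
proof -
  note w = ss_word[OF gh]
  have v: "g \<in> H1" "h \<in> H1" using H.is_word_in[OF gh] by auto
  have "\<rho> 1 (wprod E [s g, s h]) = wprod H [g, h]"
    using smap_wprod[OF smap_rho pm_E H.pm w] v by (simp add: rho_s)
  then have "wprod E [s g, s h] \<in> (\<lambda>x. el (x, wprod H [g, h])) ` M1"
    using bij_betw_imp_surj_on[OF el_bij[OF H.mult_in[OF gh]]] E.mult_in[OF w] by simp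
  then have ex: "\<exists>x. x \<in> M1 \<and> el (x, wprod H [g, h]) = wprod E [s g, s h]" by force
  have sp2: "spine H 2 (word H [g, h]) = [g, h]" using word_simplex[OF H.pm gh, of 2] by simp
  have "eta g h \<in> M1 \<and> el (eta g h, wprod H [g, h]) = wprod E [s g, s h]"
    unfolding \<eta>_def sp2 list.map by (rule someI_ex[OF ex])
  then show "eta g h \<in> M1" "el (eta g h, wprod H [g, h]) = wprod E [s g, s h]" by auto
qed

lemma swap: "g \<in> H1 \<Longrightarrow> x \<in> M1 \<Longrightarrow> wprod E [i 1 (t g 1 x), s g] = wprod E [s g, i 1 x]"
  using intertwines_comm[OF s_intertwines] by simp

lemma pair: "is_word H [g, h] \<Longrightarrow> wprod E [i 1 (eta g h), s (wprod H [g, h])] = wprod E [s g, s h]"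
  using eta(2) by (simp add: el_def)

lemma E_mid: "\<lbrakk>is_word E (a @ [p, q] @ c); is_word E (a @ [p', q'] @ c); wprod E [p, q] = wprod E [p', q']\<rbrakk>
    \<Longrightarrow> E.prd (a @ [p, q] @ c) = E.prd (a @ [p', q'] @ c)"
  by (rule E.prd_mid) (use E.prd_pair E.D_factor[of a "[p, q]" c] E.D_factor[of a "[p', q']" c] in simp_all)

text \<open>Words in the \<open>i x\<close> (\<open>Inl x\<close>) and the \<open>s g\<close> (\<open>Inr g\<close>).\<close>

definition gen :: "'a + 'b \<Rightarrow> 'a \<times> 'b" where
  "gen c = (case c of Inl x \<Rightarrow> (x, one H) | Inr g \<Rightarrow> (one M, g))"

definition egen :: "'a + 'b \<Rightarrow> 'e" where
  "egen c = (case c of Inl x \<Rightarrow> i 1 x | Inr g \<Rightarrow> s g)"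

text \<open>The calculations in \<open>E\<close> pass through words in the letters
  \<open>i 1 x\<close> and \<open>s g\<close>. Their existence is traced to words in
  \<open>M\<close> and in \<open>H\<close>, where a letter of the other kind becomes a unit and can
  be left out by \<open>D_es\<close>.\<close>

lemma gen_word:
  assumes "set cs \<subseteq> Inl ` M1 \<union> Inr ` H1" "is_word H (map (snd \<circ> gen) cs)" "is_word M (tws (map (sp \<circ> gen) cs))"
  shows "is_word E (map egen cs)"
proof -
  have "el (gen c) = egen c \<and> gen c \<in> M1 \<times> H1" if "c \<in> set cs" for c
    using that assms(1) one_in[OF M.pm] one_in[OF H.pm] by (auto simp: gen_def egen_def el_one)
  then have "map el (map gen cs) = map egen cs" "gen ` set cs \<subseteq> M1 \<times> H1" by (simp_all add: image_subset_iff)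
  note eq = this
  have "is_word E (map el (map gen cs))" by (rule el_word) (use eq(2) assms(2,3) in simp_all)
  then show ?thesis by (simp only: eq(1))
qed

lemma el_prd:
  assumes xy: "is_word M [x, y]" and w: "is_word E [i 1 x, i 1 y, s k]"
  shows "el (wprod M [x, y], k) = E.prd [i 1 x, i 1 y, s k]"
  using smap_wprod[OF smap_i M.pm pm_E xy] E.prd_triple[OF w] E.assoc[OF w] by (simp add: el_def del: foldl.simps)

lemma t_unit: "g \<in> H1 \<Longrightarrow> t g 1 (one M) = one M"
  by (rule M.waut_one[OF t_waut])

lemmas gens = gen_def egen_def sp_def t_unit t_one H.is_word_1 M.is_word_1
lemmas D_es = M.D_e1 M.D_e2 M.D_e3 M.D_e4 M.D_Nil H.D_e1 H.D_e2 H.D_e3 H.D_e4 H.D_Nil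

text \<open>Between letters of the fibre, \<open>s g\<close> and \<open>s h\<close> are exchanged
  for \<open>eta g h\<close> and \<open>s\<close> of the product. The twisted spines before and
  after give the words, and uniqueness of the first component gives the relation.\<close>

lemma eta_intertwines:
  assumes gh: "is_word H [g, h]"
  shows "intertwines M M (t g 1 \<circ> t h 1) (eta g h) (t (wprod H [g, h]) 1)"
proof -
  define k where "k = wprod H [g, h]"
  have v: "g \<in> H1" "h \<in> H1" "k \<in> H1" using H.is_word_in[OF gh] H.mult_in[OF gh] by (auto simp: k_def)
  note o = one_in[OF M.pm] one_in[OF H.pm]
  note e = eta[OF gh, folded k_def]
  define f where "f = t g 1 \<circ> t h 1"
  have f: "M.waut f" unfolding f_def by (intro M.waut_comp t_waut v)
  have to: "map (t (one H) 1) xs = xs" if "set xs \<subseteq> M1" for xs using that by (intro map_idI t_one) auto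
  have spp: "sp (x, g) = (x, t g 1)" for x g by (simp add: sp_def)
  have w: "is_word M (map f u @ [eta g h] @ map (t k 1) v)" if uv: "is_word M (u @ v)" for u v
  proof -
    let ?a = "map (\<lambda>x. (f x, one H)) u" and ?c = "map (\<lambda>x. (x, one H)) v"
    have uv1: "set u \<subseteq> M1" "set v \<subseteq> M1" "set (map f u) \<subseteq> M1"
      using M.is_word_set[OF uv] M.waut_in[OF f] by auto
    have a_in: "set ?a \<subseteq> M1 \<times> H1" "set ?c \<subseteq> M1 \<times> H1" using uv1 o by auto
    have tws_c: "tws (map sp ?c) = v"
      using M.tws_unit_prefix[OF t_one uv1(2), of "[]"] by (simp add: sp_def comp_def)
    have tws_a: "tws (map sp (?a @ c)) = map f u @ tws (map sp c)" if "set (tws (map sp c)) \<subseteq> M1" for c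
      using M.tws_unit_prefix[OF t_one uv1(3) that] by (simp add: sp_def comp_def)
    have Hu: "is_word H (map snd (?a @ b @ ?c))" if "is_word H (map snd b)" for b
      using H.D_replicate[OF that, of "length u" "length v"] by (simp add: comp_def map_replicate_const)
    have fv: "map (t g 1) (map (t h 1) v) = map f v" by (simp add: f_def)
    have fv1: "set (map f v) \<subseteq> M1" using uv1(2) M.waut_in[OF f] by auto
    have 1: "tws (map sp ([(one M, g), (one M, h)] @ ?c)) = [one M, one M] @ map f v"
      by (simp only: append.simps list.map spp tws.simps tws_c fv t_unit[OF v(1)])
    \<comment> \<open>In \<open>E\<close> this is the word of the fibre letters
      \<open>map f u\<close>, then \<open>s g\<close> and \<open>s h\<close>, then the fibre letters
      \<open>v\<close>. Its twisted spine is the image of \<open>u @ v\<close> under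
      \<open>f\<close> with two units inserted.\<close>
    have "is_word E (map el (?a @ [(one M, g), (one M, h)] @ ?c))"
    proof (rule el_word)
      have "is_word M (map f u @ [one M] @ [one M] @ map f v)"
        by (intro M.D_unit) (use M.waut_word'[OF f uv] in simp)
      then show "is_word M (tws (map sp (?a @ [(one M, g), (one M, h)] @ ?c)))"
        using fv1 o by (subst tws_a) (simp_all only: 1, auto)
      show "is_word H (map snd (?a @ [(one M, g), (one M, h)] @ ?c))" by (rule Hu) (use gh in simp)
    qed (use a_in v o in auto)
    then have "is_word E (map el ?a @ [s g, s h] @ map el ?c)" using v by (simp add: el_one)
    \<comment> \<open>Contracting \<open>s g\<close> and \<open>s h\<close> produces the letter
      \<open>el (eta g h, k)\<close>, and the twisted spine of the new word has
      \<open>eta g h\<close> in the desired place.\<close>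
    from E.D_contract[OF this] have "is_word E (map el (?a @ [(eta g h, k)] @ ?c))" using e(2) by simp
    from el_wordD[OF _ this] have 2: "is_word M (tws (map sp (?a @ [(eta g h, k)] @ ?c)))"
      using a_in v e(1) by auto
    have 3: "tws (map sp ([(eta g h, k)] @ ?c)) = eta g h # map (t k 1) v"
      by (simp only: append.simps list.map spp tws.simps tws_c)
    have "set (map (t k 1) v) \<subseteq> M1" using uv1(2) M.waut_in[OF t_waut[OF v(3)]] by auto
    then show ?thesis using 2 e(1) by (subst (asm) tws_a) (simp_all only: 3, auto)
  qed
  moreover have "wprod M [f x, eta g h] = wprod M [eta g h, t k 1 x]" if x: "x \<in> M1" for x
  proof -
    have hx: "t h 1 x \<in> M1" by (rule M.waut_in[OF t_waut[OF v(2)] x])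
    have fx: "f x \<in> M1" "t g 1 (t h 1 x) = f x" using M.waut_in[OF f x] by (simp_all add: f_def)
    have kx: "t k 1 x \<in> M1" by (rule M.waut_in[OF t_waut[OF v(3)] x])
    have mw: "is_word M [f x, eta g h]" "is_word M [eta g h, t k 1 x]"
      using w[of "[x]" "[]"] w[of "[]" "[x]"] x by (simp_all add: M.is_word_1)
    note facts = v o e(1) x hx fx kx mw gh
    have "is_word E (map egen [Inl (f x), Inl (eta g h), Inr k])"
      and "is_word E (map egen [Inl (f x), Inr g, Inr h])"
      and "is_word E (map egen [Inr g, Inl (t h 1 x), Inr h])"
      and "is_word E (map egen [Inr g, Inr h, Inl x])"
      and "is_word E (map egen [Inl (eta g h), Inr k, Inl x])"
      and "is_word E (map egen [Inl (eta g h), Inl (t k 1 x), Inr k])"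
      by (rule gen_word; use facts in \<open>auto simp: gens intro!: D_es\<close>)+
    note W = this[unfolded egen_def, simplified]
    \<comment> \<open>The letter \<open>f x\<close> moves to the right through \<open>s g\<close>
      and \<open>s h\<close>, becoming \<open>x\<close>, and back through \<open>s k\<close>,
      becoming \<open>t k 1 x\<close>.\<close>
    have "E.prd ([i 1 (f x)] @ [i 1 (eta g h), s k] @ []) = E.prd ([i 1 (f x)] @ [s g, s h] @ [])"
      by (rule E_mid) (use W pair[OF gh] in \<open>simp_all add: k_def\<close>)
    also have "\<dots> = E.prd ([] @ [i 1 (f x), s g] @ [s h])" by simp
    also have "\<dots> = E.prd ([] @ [s g, i 1 (t h 1 x)] @ [s h])"
      by (rule E_mid) (use W swap[OF v(1) hx] fx(2) in simp_all)
    also have "\<dots> = E.prd ([s g] @ [i 1 (t h 1 x), s h] @ [])" by simp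
    also have "\<dots> = E.prd ([s g] @ [s h, i 1 x] @ [])"
      by (rule E_mid) (use W swap[OF v(2) x] in simp_all)
    also have "\<dots> = E.prd ([] @ [s g, s h] @ [i 1 x])" by simp
    also have "\<dots> = E.prd ([] @ [i 1 (eta g h), s k] @ [i 1 x])"
      by (rule E_mid) (use W pair[OF gh] in \<open>simp_all add: k_def\<close>)
    also have "\<dots> = E.prd ([i 1 (eta g h)] @ [s k, i 1 x] @ [])" by simp
    also have "\<dots> = E.prd ([i 1 (eta g h)] @ [i 1 (t k 1 x), s k] @ [])"
      by (rule E_mid) (use W swap[OF v(3) x] in simp_all)
    finally have "el (wprod M [f x, eta g h], k) = el (wprod M [eta g h, t k 1 x], k)"
      using el_prd[OF mw(1) W(1)] el_prd[OF mw(2) W(6)] by simp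
    then show ?thesis using el_eq_iff[OF M.mult_in[OF mw(1)] M.mult_in[OF mw(2)] v(3)] by simp
  qed
  ultimately show ?thesis unfolding intertwines_def f_def[symmetric] k_def[symmetric] by blast
qed

lemma eta_append: "\<lbrakk>is_word H [g, h]; is_word M xs\<rbrakk> \<Longrightarrow> is_word M (xs @ [eta g h])"
  using H.is_word_in[of "[g, h]"]
  by (intro M.intw_append'[OF eta_intertwines] M.waut_comp t_waut) auto

lemma eta_one: assumes g: "g \<in> H1" shows "eta g (one H) = one M" "eta (one H) g = one M"
proof -
  have w: "is_word H [g, one H]" "is_word H [one H, g]" using g H.D_e1 H.D_e2 by (simp_all add: H.is_word_1)
  have m: "wprod H [g, one H] = g" "wprod H [one H, g] = g" using g H.m_e H.e_m by (simp_all add: H.is_word_1)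
  have sg: "wprod E [s g, one E] = s g" "wprod E [one E, s g] = s g" using E.m_e E.e_m s_in[OF g] by (simp_all add: E.is_word_1)
  have "el (eta g (one H), g) = el (one M, g)" "el (eta (one H) g, g) = el (one M, g)"
    using eta(2)[OF w(1)] eta(2)[OF w(2)] m sg by (simp_all add: s_one el_one(2)[OF g])
  then show "eta g (one H) = one M" "eta (one H) g = one M"
    using el_eq_iff[OF eta(1)[OF w(1)] one_in[OF M.pm] g] el_eq_iff[OF eta(1)[OF w(2)] one_in[OF M.pm] g] by blast+
qed

text \<open>Followed by \<open>s\<close> of the triple product, both sides equal the product of
  \<open>s g\<close>, \<open>s h\<close> and \<open>s k\<close>, bracketed from the right and from
  the left.\<close>

lemma eta_cocycle:
  assumes ghk: "is_word H [g, h, k]"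
  shows "is_word M [t g 1 (eta h k), eta g (wprod H [h, k])]" "is_word M [eta g h, eta (wprod H [g, h]) k]"
    and "wprod M [t g 1 (eta h k), eta g (wprod H [h, k])] = wprod M [eta g h, eta (wprod H [g, h]) k]"
proof -
  define gh hk j where "gh = wprod H [g, h]" and "hk = wprod H [h, k]" and "j = wprod H [gh, k]"
  have W: "is_word H [g, h]" "is_word H [h, k]" "is_word H [gh, k]" "is_word H [g, hk]"
    using H.D_prefix[of "[g, h]" "[k]"] H.D_Cons[of g "[h, k]"] H.D_contract[of "[]" g h "[k]"] H.D_contract[of "[g]" h k "[]"] ghk
    by (auto simp: gh_def hk_def)
  have j: "wprod H [g, hk] = j" using H.assoc[OF ghk] by (simp add: j_def gh_def hk_def)
  have v: "g \<in> H1" "h \<in> H1" "k \<in> H1" "gh \<in> H1" "hk \<in> H1" "j \<in> H1"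
    using H.is_word_in[OF ghk] H.mult_in W by (auto simp: gh_def hk_def j_def)
  define e1 e2 e3 e4 te where "e1 = eta g h" and "e2 = eta gh k" and "e3 = eta h k" and "e4 = eta g hk" and "te = t g 1 e3"
  have e: "e1 \<in> M1" "e2 \<in> M1" "e3 \<in> M1" "e4 \<in> M1" using eta(1) W by (simp_all add: e1_def e2_def e3_def e4_def)
  have te: "te \<in> M1" using M.waut_in[OF t_waut[OF v(1)] e(3)] by (simp add: te_def)
  have mw: "is_word M [te, e4]" "is_word M [e1, e2]"
    using eta_append[OF W(4), of "[te]"] eta_append[OF W(3), of "[e1]"] te e by (simp_all add: M.is_word_1 e4_def e2_def)
  then show "is_word M [t g 1 (eta h k), eta g (wprod H [h, k])]" "is_word M [eta g h, eta (wprod H [g, h]) k]"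
    by (simp_all add: te_def e1_def e2_def e3_def e4_def gh_def hk_def)
  note o = one_in[OF M.pm] one_in[OF H.pm]
  note facts = v o e te mw W ghk te_def[symmetric]
  have "is_word E (map egen [Inl e1, Inl e2, Inr j])"
    and "is_word E (map egen [Inl e1, Inr gh, Inr k])"
    and "is_word E (map egen [Inr g, Inr h, Inr k])"
    and "is_word E (map egen [Inr g, Inl e3, Inr hk])"
    and "is_word E (map egen [Inl te, Inr g, Inr hk])"
    and "is_word E (map egen [Inl te, Inl e4, Inr j])"
    by (rule gen_word; use facts in \<open>auto simp: gens intro!: D_es\<close>)+
  note V = this[unfolded egen_def, simplified]
  have "E.prd ([i 1 e1] @ [i 1 e2, s j] @ []) = E.prd ([i 1 e1] @ [s gh, s k] @ [])"
    by (rule E_mid) (use V pair[OF W(3)] in \<open>simp_all add: e2_def j_def\<close>)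
  also have "\<dots> = E.prd ([] @ [i 1 e1, s gh] @ [s k])" by simp
  also have "\<dots> = E.prd ([] @ [s g, s h] @ [s k])"
    by (rule E_mid) (use V pair[OF W(1)] in \<open>simp_all add: e1_def gh_def\<close>)
  also have "\<dots> = E.prd ([s g] @ [s h, s k] @ [])" by simp
  also have "\<dots> = E.prd ([s g] @ [i 1 e3, s hk] @ [])"
    by (rule E_mid) (use V pair[OF W(2)] in \<open>simp_all add: e3_def hk_def\<close>)
  also have "\<dots> = E.prd ([] @ [s g, i 1 e3] @ [s hk])" by simp
  also have "\<dots> = E.prd ([] @ [i 1 te, s g] @ [s hk])"
    by (rule E_mid) (use V swap[OF v(1) e(3)] in \<open>simp_all add: te_def\<close>)
  also have "\<dots> = E.prd ([i 1 te] @ [s g, s hk] @ [])" by simp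
  also have "\<dots> = E.prd ([i 1 te] @ [i 1 e4, s j] @ [])"
    by (rule E_mid) (use V pair[OF W(4), unfolded j] in \<open>simp_all add: e4_def\<close>)
  finally have "el (wprod M [te, e4], j) = el (wprod M [e1, e2], j)"
    using el_prd[OF mw(1) V(6)] el_prd[OF mw(2) V(1)] by simp
  then have "wprod M [te, e4] = wprod M [e1, e2]"
    using el_eq_iff[OF M.mult_in[OF mw(1)] M.mult_in[OF mw(2)] v(6)] by simp
  then show "wprod M [t g 1 (eta h k), eta g (wprod H [h, k])] = wprod M [eta g h, eta (wprod H [g, h]) k]"
    by (simp add: te_def e1_def e2_def e3_def e4_def gh_def hk_def)
qed

lemma smap_sid: "sset X \<Longrightarrow> smap X X (sid X)"
  by (rule smapI) (auto simp: sid_def act_in)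

lemma twisting_pair_extn: "twisting_pair M H t \<eta>"
proof -
  have st: "smap M M (t g)" if "g \<in> H1" for g
    using t_Aut[OF that] siso_smap by (simp add: Aut_def)
  have norm: "\<eta> u \<in> normalizer M" if u: "u \<in> simplices H 2" for u
  proof -
    obtain g h where gh: "is_word H [g, h]" "u = word H [g, h]"
      using is_word_spine[OF u] word_spine[OF H.pm u] unfolding spine_2 by metis
    define k where "k = wprod H [g, h]"
    have v: "g \<in> H1" "h \<in> H1" "k \<in> H1" using H.is_word_in[OF gh(1)] H.mult_in[OF gh(1)] by (auto simp: k_def)
    \<comment> \<open>The automorphism demanded by the normalizer: the relation for
      \<open>eta g h\<close> is precomposed with the inverse of \<open>t k 1\<close>, which leaves
      the identity on one side.\<close>
    define f where "f = t g 1 \<circ> t h 1 \<circ> M.finv (t k 1)"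
    have fk: "M.waut (M.finv (t k 1))" by (rule M.waut_finv[OF t_waut[OF v(3)]])
    have f: "M.waut f" unfolding f_def by (intro M.waut_comp t_waut v fk)
    have i: "intertwines M M f (eta g h) (t k 1 \<circ> M.finv (t k 1))"
      unfolding f_def using M.intw_comp_right[OF eta_intertwines[OF gh(1)] fk] by (simp only: k_def)
    have "intertwines M M (wmap M M f 1) (eta g h) (sid M 1)"
      by (rule M.intw_cong[OF i]) (simp_all add: M.smap_waut(2)[OF f] sid_def M.finv(2)[OF t_waut[OF v(3)]])
    from intertwines_htpc[OF M.pm M.pm M.smap_waut(1)[OF f] smap_sid[OF M.ss] this] M.waut_Aut[OF f] eta(1)[OF gh(1)]
    show ?thesis unfolding normalizer_def gh(2) by blast
  qed
  have hom: "htpc M M (scomp M (t g) (t h)) (eta g h) (t (wprod H [g, h]))" if gh: "is_word H [g, h]" for g h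
  proof -
    have v: "g \<in> H1" "h \<in> H1" "wprod H [g, h] \<in> H1" using H.is_word_in[OF gh] H.mult_in[OF gh] by auto
    show ?thesis
      by (rule intertwines_htpc[OF M.pm M.pm smap_scomp[OF M.ss st[OF v(2)] st[OF v(1)]] st[OF v(3)]],
        rule M.intw_cong[OF eta_intertwines[OF gh]]) (simp_all add: scomp_app)
  qed
  have t1: "t (one H) = sid M"
    by (rule smap_eqI_1[OF st[OF one_in[OF H.pm]] smap_sid[OF M.ss] M.pm M.ss]) (simp add: t_one sid_def)
  show ?thesis
    unfolding twisting_pair_def Let_def
    using t_Aut norm hom t1 eta_one eta_cocycle by (intro conjI allI impI ballI funcsetI) simp_all
qed

section \<open>The equivalence with the twisted product\<close>

sublocale TW: twist M H t \<eta>
  by unfold_locales (rule twisting_pair_extn)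

lemma tword_iff: "set ws \<subseteq> M1 \<times> H1 \<Longrightarrow> TW.tword ws \<longleftrightarrow> is_word E (map el ws)"
  using is_word_el[of ws] TW.tword_sw[of ws] by (simp add: sp_def TW.sp_def)

lemma tword_el: "TW.tword ws \<Longrightarrow> is_word E (map el ws)"
  using tword_iff TW.tword_def by blast

text \<open>The factor \<open>s g\<close> passes \<open>i 1 z\<close> at the price of
  \<open>t g 1\<close>, and then \<open>s g\<close> and \<open>s h\<close> merge into
  \<open>eta g h\<close> and \<open>s\<close> of the product. This is the origin of the formula for
  the twisted product.\<close>

lemma el_tw: assumes w: "TW.tword [p, q]" shows "el (TW.tw p q) = wprod E [el p, el q]"
proof -
  obtain x g z h where pq: "p = (x, g)" "q = (z, h)" by (cases p, cases q)
  note tw = TW.tw_pair[OF w[unfolded pq]]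
  define k tz e where "k = wprod H [g, h]" and "tz = t g 1 z" and "e = eta g h"
  have v: "x \<in> M1" "z \<in> M1" "g \<in> H1" "h \<in> H1" "k \<in> H1"
    using w H.mult_in[OF tw(3)] by (auto simp: pq TW.tword_def k_def)
  note o = one_in[OF M.pm] one_in[OF H.pm]
  have e: "e \<in> M1" "tz \<in> M1" using eta(1)[OF tw(3)] M.waut_in[OF t_waut[OF v(3)] v(2)] by (simp_all add: e_def tz_def)
  have mw: "is_word M [x, tz]" "is_word M [x, tz, e]" using tw(1,2) by (simp_all add: tz_def e_def)
  note facts = v o e mw tw(3) tz_def[symmetric]
  have "is_word E (map egen [Inl x, Inr g, Inl z, Inr h])"
    and "is_word E (map egen [Inl x, Inl tz, Inr g, Inr h])"
    and "is_word E (map egen [Inl x, Inl tz, Inl e, Inr k])"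
    by (rule gen_word; use facts in \<open>auto simp: gens intro!: D_es\<close>)+
  note V = this[unfolded egen_def, simplified]
  have 1: "is_word E ([i 1 x, s g] @ [i 1 z, s h])" using V(1) by simp
  have "wprod E [el p, el q] = E.prd ([i 1 x, s g] @ [i 1 z, s h])"
    using E.prd_append[OF 1] E.prd_pair[OF E.D_prefix[OF 1]] E.prd_pair[OF E.D_suffix[OF 1]]
    by (simp only: pq el_def fst_conv snd_conv)
  also have "\<dots> = E.prd ([i 1 x] @ [s g, i 1 z] @ [s h])" by simp
  also have "\<dots> = E.prd ([i 1 x] @ [i 1 tz, s g] @ [s h])"
    by (rule E_mid) (use V swap[OF v(3,2)] in \<open>simp_all add: tz_def\<close>)
  also have "\<dots> = E.prd ([i 1 x, i 1 tz] @ [s g, s h] @ [])" by simp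
  also have "\<dots> = E.prd ([i 1 x, i 1 tz] @ [i 1 e, s k] @ [])"
    by (rule E_mid) (use V pair[OF tw(3)] in \<open>simp_all add: e_def k_def\<close>)
  also have "\<dots> = E.prd (map (i 1) [x, tz, e] @ [s k])" by simp
  also have "\<dots> = wprod E [i 1 (wprod M [x, tz, e]), s k]"
  proof -
    have 2: "is_word E (map (i 1) [x, tz, e] @ [s k])" using V(3) by simp
    have "E.prd [s k] = s k" using E.prd_single E.D_suffix[OF 2] by blast
    then show ?thesis
      using E.prd_append[OF 2] smap_wprod[OF smap_i M.pm pm_E mw(2)] E.wprod_prd[OF E.D_prefix[OF 2]] by (simp only:)
  qed
  also have "\<dots> = el (TW.tw p q)" unfolding pq tw(5) by (simp add: el_def tz_def e_def k_def)
  finally show ?thesis ..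
qed

definition Psi :: "nat \<Rightarrow> ('a \<times> 'b) list \<Rightarrow> 'e" where
  "Psi = (\<lambda>n. \<lambda>ws\<in>simplices TW.TT n. word E (map el ws))"

lemma el_11: "el (one M, one H) = one E"
  using el_one(1)[OF one_in[OF M.pm]] i_one by simp

lemma smap_Psi: "smap TW.TT E Psi"
  unfolding Psi_def by (rule TW.T.smap_from_word_sset[OF pm_E]) (simp_all only: tword_el el_tw el_11)

lemma tword_set: "TW.tword ws \<Longrightarrow> set ws \<subseteq> M1 \<times> H1"
  by (simp add: TW.tword_def)

lemma el_words: assumes "is_word E es" obtains ws where "TW.tword ws" "es = map el ws"
proof -
  have "\<exists>p. p \<in> M1 \<times> H1 \<and> e = el p" if "e \<in> set es" for e
    using el_surj[OF E.is_word_in[OF assms that]] by blast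
  then obtain f where f: "\<And>e. e \<in> set es \<Longrightarrow> f e \<in> M1 \<times> H1 \<and> e = el (f e)" by metis
  then have "map el (map f es) = es" "f ` set es \<subseteq> M1 \<times> H1"
    by (auto intro!: map_idI simp del: mem_Times_iff, fastforce+)
  then show ?thesis using that[of "map f es"] tword_iff[of "map f es"] assms by simp
qed

lemma spine_Psi: "ws \<in> simplices TW.TT n \<Longrightarrow> Psi n ws \<in> simplices E n \<and> spine E n (Psi n ws) = map el ws"
  using word_simplex[OF pm_E, of "map el ws" n] tword_el by (simp add: Psi_def TW.T.simplices_word_sset)

lemma siso_Psi: "siso TW.TT E Psi"
proof (rule sisoI[OF TW.T.sset_word_sset smap_Psi])
  show "bij_betw (Psi n) (simplices TW.TT n) (simplices E n)" for n
  proof (rule bij_betwI')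
    fix ws vs assume w: "ws \<in> simplices TW.TT n" and v: "vs \<in> simplices TW.TT n"
    then have s: "set ws \<subseteq> M1 \<times> H1" "set vs \<subseteq> M1 \<times> H1" using tword_set by (simp_all add: TW.T.simplices_word_sset)
    show "Psi n ws = Psi n vs \<longleftrightarrow> ws = vs"
    proof
      assume "Psi n ws = Psi n vs"
      then have "map el ws = map el vs" using spine_Psi[OF w] spine_Psi[OF v] by metis
      moreover have "inj_on el (set ws \<union> set vs)" using s el_inj by (intro inj_onI) blast
      ultimately show "ws = vs" by (simp add: inj_on_map_eq_map)
    qed simp
  next
    fix ws assume "ws \<in> simplices TW.TT n"
    then show "Psi n ws \<in> simplices E n" using spine_Psi by blast
  next
    fix e assume e: "e \<in> simplices E n"
    obtain ws where ws: "TW.tword ws" "spine E n e = map el ws" using el_words[OF is_word_spine[OF e]] .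
    have "length ws = n" using arg_cong[OF ws(2), of length] by simp
    then have w: "ws \<in> simplices TW.TT n" using ws by (simp add: TW.T.simplices_word_sset)
    have "e = Psi n ws" by (rule pm_spine_eqD[OF pm_E e]) (use spine_Psi[OF w] ws(2) in simp_all)
    then show "\<exists>ws\<in>simplices TW.TT n. e = Psi n ws" using w by blast
  qed
qed

lemma Psi_1: "p \<in> M1 \<times> H1 \<Longrightarrow> Psi 1 [p] = el p"
  using spine_Psi[of "[p]" 1] spine_1[OF sset_E, of "Psi 1 [p]"] by (simp add: TW.simplices_TT_1 image_iff)

lemma equivalent_extn:
  "equivalent_extensions M (twisted_product M H t \<eta>) (tw_incl M H) (tw_proj M H t \<eta>) E i \<rho>"
proof -
  have "scomp M Psi (tw_incl M H) = i"
  proof (rule smap_eqI_1[OF smap_scomp[OF M.ss TW.smap_tw_incl smap_Psi] smap_i pm_E M.ss])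
    fix x assume x: "x \<in> M1"
    show "scomp M Psi (tw_incl M H) 1 x = i 1 x"
      unfolding scomp_app[OF x] TW.tw_incl_1[OF x] using Psi_1[of "(x, one H)"] x one_in[OF H.pm] el_one(1)[OF x] by simp
  qed
  moreover have "scomp TW.TT \<rho> Psi = TW.\<tau>"
  proof (rule smap_eqI_1[OF smap_scomp[OF TW.T.sset_word_sset smap_Psi smap_rho] TW.smap_tau H.pm TW.T.sset_word_sset])
    fix ws assume ws: "ws \<in> simplices TW.TT 1"
    then obtain x g where p: "ws = [(x, g)]" "x \<in> M1" "g \<in> H1" by (auto simp: TW.simplices_TT_1)
    have "spine H 1 (TW.\<tau> 1 ws) = [g]" using TW.spine_tau[OF ws] p by simp
    then have "TW.\<tau> 1 ws = g" using spine_1[OF H.ss smap_in[OF TW.smap_tau ws]] by simp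
    then show "scomp TW.TT \<rho> Psi 1 ws = TW.\<tau> 1 ws"
      unfolding scomp_app[OF ws] using Psi_1[of "(x, g)"] el_in[of x g] p by simp
  qed
  ultimately show ?thesis
    unfolding equivalent_extensions_def TW.twisted_product_eq using siso_Psi by blast
qed

text \<open>Inverses of letters are carried over from the twisted product along the bijection
  \<open>el\<close>. Words and products correspond under \<open>el\<close>, so the letterwise
  criterion for an inversion applies.\<close>

lemma partial_group_E: "partial_group E"
proof -
  define iv where "iv e = el (TW.ivp (inv_into (M1 \<times> H1) el e))" for e
  have inj: "inj_on el (M1 \<times> H1)" using el_inj by (intro inj_onI) blast
  have iv: "iv (el p) = el (TW.ivp p)" if "p \<in> M1 \<times> H1" for p
    unfolding iv_def inv_into_f_f[OF inj that] ..
  have "inversion E (\<lambda>n. \<lambda>u\<in>simplices E n. word E (rev (map iv (spine E n u))))"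
  proof (rule E.inversion_of_words)
    show "is_word E (rev (map iv es) @ es)" if es: "is_word E es" for es
    proof -
      obtain ws where ws: "TW.tword ws" "es = map el ws" using el_words[OF es] .
      have "map iv es = map el (map TW.ivp ws)" using tword_set[OF ws(1)] iv by (auto simp: ws(2))
      then have "rev (map iv es) @ es = map el (rev (map TW.ivp ws) @ ws)" by (simp add: ws(2) rev_map)
      then show ?thesis using tword_el[OF TW.T.D_inv[OF ws(1)]] by simp
    qed
    show "wprod E [iv e, e] = one E" if e: "e \<in> simplices E 1" for e
    proof -
      obtain p where p: "p \<in> M1 \<times> H1" "e = el p" using el_surj[OF e] .
      have w: "TW.tword [p]" using p(1) by (cases p) (simp add: TW.tword_single)
      have "TW.tword [TW.ivp p, p]" using TW.T.D_inv[OF w] by simp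
      from el_tw[OF this] show ?thesis using TW.T.iv_m[OF w] by (simp add: p iv el_11)
    qed
  qed
  then show ?thesis using pm_E unfolding partial_group_def by blast
qed

end

theorem theorem4p5:
  fixes M :: "'a sset" and H :: "'b sset"
  assumes M: "partial_group M" and H: "partial_group H"
  shows
    "(\<forall>t \<eta>. twisting_pair M H t \<eta> \<longrightarrow>
      (let T = twisted_product M H t \<eta>; i = tw_incl M H; \<tau> = tw_proj M H t \<eta> in
        extension M T H i \<tau> \<and>
        (\<forall>x\<in>simplices M 1. i 1 x = [(x, one H)]) \<and>
        partial_group T \<and>
        simplices T 1 = (\<lambda>y. [y]) ` (simplices M 1 \<times> simplices H 1) \<and>
        (\<forall>ws. set ws \<subseteq> simplices M 1 \<times> simplices H 1 \<longrightarrow>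
           (is_word T (map (\<lambda>y. [y]) ws) \<longleftrightarrow>
              is_word H (map snd ws) \<and> is_word M (twisted_spine t ws))) \<and>
        (\<forall>x g z h. is_word T [[(x, g)], [(z, h)]] \<longrightarrow>
           is_word M [x, t g 1 z, \<eta> (word H [g, h])] \<and>
           wprod T [[(x, g)], [(z, h)]] =
             [(wprod M [x, t g 1 z, \<eta> (word H [g, h])], wprod H [g, h])]) \<and>
        (\<forall>x\<in>simplices M 1. \<forall>g\<in>simplices H 1.
           is_word H [inv1 H g, g] \<and>
           is_word M [inv1 M (\<eta> (word H [inv1 H g, g])), t (inv1 H g) 1 (inv1 M x)] \<and>
           inv1 T [(x, g)] =
             [(wprod M [inv1 M (\<eta> (word H [inv1 H g, g])), t (inv1 H g) 1 (inv1 M x)], inv1 H g)]) \<and>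
        (\<forall>ws. is_word T (map (\<lambda>y. [y]) ws) \<longrightarrow>
           \<tau> (length ws) (word T (map (\<lambda>y. [y]) ws)) = word H (map snd ws)))) \<and>
    (\<forall>(E :: 'e sset) i \<rho>. extension M E H i \<rho> \<longrightarrow>
      (\<exists>t \<eta>. twisting_pair M H t \<eta> \<and>
        equivalent_extensions M (twisted_product M H t \<eta>) (tw_incl M H) (tw_proj M H t \<eta>) E i \<rho>)) \<and>
    (\<forall>(E :: 'e sset) i \<rho>. extension M E H i \<rho> \<longrightarrow> partial_group E)"
proof (intro conjI allI impI, goal_cases)
  case (1 t \<eta>)
  interpret twist M H t \<eta>
    by (rule twist.intro[OF pgrpI[OF M] pgrpI[OF H]]) (unfold_locales, rule 1)
  show ?case unfolding Let_def twisted_product_eq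
    by (intro conjI allI ballI impI; rule extension_twisted tw_incl_1 T.partial_group_word_sset simplices_TT_1
      is_word_TT_iff pair_TT inv1_TT tau_word; assumption)
next
  case (2 E i \<rho>)
  interpret extn M H E i \<rho>
    by (rule extn.intro[OF pgrpI[OF M] pgrpI[OF H]]) (unfold_locales, rule 2)
  show ?case using twisting_pair_extn equivalent_extn by blast
next
  case (3 E i \<rho>)
  interpret extn M H E i \<rho>
    by (rule extn.intro[OF pgrpI[OF M] pgrpI[OF H]]) (unfold_locales, rule 3)
  show ?case by (rule partial_group_E)
qed

end
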